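(* Let $p,N\ge1$ be integers, $\eta=\{1,\dots,N\}$, and let $\mathscr{L}$, the matrices $\mathbf{B}_\alpha(\mathbf{i})$ ($\alpha\subset\eta$, $\mathbf{i}\in P_{\overline{\alpha}}$) attached to $\mathcal{A}\in\mathscr{L}$, and the algebra isomorphism $\sigma$ be as defined in the context. (i) An operator $\mathcal{A}\in\mathscr{L}$ is invertible if and only if all matrices $\mathbf{B}_\alpha(\mathbf{i})$, $\alpha\subset\eta$, $\mathbf{i}\in P_{\overline{\alpha}}$, are invertible. In this case $$\mathcal{A}^{-1}=\sigma^{-1}\Big(\big((\mathbf{B}_\alpha(\mathbf{i})^{-1})_{\mathbf{i}\in P_{\overline{\alpha}}}\big)_{\alpha\subset\eta}\Big).$$ (ii) The spectrum of $\mathcal{A}\in\mathscr{L}$ consists of all eigenvalues of the matrices $\mathbf{B}_\alpha(\mathbf{i})$, $\alpha\subset\eta$, $\mathbf{i}\in P_{\overline{\alpha}}$. The eigenvalues of $\mathbf{B}_\eta$ form a discrete spectrum; the other eigenvalues belong to the essential spectrum. (iii) The multidimensional trace $\tau$ and the determinant $\pi$ can be defined by $$\tau,\pi:\mathscr{L}\to\prod_{n=0}^N\mathbb{C}^{\binom{N}{n}p^{N-n}}=\mathbb{C}^{(p+1)^N},\qquad \tau(\mathcal{A})=\big((\mathrm{Tr}\,\mathbf{B}_\alpha(\mathbf{i}))_{\mathbf{i}\in P_{\overline{\alpha}}}\big)_{\alpha\subset\eta},\quad \pi(\mathcal{A})=\big((\det\mathbf{B}_\alpha(\mathbf{i}))_{\mathbf{i}\in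 P_{\overline{\alpha}}}\big)_{\alpha\subset\eta}.$$ They satisfy, for all $\lambda,\mu\in\mathbb{C}$ and $\mathcal{A},\mathcal{B}\in\mathscr{L}$, $$\tau(\lambda\mathcal{A}+\mu\mathcal{B})=\lambda\tau(\mathcal{A})+\mu\tau(\mathcal{B}),\quad \tau(\mathcal{A}\mathcal{B})=\tau(\mathcal{B}\mathcal{A}),\quad \pi(\mathcal{A}\mathcal{B})=\pi(\mathcal{A})\pi(\mathcal{B}),\quad \pi(e^{\mathcal{A}})=e^{\tau(\mathcal{A})},$$ where products and exponentials in $\mathbb{C}^{(p+1)^N}$ are componentwise. The operator $\mathcal{A}$ is invertible if and only if all determinants $\det\mathbf{B}_\alpha(\mathbf{i})$ (the components of $\pi(\mathcal{A})$) are nonzero.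
   Context: Notation. Fix integers $p,N\ge1$ and $\eta=\{1,\dots,N\}$. The symbol $\alpha\subset\eta$ allows $\alpha=\emptyset$ and $\alpha=\eta$; $\overline{\alpha}=\eta\setminus\alpha$; $|\alpha|$ is the number of elements of $\alpha$. For $\alpha\subset\eta$, $P_\alpha=\{\mathbf{m}=(m_n)_{n\in\alpha}: m_n\in\{1,\dots,p\}\}$ (so $P_\emptyset$ has one element, the empty multi-index; hence for $\alpha=\eta$ there is a single matrix, denoted $\mathbf{B}_\eta$). For $\mathbf{x}=(x_n)_{n\in\gamma}$ and $\alpha\subset\gamma$, $\mathbf{x}_\alpha=(x_n)_{n\in\alpha}$. For disjoint $\alpha,\beta$ and vectors $\mathbf{x}_\alpha$, $\mathbf{y}_\beta$, $\mathbf{x}_\alpha\diamond\mathbf{y}_\beta=\mathbf{y}_\beta\diamond\mathbf{x}_\alpha$ is the vector $(z_n)_{n\in\alpha\cup\beta}$ with $z_n=x_n$ for $n\in\alpha$ and $z_n=y_n$ for $n\in\beta$. The Kronecker delta is $\delta(x,y)=1$ if $x=y$ and $0$ otherwise (and equals $1$ for two empty multi-indices). For $r\in\{1,\dots,p\}$, $\chi_r(y)=1$ if $y\in[(r-1)/p,r/p)$ and $\chi_r(y)=0$ otherwise. The algebra $\mathscr{L}$. Let $L^2=L^2([0,1)^N)$ be the Hilbert space of square-integrable scalar (complex-valued) functions on the cube $[0,1)^N$. $\mathscr{L}$ is the set of all operators $\mathcal{A}:L^2\to L^2$ of the form $$\mathcal{A}u(\mathbf{k})=\sum_{\alpha\subset\eta}\int_{[0,1)^{|\alpha|}}A_\alpha(\mathbf{k},\mathbf{x}_\alpha)\,u(\mathbf{k}_{\overline{\alpha}}\diamond\mathbf{x}_\alpha)\,d\mathbf{x}_\alpha,$$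 where $d\mathbf{x}_\alpha=\prod_{n\in\alpha}dx_n$ is Lebesgue measure, the term for $\alpha=\emptyset$ is $A_\emptyset(\mathbf{k})u(\mathbf{k})$, and $$A_\alpha(\mathbf{k},\mathbf{x}_\alpha)=\sum_{(\mathbf{i},\mathbf{m})\in P_\eta\times P_\alpha}p^{|\alpha|}a_\alpha(\mathbf{i},\mathbf{m})\prod_{j\in\eta}\chi_{i_j}(k_j)\prod_{n\in\alpha}\chi_{m_n}(x_n),\qquad a_\alpha(\mathbf{i},\mathbf{m})\in\mathbb{C}.$$ $\mathscr{L}$ is a subalgebra, containing the identity operator, of the algebra of bounded operators on $L^2$; the coefficients $a_\alpha(\mathbf{i},\mathbf{m})$ are uniquely determined by $\mathcal{A}$. Invertibility of $\mathcal{A}\in\mathscr{L}$ in $\mathscr{L}$ is equivalent to its invertibility in the algebra of bounded operators on $L^2$. Spectrum, discrete spectrum and essential spectrum refer to $\mathcal{A}$ as a bounded operator on $L^2$. The matrices and $\sigma$. For $\mathcal{A}\in\mathscr{L}$ put, for $\alpha\subset\eta$, $\mathbf{i}\in P_\eta$, $\mathbf{m}\in P_\alpha$, $$b_\alpha(\mathbf{i},\mathbf{m})=\sum_{\beta\subset\alpha}\delta(\mathbf{i}_{\alpha\setminus\beta},\mathbf{m}_{\alpha\setminus\beta})\,a_\beta(\mathbf{i},\mathbf{m}_\beta),$$ and for $\mathbf{i}\in P_{\overline{\alpha}}$ let $\mathbf{B}_\alpha(\mathbf{i})=(b_\alpha(\mathbf{i}\diamond\mathbf{m},\mathbf{n}))_{\mathbf{m},\mathbf{n}\in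 P_\alpha}\in\mathbb{C}^{p^{|\alpha|}\times p^{|\alpha|}}$. The mapping $\sigma:\mathscr{L}\to\prod_{\alpha\subset\eta}\prod_{\mathbf{i}\in P_{\overline{\alpha}}}\mathbb{C}^{p^{|\alpha|}\times p^{|\alpha|}}=\prod_{n=0}^N(\mathbb{C}^{p^n\times p^n})^{\binom{N}{n}p^{N-n}}$, $\sigma(\mathcal{A})=((\mathbf{B}_\alpha(\mathbf{i}))_{\mathbf{i}\in P_{\overline{\alpha}}})_{\alpha\subset\eta}$, is an algebra isomorphism.
   Formalization: In (ii), the discrete spectrum is the set of eigenvalues of B_η that are not eigenvalues of any B_α(i) with α≠η; all eigenvalues of those other matrices are essential. Without this the claim fails, e.g. for A=0, where 0 is an eigenvalue of B_η of infinite multiplicity. *)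

theory Defs
  imports
    "HOL-Probability.Infinite_Product_Measure"
    "Jordan_Normal_Form.Gauss_Jordan_Elimination"
    "Jordan_Normal_Form.Char_Poly"
    "HOL-Library.Countable_Set"
begin

section \<open>Complex normed spaces and their bounded operators\<close>

class complex_normed_vector = real_normed_vector +
  fixes scaleC :: "complex \<Rightarrow> 'a \<Rightarrow> 'a"  (infixr \<open>*\<^sub>C\<close> 75)
  assumes scaleC_add_right: "a *\<^sub>C (x + y) = a *\<^sub>C x + a *\<^sub>C y"
    and scaleC_add_left: "(a + b) *\<^sub>C x = a *\<^sub>C x + b *\<^sub>C x"
    and scaleC_scaleC: "a *\<^sub>C b *\<^sub>C x = (a * b) *\<^sub>C x"
    and scaleR_scaleC: "r *\<^sub>R x = complex_of_real r *\<^sub>C x"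
    and norm_scaleC: "norm (a *\<^sub>C x) = cmod a * norm x"

lemma bounded_linear_scaleC: "bounded_linear (\<lambda>x::'a::complex_normed_vector. c *\<^sub>C x)"
  by (rule bounded_linear_intro[where K = "cmod c"])
     (auto simp: scaleC_add_right scaleR_scaleC scaleC_scaleC mult.commute norm_scaleC)

typedef (overloaded) 'a clinop =
  "{T :: 'a::complex_normed_vector \<Rightarrow>\<^sub>L 'a. \<forall>c x. blinfun_apply T (c *\<^sub>C x) = c *\<^sub>C blinfun_apply T x}"
  morphisms blinfun_of_clinop Clinop
  by (rule exI[of _ 0]) (auto simp: bounded_linear_scaleC[THEN bounded_linear.linear, THEN linear_0])

setup_lifting type_definition_clinop

lift_definition clinop_apply :: "'a::complex_normed_vector clinop \<Rightarrow> 'a \<Rightarrow> 'a"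
  is blinfun_apply .

lemma scaleC_diff_right: "a *\<^sub>C (x - y) = a *\<^sub>C x - a *\<^sub>C (y::'a::complex_normed_vector)"
  by (metis add_diff_cancel eq_diff_eq scaleC_add_right)

lemma scaleC_zero_right [simp]: "a *\<^sub>C (0::'a::complex_normed_vector) = 0"
  using scaleC_diff_right[of a 0 0] by simp

lemma scaleC_minus_right: "a *\<^sub>C (- y) = - (a *\<^sub>C (y::'a::complex_normed_vector))"
  using scaleC_diff_right[of a 0 y] by simp

instantiation clinop :: (complex_normed_vector) complex_normed_vector
begin

lift_definition zero_clinop :: "'a clinop" is 0
  by simp

lift_definition plus_clinop :: "'a clinop \<Rightarrow> 'a clinop \<Rightarrow> 'a clinop" is "(+)"
  by (simp add: plus_blinfun.rep_eq scaleC_add_right)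

lift_definition minus_clinop :: "'a clinop \<Rightarrow> 'a clinop \<Rightarrow> 'a clinop" is "(-)"
  by (simp add: minus_blinfun.rep_eq scaleC_diff_right)

lift_definition uminus_clinop :: "'a clinop \<Rightarrow> 'a clinop" is uminus
  by (simp add: uminus_blinfun.rep_eq scaleC_minus_right)

lift_definition scaleR_clinop :: "real \<Rightarrow> 'a clinop \<Rightarrow> 'a clinop" is scaleR
  by (simp add: scaleR_blinfun.rep_eq scaleR_scaleC scaleC_scaleC mult.commute)

lift_definition scaleC_clinop :: "complex \<Rightarrow> 'a clinop \<Rightarrow> 'a clinop"
  is "\<lambda>c T. Blinfun (\<lambda>x. c *\<^sub>C x) o\<^sub>L T"
  by (simp add: bounded_linear_Blinfun_apply bounded_linear_scaleC scaleC_scaleC mult.commute)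

lift_definition norm_clinop :: "'a clinop \<Rightarrow> real" is norm .

definition dist_clinop :: "'a clinop \<Rightarrow> 'a clinop \<Rightarrow> real"
  where "dist_clinop S T = norm (S - T)"

definition sgn_clinop :: "'a clinop \<Rightarrow> 'a clinop"
  where "sgn_clinop T = inverse (norm T) *\<^sub>R T"

definition uniformity_clinop :: "('a clinop \<times> 'a clinop) filter"
  where "uniformity_clinop = (INF e\<in>{0<..}. principal {(x, y). dist x y < e})"

definition open_clinop :: "'a clinop set \<Rightarrow> bool"
  where "open_clinop U = (\<forall>x\<in>U. \<forall>\<^sub>F (x', y) in uniformity. x' = x \<longrightarrow> y \<in> U)"

lemma scaleC_clinop_apply:
  "blinfun_apply (blinfun_of_clinop (c *\<^sub>C T)) x = c *\<^sub>C blinfun_apply (blinfun_of_clinop T) x"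
  by (simp add: scaleC_clinop.rep_eq bounded_linear_Blinfun_apply bounded_linear_scaleC)

lemma clinop_eqI:
  "(\<And>x. blinfun_apply (blinfun_of_clinop S) x = blinfun_apply (blinfun_of_clinop T) x) \<Longrightarrow> S = T"
  by (metis blinfun_eqI blinfun_of_clinop_inject)

instance
proof
  fix x y z :: "'a clinop" and a b :: real and c d :: complex
  show "x + y + z = x + (y + z)" "x + y = y + x" "0 + x = x" "- x + x = 0" "x - y = x + - y"
    by (transfer; simp)+
  show "a *\<^sub>R (x + y) = a *\<^sub>R x + a *\<^sub>R y" "(a + b) *\<^sub>R x = a *\<^sub>R x + b *\<^sub>R x"
    "a *\<^sub>R b *\<^sub>R x = (a * b) *\<^sub>R x" "1 *\<^sub>R x = x"
    by (transfer; simp add: algebra_simps)+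
  show "dist x y = norm (x - y)" "sgn x = inverse (norm x) *\<^sub>R x"
    by (simp_all add: dist_clinop_def sgn_clinop_def)
  show "uniformity = (INF e\<in>{0<..}. principal {(x, y). dist x y < (e::real)} :: ('a clinop \<times> 'a clinop) filter)"
    by (rule uniformity_clinop_def)
  show "open U = (\<forall>x\<in>U. \<forall>\<^sub>F (x', y) in uniformity. x' = x \<longrightarrow> y \<in> U)" for U :: "'a clinop set"
    by (rule open_clinop_def)
  show "(norm x = 0) = (x = 0)" "norm (x + y) \<le> norm x + norm y" "norm (a *\<^sub>R x) = \<bar>a\<bar> * norm x"
    by (transfer; simp add: norm_triangle_ineq)+
  show "c *\<^sub>C (x + y) = c *\<^sub>C x + c *\<^sub>C y" "(c + d) *\<^sub>C x = c *\<^sub>C x + d *\<^sub>C x"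
    "c *\<^sub>C d *\<^sub>C x = (c * d) *\<^sub>C x" "a *\<^sub>R x = complex_of_real a *\<^sub>C x"
    by (rule clinop_eqI;
        simp add: scaleC_clinop_apply plus_clinop.rep_eq scaleR_clinop.rep_eq plus_blinfun.rep_eq
          scaleR_blinfun.rep_eq scaleC_add_right scaleC_add_left scaleC_scaleC scaleR_scaleC)+
  have le: "norm (c *\<^sub>C x) \<le> cmod c * norm x" for c and x :: "'a clinop"
    unfolding norm_clinop.rep_eq
  proof (rule norm_blinfun_bound)
    fix v
    have "norm (blinfun_apply (blinfun_of_clinop x) v) \<le> norm (blinfun_of_clinop x) * norm v"
      by (rule norm_blinfun)
    thus "norm (blinfun_apply (blinfun_of_clinop (c *\<^sub>C x)) v)
        \<le> cmod c * norm (blinfun_of_clinop x) * norm v"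
      by (simp add: scaleC_clinop_apply norm_scaleC mult.assoc mult_left_mono)
  qed simp
  show "norm (c *\<^sub>C x) = cmod c * norm x"
  proof (cases "c = 0")
    case True
    then show ?thesis using le[of c x] by (simp add: norm_clinop.rep_eq)
  next
    case False
    have "inverse c *\<^sub>C c *\<^sub>C x = x"
      by (rule clinop_eqI)
         (use False in \<open>simp add: scaleC_clinop_apply scaleC_scaleC,
            simp flip: scaleR_scaleC[of 1, simplified]\<close>)
    hence "norm x \<le> inverse (cmod c) * norm (c *\<^sub>C x)"
      using le[of "inverse c" "c *\<^sub>C x"] by (simp add: norm_inverse)
    hence "cmod c * norm x \<le> norm (c *\<^sub>C x)"
      using False by (simp add: field_simps)
    with le[of c x] show ?thesis by simp
  qed
qed

end

instantiation clinop :: ("{complex_normed_vector, perfect_space}") real_normed_algebra_1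
begin

lift_definition one_clinop :: "'a clinop" is id_blinfun
  by simp

lift_definition times_clinop :: "'a clinop \<Rightarrow> 'a clinop \<Rightarrow> 'a clinop" is "(o\<^sub>L)"
  by simp

instance
proof
  fix x y z :: "'a clinop" and a :: real
  show "x * y * z = x * (y * z)" "1 * x = x" "x * 1 = x"
    "(x + y) * z = x * z + y * z" "x * (y + z) = x * y + x * z"
    "a *\<^sub>R x * y = a *\<^sub>R (x * y)" "x * a *\<^sub>R y = a *\<^sub>R (x * y)"
    by (transfer, rule blinfun_eqI, simp add: blinfun.bilinear_simps)+
  show "norm (x * y) \<le> norm x * norm y"
    by transfer (rule norm_blinfun_compose)
  show n1: "norm (1::'a clinop) = 1"
    by transfer simp
  show "(0::'a clinop) \<noteq> 1"
  proof
    assume "(0::'a clinop) = 1"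
    with n1 have "norm (0::'a clinop) = 1" by (simp only:)
    thus False by simp
  qed
qed

end

instance clinop :: ("{complex_normed_vector, perfect_space, banach}") banach
proof
  fix X :: "nat \<Rightarrow> 'a clinop"
  assume "Cauchy X"
  have D: "dist (blinfun_of_clinop S) (blinfun_of_clinop T) = dist S T" for S T :: "'a clinop"
    by (simp add: dist_norm norm_clinop.rep_eq minus_clinop.rep_eq)
  have "Cauchy (\<lambda>n. blinfun_of_clinop (X n))"
    using \<open>Cauchy X\<close> by (simp add: Cauchy_def D)
  then obtain T where T: "(\<lambda>n. blinfun_of_clinop (X n)) \<longlonglongrightarrow> T"
    using convergent_def convergent_eq_Cauchy by blast
  have pt: "(\<lambda>n. blinfun_apply (blinfun_of_clinop (X n)) v) \<longlonglongrightarrow> blinfun_apply T v" for v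
    by (intro blinfun.tendsto T tendsto_const)
  have "blinfun_apply T (c *\<^sub>C v) = c *\<^sub>C blinfun_apply T v" for c v
  proof (rule LIMSEQ_unique[OF pt])
    have "(\<lambda>n. c *\<^sub>C blinfun_apply (blinfun_of_clinop (X n)) v) \<longlonglongrightarrow> c *\<^sub>C blinfun_apply T v"
      by (rule bounded_linear.tendsto[OF bounded_linear_scaleC pt])
    thus "(\<lambda>n. blinfun_apply (blinfun_of_clinop (X n)) (c *\<^sub>C v)) \<longlonglongrightarrow> c *\<^sub>C blinfun_apply T v"
      using blinfun_of_clinop[of "X _"] by simp
  qed
  hence "blinfun_of_clinop (Clinop T) = T"
    by (intro Clinop_inverse) simp
  hence "X \<longlonglongrightarrow> Clinop T"
    using T by (simp add: tendsto_iff D[symmetric])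
  thus "convergent X" by (rule convergentI)
qed

section \<open>Invertibility and spectra\<close>

definition invertible_op :: "'a::ring_1 \<Rightarrow> bool"
  where "invertible_op A \<longleftrightarrow> (\<exists>C. A * C = 1 \<and> C * A = 1)"

definition inverse_op :: "'a::ring_1 \<Rightarrow> 'a"
  where "inverse_op A = (THE C. A * C = 1 \<and> C * A = 1)"

definition op_spectrum :: "'a::{complex_normed_vector, perfect_space} clinop \<Rightarrow> complex set"
  where "op_spectrum A = {z. \<not> invertible_op (z *\<^sub>C 1 - A)}"

text \<open>Finite dimension over the reals and over the complex numbers is the same thing, so the
  real span of the library can be used.\<close>

definition finite_dimensional :: "'a::real_vector set \<Rightarrow> bool"
  where "finite_dimensional V \<longleftrightarrow> (\<exists>S. finite S \<and> V \<subseteq> span S)"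

definition fredholm :: "'a::complex_normed_vector clinop \<Rightarrow> bool"
  where "fredholm T \<longleftrightarrow>
    finite_dimensional {u. clinop_apply T u = 0} \<and>
    closed (range (clinop_apply T)) \<and>
    (\<exists>S. finite S \<and> span (range (clinop_apply T) \<union> S) = UNIV)"

definition essential_spectrum :: "'a::{complex_normed_vector, perfect_space} clinop \<Rightarrow> complex set"
  where "essential_spectrum A = {z. \<not> fredholm (z *\<^sub>C 1 - A)}"

text \<open>The Riesz projection
  \<open>(2 * pi * \<i>)\<inverse> * (contour integral of (z - A)\<inverse> over the circle with centre w and radius r)\<close>,
  with the circle parametrised by \<open>z = w + r * cis t\<close>, so that \<open>dz = \<i> * r * cis t * dt\<close>.\<close>

definition has_riesz_projection ::
  "'a::{complex_normed_vector, perfect_space} clinop \<Rightarrow> complex \<Rightarrow> real \<Rightarrow> 'a clinop \<Rightarrow> bool"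
  where "has_riesz_projection A w r Q \<longleftrightarrow>
    ((\<lambda>t. (of_real r * cis t / of_real (2 * pi)) *\<^sub>C
           inverse_op ((w + of_real r * cis t) *\<^sub>C 1 - A)) has_integral Q) {0..2 * pi}"

text \<open>Isolated points of the spectrum of finite algebraic multiplicity, the algebraic multiplicity
  being the rank of the Riesz projection.\<close>

definition discrete_spectrum :: "'a::{complex_normed_vector, perfect_space} clinop \<Rightarrow> complex set"
  where "discrete_spectrum A =
    {w. \<exists>r>0. op_spectrum A \<inter> cball w r = {w} \<and>
         (\<exists>Q. has_riesz_projection A w r Q \<and> finite_dimensional (range (clinop_apply Q)))}"

section \<open>The space of square-integrable functions on the cube\<close>

text \<open>The coordinates are indexed by a finite type \<open>'n\<close>, which plays the role of \<open>\<eta> = {1,\<dots>,N}\<close>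
  with \<open>N = CARD('n)\<close>. A vector \<open>x\<^sub>\<alpha>\<close> is a function on \<open>'n\<close> that is \<open>undefined\<close> off \<open>\<alpha>\<close>,
  as in the library's product measures.\<close>

definition cube :: "'n set \<Rightarrow> ('n \<Rightarrow> real) measure"
  where "cube \<alpha> = Pi\<^sub>M \<alpha> (\<lambda>_. restrict_space lborel {0..<1})"

definition sq_integrable :: "(('n::finite \<Rightarrow> real) \<Rightarrow> complex) \<Rightarrow> bool"
  where "sq_integrable f \<longleftrightarrow>
    f \<in> borel_measurable (cube UNIV) \<and> integrable (cube UNIV) (\<lambda>x. (cmod (f x))\<^sup>2)"

definition L2_eq :: "(('n::finite \<Rightarrow> real) \<Rightarrow> complex) \<Rightarrow> (('n \<Rightarrow> real) \<Rightarrow> complex) \<Rightarrow> bool"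
  where "L2_eq f g \<longleftrightarrow> sq_integrable f \<and> sq_integrable g \<and> (AE x in cube UNIV. f x = g x)"

lemma prob_space_cube: "prob_space (cube \<alpha>)"
  unfolding cube_def
  by (intro prob_space_PiM prob_spaceI) (simp add: emeasure_restrict_space space_restrict_space)

lemma cnj_measurable [measurable]: "cnj \<in> borel_measurable borel"
  by (intro borel_measurable_continuous_onI continuous_intros)

lemma sq_integrable_const [simp]: "sq_integrable (\<lambda>_::'n::finite \<Rightarrow> real. c)"
proof -
  interpret prob_space "cube (UNIV :: 'n set)" by (rule prob_space_cube)
  show ?thesis by (simp add: sq_integrable_def)
qed

lemma sq_integrable_add:
  assumes "sq_integrable f" "sq_integrable g"
  shows "sq_integrable (\<lambda>x. f x + g x)"
proof -
  have [measurable]: "f \<in> borel_measurable (cube UNIV)" "g \<in> borel_measurable (cube UNIV)"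
    using assms by (auto simp: sq_integrable_def)
  have "(cmod (a + b))\<^sup>2 \<le> 2 * (cmod a)\<^sup>2 + 2 * (cmod b)\<^sup>2" for a b
  proof -
    have "(cmod (a + b))\<^sup>2 \<le> (cmod a + cmod b)\<^sup>2"
      by (intro power_mono norm_triangle_ineq) simp
    also have "\<dots> \<le> 2 * (cmod a)\<^sup>2 + 2 * (cmod b)\<^sup>2"
      using zero_le_power2[of "cmod a - cmod b"] by (simp add: power2_eq_square algebra_simps)
    finally show ?thesis .
  qed
  moreover have "integrable (cube UNIV) (\<lambda>x. 2 * (cmod (f x))\<^sup>2 + 2 * (cmod (g x))\<^sup>2)"
    using assms by (auto simp: sq_integrable_def)
  ultimately have "integrable (cube UNIV) (\<lambda>x. (cmod (f x + g x))\<^sup>2)"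
    by (elim Bochner_Integration.integrable_bound) auto
  thus ?thesis by (simp add: sq_integrable_def)
qed

lemma sq_integrable_cmult: "sq_integrable f \<Longrightarrow> sq_integrable (\<lambda>x. c * f x)"
  by (auto simp: sq_integrable_def norm_mult power_mult_distrib)

lemma sq_integrable_scaleR: "sq_integrable f \<Longrightarrow> sq_integrable (\<lambda>x. r *\<^sub>R f x)"
  using sq_integrable_cmult[of f "of_real r"] by (simp add: scaleR_conv_of_real)

lemma sq_integrable_uminus: "sq_integrable f \<Longrightarrow> sq_integrable (\<lambda>x. - f x)"
  using sq_integrable_cmult[of f "-1"] by simp

lemma sq_integrable_diff:
  "sq_integrable f \<Longrightarrow> sq_integrable g \<Longrightarrow> sq_integrable (\<lambda>x. f x - g x)"
  using sq_integrable_add[of f "\<lambda>x. - g x"] by (simp add: sq_integrable_uminus)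

lemma sq_integrable_mult_cnj:
  assumes "sq_integrable f" "sq_integrable g"
  shows "integrable (cube UNIV) (\<lambda>x. f x * cnj (g x))"
proof -
  have [measurable]: "f \<in> borel_measurable (cube UNIV)" "g \<in> borel_measurable (cube UNIV)"
    using assms by (auto simp: sq_integrable_def)
  have "cmod a * cmod b \<le> (cmod a)\<^sup>2 + (cmod b)\<^sup>2" for a b
  proof -
    have "2 * (cmod a * cmod b) \<le> (cmod a)\<^sup>2 + (cmod b)\<^sup>2"
      using zero_le_power2[of "cmod a - cmod b"] by (simp add: power2_eq_square algebra_simps)
    moreover have "0 \<le> cmod a * cmod b" by simp
    ultimately show ?thesis by linarith
  qed
  moreover have "integrable (cube UNIV) (\<lambda>x. (cmod (f x))\<^sup>2 + (cmod (g x))\<^sup>2)"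
    using assms by (auto simp: sq_integrable_def)
  ultimately show ?thesis
    by (elim Bochner_Integration.integrable_bound) (auto simp: norm_mult)
qed

quotient_type 'n L2 = "('n::finite \<Rightarrow> real) \<Rightarrow> complex" / partial: L2_eq
proof (rule part_equivpI)
  show "\<exists>f::('n \<Rightarrow> real) \<Rightarrow> complex. L2_eq f f"
    by (rule exI[of _ "\<lambda>_. 0"]) (simp add: L2_eq_def)
  show "symp (L2_eq :: (('n \<Rightarrow> real) \<Rightarrow> complex) \<Rightarrow> _)"
    by (auto simp: symp_def L2_eq_def elim: eventually_mono)
  show "transp (L2_eq :: (('n \<Rightarrow> real) \<Rightarrow> complex) \<Rightarrow> _)"
  proof (rule transpI)
    fix f g h :: "('n \<Rightarrow> real) \<Rightarrow> complex"
    assume A: "L2_eq f g" "L2_eq g h"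
    hence "AE x in cube UNIV. f x = g x" "AE x in cube UNIV. g x = h x"
      by (auto simp: L2_eq_def)
    hence "AE x in cube UNIV. f x = h x" by eventually_elim simp
    with A show "L2_eq f h" by (simp add: L2_eq_def)
  qed
qed

lemma L2_eq_refl: "L2_eq f f \<longleftrightarrow> sq_integrable f"
  by (simp add: L2_eq_def)

instantiation L2 :: (finite) real_inner
begin

lift_definition zero_L2 :: "'a L2" is "\<lambda>_. 0"
  by (simp add: L2_eq_def)

lift_definition plus_L2 :: "'a L2 \<Rightarrow> 'a L2 \<Rightarrow> 'a L2" is "\<lambda>f g x. f x + g x"
proof -
  fix f f' g g' :: "('a \<Rightarrow> real) \<Rightarrow> complex"
  assume "L2_eq f f'" "L2_eq g g'"
  hence "AE x in cube UNIV. f x = f' x" "AE x in cube UNIV. g x = g' x"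
    by (auto simp: L2_eq_def)
  hence "AE x in cube UNIV. f x + g x = f' x + g' x" by eventually_elim simp
  thus "L2_eq (\<lambda>x. f x + g x) (\<lambda>x. f' x + g' x)"
    using \<open>L2_eq f f'\<close> \<open>L2_eq g g'\<close> by (auto simp: L2_eq_def intro: sq_integrable_add)
qed

lift_definition minus_L2 :: "'a L2 \<Rightarrow> 'a L2 \<Rightarrow> 'a L2" is "\<lambda>f g x. f x - g x"
proof -
  fix f f' g g' :: "('a \<Rightarrow> real) \<Rightarrow> complex"
  assume "L2_eq f f'" "L2_eq g g'"
  hence "AE x in cube UNIV. f x = f' x" "AE x in cube UNIV. g x = g' x"
    by (auto simp: L2_eq_def)
  hence "AE x in cube UNIV. f x - g x = f' x - g' x" by eventually_elim simp
  thus "L2_eq (\<lambda>x. f x - g x) (\<lambda>x. f' x - g' x)"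
    using \<open>L2_eq f f'\<close> \<open>L2_eq g g'\<close> by (auto simp: L2_eq_def intro: sq_integrable_diff)
qed

lift_definition uminus_L2 :: "'a L2 \<Rightarrow> 'a L2" is "\<lambda>f x. - f x"
  by (auto simp: L2_eq_def sq_integrable_uminus)

lift_definition scaleR_L2 :: "real \<Rightarrow> 'a L2 \<Rightarrow> 'a L2" is "\<lambda>r f x. r *\<^sub>R f x"
  by (auto simp: L2_eq_def sq_integrable_scaleR elim: eventually_mono)

lift_definition inner_L2 :: "'a L2 \<Rightarrow> 'a L2 \<Rightarrow> real"
  is "\<lambda>f g. LINT x|cube UNIV. Re (f x * cnj (g x))"
proof -
  fix f f' g g' :: "('a \<Rightarrow> real) \<Rightarrow> complex"
  assume A: "L2_eq f f'" "L2_eq g g'"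
  hence [measurable]: "f \<in> borel_measurable (cube UNIV)" "g \<in> borel_measurable (cube UNIV)"
    "f' \<in> borel_measurable (cube UNIV)" "g' \<in> borel_measurable (cube UNIV)"
    by (auto simp: L2_eq_def sq_integrable_def)
  have "AE x in cube UNIV. f x = f' x" "AE x in cube UNIV. g x = g' x"
    using A by (auto simp: L2_eq_def)
  hence "AE x in cube UNIV. Re (f x * cnj (g x)) = Re (f' x * cnj (g' x))"
    by eventually_elim simp
  thus "(LINT x|cube UNIV. Re (f x * cnj (g x))) = (LINT x|cube UNIV. Re (f' x * cnj (g' x)))"
    by (intro integral_cong_AE) measurable
qed

definition norm_L2 :: "'a L2 \<Rightarrow> real"
  where "norm_L2 u = sqrt (inner u u)"

definition dist_L2 :: "'a L2 \<Rightarrow> 'a L2 \<Rightarrow> real"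
  where "dist_L2 u v = norm (u - v)"

definition sgn_L2 :: "'a L2 \<Rightarrow> 'a L2"
  where "sgn_L2 u = inverse (norm u) *\<^sub>R u"

definition uniformity_L2 :: "('a L2 \<times> 'a L2) filter"
  where "uniformity_L2 = (INF e\<in>{0<..}. principal {(x, y). dist x y < e})"

definition open_L2 :: "'a L2 set \<Rightarrow> bool"
  where "open_L2 U = (\<forall>x\<in>U. \<forall>\<^sub>F (x', y) in uniformity. x' = x \<longrightarrow> y \<in> U)"

instance
proof
  fix x y z :: "'a L2" and a b :: real
  show "x + y + z = x + (y + z)" "x + y = y + x" "0 + x = x" "- x + x = 0" "x - y = x + - y"
    "a *\<^sub>R (x + y) = a *\<^sub>R x + a *\<^sub>R y" "(a + b) *\<^sub>R x = a *\<^sub>R x + b *\<^sub>R x"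
    "a *\<^sub>R b *\<^sub>R x = (a * b) *\<^sub>R x" "1 *\<^sub>R x = x"
    by (transfer; simp add: L2_eq_def algebra_simps sq_integrable_add sq_integrable_diff
          sq_integrable_uminus sq_integrable_scaleR sq_integrable_cmult)+
  show "dist x y = norm (x - y)" "sgn x = inverse (norm x) *\<^sub>R x" "norm x = sqrt (inner x x)"
    by (simp_all add: dist_L2_def sgn_L2_def norm_L2_def)
  show "uniformity = (INF e\<in>{0<..}. principal {(x, y). dist x y < (e::real)} :: ('a L2 \<times> 'a L2) filter)"
    by (rule uniformity_L2_def)
  show "open U = (\<forall>x\<in>U. \<forall>\<^sub>F (x', y) in uniformity. x' = x \<longrightarrow> y \<in> U)" for U :: "'a L2 set"
    by (rule open_L2_def)
  show "inner x y = inner y x"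
    by transfer (simp add: mult.commute)
  show "inner (x + y) z = inner x z + inner y z"
  proof (transfer, goal_cases)
    case (1 f g h)
    hence "integrable (cube UNIV) (\<lambda>x. Re (f x * cnj (h x)))"
      "integrable (cube UNIV) (\<lambda>x. Re (g x * cnj (h x)))"
      by (intro integrable_Re sq_integrable_mult_cnj; simp add: L2_eq_def)+
    then show ?case
      by (subst Bochner_Integration.integral_add[symmetric]) (auto simp: algebra_simps)
  qed
  show "inner (a *\<^sub>R x) y = a * inner x y"
  proof (transfer, goal_cases)
    case (1 a f g)
    have "Re (a *\<^sub>R f x * cnj (g x)) = a * Re (f x * cnj (g x))" for x
      by simp
    then show ?case by (simp only: Bochner_Integration.integral_mult_right_zero)
  qed
  show "0 \<le> inner x x"
    by transfer (auto intro!: Bochner_Integration.integral_nonneg)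
  show "(inner x x = 0) = (x = 0)"
  proof (transfer, goal_cases)
    case (1 f)
    hence f: "sq_integrable f" by (simp add: L2_eq_def)
    have "(LINT x|cube UNIV. Re (f x * cnj (f x))) = 0 \<longleftrightarrow> (AE x in cube UNIV. Re (f x * cnj (f x)) = 0)"
      using f by (intro integral_nonneg_eq_0_iff_AE integrable_Re sq_integrable_mult_cnj) auto
    also have "\<dots> \<longleftrightarrow> (AE x in cube UNIV. f x = 0)"
      by (intro AE_cong) (simp add: complex_eq_iff sum_squares_eq_zero_iff)
    finally show ?case using f by (simp add: L2_eq_def)
  qed
qed

end

instantiation L2 :: (finite) complex_normed_vector
begin

lift_definition scaleC_L2 :: "complex \<Rightarrow> 'a L2 \<Rightarrow> 'a L2" is "\<lambda>c f x. c * f x"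
  by (auto simp: L2_eq_def sq_integrable_cmult elim: eventually_mono)

instance
proof
  fix x y :: "'a L2" and a b :: complex and r :: real
  show "a *\<^sub>C (x + y) = a *\<^sub>C x + a *\<^sub>C y" "(a + b) *\<^sub>C x = a *\<^sub>C x + b *\<^sub>C x"
    "a *\<^sub>C b *\<^sub>C x = (a * b) *\<^sub>C x"
    by (transfer; simp add: L2_eq_def algebra_simps sq_integrable_add sq_integrable_cmult)+
  show "r *\<^sub>R x = complex_of_real r *\<^sub>C x"
    by transfer (simp add: L2_eq_def sq_integrable_cmult scaleR_conv_of_real)
  have "inner (a *\<^sub>C x) (a *\<^sub>C x) = (cmod a)\<^sup>2 * inner x x"
  proof (transfer, goal_cases)
    case (1 a f)
    have "Re (a * f x * cnj (a * f x)) = (cmod a)\<^sup>2 * Re (f x * cnj (f x))" for x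
      by (simp only: complex_norm_square[symmetric] Re_complex_of_real norm_mult power_mult_distrib)
    then show ?case by (simp only: Bochner_Integration.integral_mult_right_zero)
  qed
  thus "norm (a *\<^sub>C x) = cmod a * norm x"
    by (simp add: norm_eq_sqrt_inner real_sqrt_mult)
qed

end

lemma L2_abs_eq_iff:
  "sq_integrable f \<Longrightarrow> sq_integrable g \<Longrightarrow>
    abs_L2 f = abs_L2 g \<longleftrightarrow> (AE x in cube UNIV. f x = g x)"
  using Quotient3_rel[OF Quotient3_L2, of f g] by (simp add: L2_eq_def)

lemma sq_integrable_rep_L2: "sq_integrable (rep_L2 u)"
  using Quotient3_rep_reflp[OF Quotient3_L2, of u] by (simp only: L2_eq_refl)

lemma abs_rep_L2: "abs_L2 (rep_L2 u) = u"
  by (rule Quotient3_abs_rep[OF Quotient3_L2])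

lemma norm_abs_L2:
  assumes "sq_integrable f"
  shows "norm (abs_L2 f) = sqrt (LINT x|cube UNIV. (cmod (f x))\<^sup>2)"
proof -
  have "inner (abs_L2 f) (abs_L2 f) = (LINT x|cube UNIV. Re (f x * cnj (f x)))"
    by (rule inner_L2.abs_eq) (simp_all add: L2_eq_def assms)
  also have "\<dots> = (LINT x|cube UNIV. (cmod (f x))\<^sup>2)"
    by (simp only: complex_norm_square[symmetric] Re_complex_of_real)
  finally show ?thesis by (simp add: norm_eq_sqrt_inner)
qed

lemma abs_L2_diff:
  assumes "sq_integrable f" "sq_integrable g"
  shows "abs_L2 f - abs_L2 g = abs_L2 (\<lambda>x. f x - g x)"
  by (rule minus_L2.abs_eq) (simp_all add: L2_eq_def assms)

instance L2 :: (finite) perfect_space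
proof
  fix x :: "'a L2"
  define o1 :: "'a L2" where "o1 = abs_L2 (\<lambda>_. 1)"
  have o1: "norm o1 = 1"
    unfolding o1_def
    by (subst norm_abs_L2) (simp_all add: prob_space.prob_space[OF prob_space_cube])
  show "\<not> open {x}"
  proof
    assume "open {x}"
    then obtain e where e: "e > 0" "\<And>y. dist y x < e \<Longrightarrow> y = x"
      unfolding open_dist by auto
    have "dist (x + (e / 2) *\<^sub>R o1) x < e"
      using e(1) o1 by (simp add: dist_norm)
    hence "(e / 2) *\<^sub>R o1 = 0"
      using e(2) by (metis add_cancel_right_right)
    thus False using e(1) o1 by auto
  qed
qed

instance L2 :: (finite) banach
proof
  fix X :: "nat \<Rightarrow> 'a L2"
  assume X: "Cauchy X"
  interpret prob_space "cube (UNIV :: 'a set)" by (rule prob_space_cube)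
  define f where "f n = rep_L2 (X n)" for n
  have fs: "sq_integrable (f n)" for n
    by (simp add: f_def sq_integrable_rep_L2)
  have fm [measurable]: "f n \<in> borel_measurable (cube UNIV)" for n
    using fs[of n] by (simp add: sq_integrable_def)
  have Xf: "X n = abs_L2 (f n)" for n
    by (simp add: f_def abs_rep_L2)
  have ds: "sq_integrable (\<lambda>x. f i x - f j x)" for i j
    by (intro sq_integrable_diff fs)
  have nd: "dist (X i) (X j) = sqrt (LINT x|cube UNIV. (cmod (f i x - f j x))\<^sup>2)" for i j
    by (simp add: dist_norm Xf abs_L2_diff fs norm_abs_L2 ds)
  have int1: "integrable (cube UNIV) g" if "sq_integrable g" for g :: "('a \<Rightarrow> real) \<Rightarrow> complex"
    using sq_integrable_mult_cnj[OF that sq_integrable_const[of 1]] by simp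
  have L1: "(LINT x|cube UNIV. cmod (f i x - f j x)) \<le> dist (X i) (X j)" for i j
  proof -
    let ?g = "\<lambda>x. cmod (f i x - f j x)"
    have i1: "integrable (cube UNIV) ?g" by (intro integrable_norm int1 ds)
    have i2: "integrable (cube UNIV) (\<lambda>x. (?g x)\<^sup>2)" using ds by (simp add: sq_integrable_def)
    define m where "m = (LINT x|cube UNIV. ?g x)"
    have "0 \<le> (LINT x|cube UNIV. (?g x - m)\<^sup>2)"
      by (intro Bochner_Integration.integral_nonneg) simp
    also have "\<dots> = (LINT x|cube UNIV. (?g x)\<^sup>2 - 2 * m * ?g x + m\<^sup>2)"
      by (simp add: power2_diff algebra_simps)
    also have "\<dots> = (LINT x|cube UNIV. (?g x)\<^sup>2) - 2 * m * m + m\<^sup>2"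
      using i1 i2 by (simp add: m_def prob_space)
    finally have "m\<^sup>2 \<le> (LINT x|cube UNIV. (?g x)\<^sup>2)"
      by (simp add: power2_eq_square)
    thus ?thesis
      unfolding nd m_def[symmetric] by (rule real_le_rsqrt)
  qed
  obtain r where r: "strict_mono r" and ae: "AE x in cube UNIV. Cauchy (\<lambda>i. f (r i) x)"
  proof (rule cauchy_L1_AE_cauchy_subseq[of "cube UNIV" f])
    show "integrable (cube UNIV) (f n)" for n by (intro int1 fs)
    fix e :: real assume "e > 0"
    then obtain N where "\<forall>i\<ge>N. \<forall>j\<ge>N. dist (X i) (X j) < e"
      using X unfolding Cauchy_def by blast
    thus "\<exists>N. \<forall>i\<ge>N. \<forall>j\<ge>N. (LINT x|cube UNIV. cmod (f i x - f j x)) < e"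
      using L1 le_less_trans by blast
  qed
  define g where "g x = lim (\<lambda>i. f (r i) x)" for x
  have gm [measurable]: "g \<in> borel_measurable (cube UNIV)"
    unfolding g_def by measurable
  have lim: "AE x in cube UNIV. (\<lambda>i. f (r i) x) \<longlonglongrightarrow> g x"
    using ae by eventually_elim (simp add: g_def Cauchy_convergent_iff convergent_LIMSEQ_iff)
  have key: "\<exists>N. \<forall>n\<ge>N. sq_integrable (\<lambda>x. f n x - g x) \<and>
      (LINT x|cube UNIV. (cmod (f n x - g x))\<^sup>2) \<le> e\<^sup>2" if "e > 0" for e :: real
  proof -
    obtain N where N: "\<And>i j. i \<ge> N \<Longrightarrow> j \<ge> N \<Longrightarrow> dist (X i) (X j) < e"
      using X \<open>e > 0\<close> unfolding Cauchy_def by blast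
    have "sq_integrable (\<lambda>x. f n x - g x) \<and>
      (LINT x|cube UNIV. (cmod (f n x - g x))\<^sup>2) \<le> e\<^sup>2" if "n \<ge> N" for n
    proof -
      have "(\<integral>\<^sup>+x. ennreal ((cmod (f n x - g x))\<^sup>2) \<partial>cube UNIV)
          = (\<integral>\<^sup>+x. liminf (\<lambda>i. ennreal ((cmod (f n x - f (r i) x))\<^sup>2)) \<partial>cube UNIV)"
      proof (rule nn_integral_cong_AE, use lim in eventually_elim)
        fix x assume "(\<lambda>i. f (r i) x) \<longlonglongrightarrow> g x"
        hence "(\<lambda>i. ennreal ((cmod (f n x - f (r i) x))\<^sup>2)) \<longlonglongrightarrow> ennreal ((cmod (f n x - g x))\<^sup>2)"
          by (intro tendsto_intros)
        thus "ennreal ((cmod (f n x - g x))\<^sup>2) = liminf (\<lambda>i. ennreal ((cmod (f n x - f (r i) x))\<^sup>2))"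
          by (rule lim_imp_Liminf[symmetric, rotated]) simp
      qed
      also have "\<dots> \<le> liminf (\<lambda>i. \<integral>\<^sup>+x. ennreal ((cmod (f n x - f (r i) x))\<^sup>2) \<partial>cube UNIV)"
        by (rule nn_integral_liminf) measurable
      also have "\<dots> \<le> ennreal (e\<^sup>2)"
      proof (rule Liminf_le)
        have "\<forall>\<^sub>F i in sequentially. i \<ge> N" by (rule eventually_ge_at_top)
        thus "\<forall>\<^sub>F i in sequentially.
            (\<integral>\<^sup>+x. ennreal ((cmod (f n x - f (r i) x))\<^sup>2) \<partial>cube UNIV) \<le> ennreal (e\<^sup>2)"
        proof eventually_elim
          case (elim i)
          have "r i \<ge> N" using elim seq_suble[OF r, of i] by linarith
          hence "sqrt (LINT x|cube UNIV. (cmod (f n x - f (r i) x))\<^sup>2) \<le> e"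
            using N[OF \<open>n \<ge> N\<close>] nd less_imp_le by metis
          hence "(LINT x|cube UNIV. (cmod (f n x - f (r i) x))\<^sup>2) \<le> e\<^sup>2"
            by (rule sqrt_le_D)
          moreover have "integrable (cube UNIV) (\<lambda>x. (cmod (f n x - f (r i) x))\<^sup>2)"
            using ds by (simp add: sq_integrable_def)
          ultimately show ?case
            by (subst nn_integral_eq_integral) (auto intro: ennreal_leI)
        qed
      qed simp
      finally have *: "(\<integral>\<^sup>+x. ennreal ((cmod (f n x - g x))\<^sup>2) \<partial>cube UNIV) \<le> ennreal (e\<^sup>2)" .
      have i: "integrable (cube UNIV) (\<lambda>x. (cmod (f n x - g x))\<^sup>2)"
        by (rule integrableI_bounded) (use * in \<open>auto intro: le_less_trans\<close>)
      have "(LINT x|cube UNIV. (cmod (f n x - g x))\<^sup>2) \<le> e\<^sup>2"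
        using * i by (subst (asm) nn_integral_eq_integral) auto
      thus ?thesis using i by (simp add: sq_integrable_def)
    qed
    thus ?thesis by blast
  qed
  have gs: "sq_integrable g"
  proof -
    obtain n where "sq_integrable (\<lambda>x. f n x - g x)" using key[of 1] by auto
    from sq_integrable_diff[OF fs[of n] this] show ?thesis by simp
  qed
  have "X \<longlonglongrightarrow> abs_L2 g"
  proof (rule metric_LIMSEQ_I)
    fix e :: real assume "e > 0"
    then obtain N where N: "\<And>n. n \<ge> N \<Longrightarrow> (LINT x|cube UNIV. (cmod (f n x - g x))\<^sup>2) \<le> (e/2)\<^sup>2"
      using key[of "e/2"] by auto
    have "dist (X n) (abs_L2 g) < e" if "n \<ge> N" for n
    proof -
      have "dist (X n) (abs_L2 g) = sqrt (LINT x|cube UNIV. (cmod (f n x - g x))\<^sup>2)"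
        unfolding dist_norm Xf abs_L2_diff[OF fs gs]
        by (rule norm_abs_L2[OF sq_integrable_diff[OF fs gs]])
      also have "\<dots> \<le> e / 2"
        using N[OF that] \<open>e > 0\<close> by (intro real_le_lsqrt) auto
      finally show ?thesis using \<open>e > 0\<close> by simp
    qed
    thus "\<exists>N. \<forall>n\<ge>N. dist (X n) (abs_L2 g) < e" by blast
  qed
  thus "convergent X" by (rule convergentI)
qed

section \<open>The algebra of operators with piecewise constant kernels\<close>

definition multi_idx :: "nat \<Rightarrow> 'n set \<Rightarrow> ('n \<Rightarrow> nat) set"
  where "multi_idx p \<alpha> = Pi\<^sub>E \<alpha> (\<lambda>_. {1..p})"

text \<open>\<open>x \<diamondop> y\<close> is rendered as \<open>merge \<alpha> \<beta> (x, y)\<close>, and \<open>x\<^sub>\<alpha>\<close> as \<open>restrict x \<alpha>\<close>.\<close>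

definition chi :: "nat \<Rightarrow> nat \<Rightarrow> real \<Rightarrow> complex"
  where "chi p r y = indicator {(real r - 1) / real p ..< real r / real p} y"

type_synonym 'n coeffs = "'n set \<Rightarrow> ('n \<Rightarrow> nat) \<Rightarrow> ('n \<Rightarrow> nat) \<Rightarrow> complex"

definition kernel ::
  "nat \<Rightarrow> 'n::finite coeffs \<Rightarrow> 'n set \<Rightarrow> ('n \<Rightarrow> real) \<Rightarrow> ('n \<Rightarrow> real) \<Rightarrow> complex"
  where "kernel p a \<alpha> k x =
    (\<Sum>(i, m)\<in>multi_idx p UNIV \<times> multi_idx p \<alpha>.
       of_nat (p ^ card \<alpha>) * a \<alpha> i m * (\<Prod>j\<in>UNIV. chi p (i j) (k j)) * (\<Prod>n\<in>\<alpha>. chi p (m n) (x n)))"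

definition mixed_integral ::
  "nat \<Rightarrow> 'n::finite coeffs \<Rightarrow> (('n \<Rightarrow> real) \<Rightarrow> complex) \<Rightarrow> ('n \<Rightarrow> real) \<Rightarrow> complex"
  where "mixed_integral p a f k =
    (\<Sum>\<alpha>\<in>UNIV. LINT x|cube \<alpha>. kernel p a \<alpha> k x * f (merge (- \<alpha>) \<alpha> (k, x)))"

text \<open>The operator \<open>T\<close> is given by the coefficients \<open>a\<close>. Only the values of \<open>a\<close> at valid
  multi-indices matter; requiring the others to vanish makes \<open>a\<close> unique.\<close>

definition has_coeffs :: "nat \<Rightarrow> 'n::finite L2 clinop \<Rightarrow> 'n coeffs \<Rightarrow> bool"
  where "has_coeffs p T a \<longleftrightarrow>
    (\<forall>\<alpha> i m. (i, m) \<notin> multi_idx p UNIV \<times> multi_idx p \<alpha> \<longrightarrow> a \<alpha> i m = 0) \<and>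
    (\<forall>f. sq_integrable f \<longrightarrow>
       (AE k in cube UNIV. rep_L2 (clinop_apply T (abs_L2 f)) k = mixed_integral p a f k))"

definition mixed_algebra :: "nat \<Rightarrow> 'n::finite L2 clinop set"
  where "mixed_algebra p = {T. \<exists>a. has_coeffs p T a}"

definition coeffs_of :: "nat \<Rightarrow> 'n::finite L2 clinop \<Rightarrow> 'n coeffs"
  where "coeffs_of p T = (THE a. has_coeffs p T a)"

section \<open>The matrices, the representation, trace and determinant\<close>

definition b_coeff ::
  "nat \<Rightarrow> 'n::finite L2 clinop \<Rightarrow> 'n set \<Rightarrow> ('n \<Rightarrow> nat) \<Rightarrow> ('n \<Rightarrow> nat) \<Rightarrow> complex"
  where "b_coeff p T \<alpha> i m =
    (\<Sum>\<beta>\<in>Pow \<alpha>. (if restrict i (\<alpha> - \<beta>) = restrict m (\<alpha> - \<beta>) then 1 else 0)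
                  * coeffs_of p T \<beta> i (restrict m \<beta>))"

text \<open>Rows and columns are numbered by a fixed enumeration of the finite set \<open>multi_idx p \<alpha>\<close>,
  which has \<open>p ^ card \<alpha>\<close> elements.\<close>

definition B_mat :: "nat \<Rightarrow> 'n::finite L2 clinop \<Rightarrow> 'n set \<Rightarrow> ('n \<Rightarrow> nat) \<Rightarrow> complex mat"
  where "B_mat p T \<alpha> i =
    (let e = from_nat_into (multi_idx p \<alpha>)
     in Matrix.mat (p ^ card \<alpha>) (p ^ card \<alpha>)
          (\<lambda>(r, c). b_coeff p T \<alpha> (merge (- \<alpha>) \<alpha> (i, e r)) (e c)))"

definition blocks :: "nat \<Rightarrow> ('n set \<times> ('n \<Rightarrow> nat)) set"
  where "blocks p = (SIGMA \<alpha>:UNIV. multi_idx p (- \<alpha>))"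

definition sigma_map :: "nat \<Rightarrow> 'n::finite L2 clinop \<Rightarrow> 'n set \<times> ('n \<Rightarrow> nat) \<Rightarrow> complex mat"
  where "sigma_map p T = (\<lambda>(\<alpha>, i)\<in>blocks p. B_mat p T \<alpha> i)"

definition mat_trace :: "complex mat \<Rightarrow> complex"
  where "mat_trace M = (\<Sum>r<dim_row M. M $$ (r, r))"

definition tau :: "nat \<Rightarrow> 'n::finite L2 clinop \<Rightarrow> 'n set \<times> ('n \<Rightarrow> nat) \<Rightarrow> complex"
  where "tau p T = (\<lambda>(\<alpha>, i)\<in>blocks p. mat_trace (B_mat p T \<alpha> i))"

definition det_map :: "nat \<Rightarrow> 'n::finite L2 clinop \<Rightarrow> 'n set \<times> ('n \<Rightarrow> nat) \<Rightarrow> complex"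
  where "det_map p T = (\<lambda>(\<alpha>, i)\<in>blocks p. Determinant.det (B_mat p T \<alpha> i))"

end

(* The algebra is spanned by the operators with kernels built from cell indicators. These are tensor
   products over the coordinates, and each one-coordinate factor algebra is the direct sum of a full
   matrix algebra of size p and of p copies of the scalars. Hence the whole algebra has a basis of
   matrix units, indexed by blocks s = (alpha, i), and the entries of B_alpha(i) are the coordinates of
   an operator in this basis: T V_s(c, d) = sum over r of B_s(T)(r, c) V_s(r, d). Conversely an operator
   satisfying such relations lies in the algebra and has these matrices, because the diagonal units sum
   to 1. Products, inverses and exponentials are computed from this relation, block by block.

   The unit V_s(r, c) has finite rank exactly if alpha is the full index set. An eigenvector of B_s(A)
   for z gives an operator W with A W = z W whose range is as large as that of the units of the block s;
   so z is in the spectrum, and z - A has an infinite-dimensional kernel if alpha is not full. The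
   resolvent is the sum of the entries of the inverses of z - B_s(A) times the units. In the Riesz
   projection at an isolated point w, Cauchy's theorem removes all blocks that do not have the
   eigenvalue w, while Q W = W for the W above; so Q has finite rank iff w is an eigenvalue of the
   finite-rank block only. *)

theory Submission
  imports Defs "HOL-Complex_Analysis.Cauchy_Integral_Theorem" "Jordan_Normal_Form.Schur_Decomposition"
begin

section \<open>Averaging over a set of coordinates\<close>

text \<open>Elements of \<open>L2\<close> are classes of functions, and the slices in the integrals
  are integrable only for almost every \<open>k\<close>. Apart from the test vectors that determine
  ranks, measure theory is therefore confined to two kinds of operators, averages and
  multiplications by indicators of boxes. All other operators of the algebra are linear combinations
  of products of these, and the computations become algebra of operators. The column index d of
  V_s(c, d) is a passive label: multiplication from the left only mixes rows, so every column of a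
  block carries a copy of the representation by B_s. The same relation proves that the coefficients
  are unique, which must be known before \<open>coeffs_of\<close>, a definite description, means
  anything. Invertibility and the Fredholm property refer to all bounded operators on
  \<open>L2\<close>, so a singular block has to exclude every bounded inverse, not just one in the
  algebra. This is why W is an operator on the whole space: (z - A) W = 0 with W nonzero leaves no
  room for a left inverse.\<close>

interpretation cube: prob_space "cube \<alpha>" for \<alpha> :: "'n set"
  by (rule prob_space_cube)

lemma prob_space_unit: "prob_space (restrict_space lborel {0..<1::real})"
  by (rule prob_spaceI) (simp add: emeasure_restrict_space space_restrict_space)

interpretation unit_prod: product_sigma_finite "\<lambda>_::'n. restrict_space lborel {0..<1::real}"
  by (rule product_sigma_finite.intro) (rule prob_space_imp_sigma_finite[OF prob_space_unit])

interpretation cube_pair: pair_sigma_finite "cube (\<alpha> :: 'n set)" "cube (\<beta> :: 'n set)"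
  for \<alpha> \<beta> ..

section \<open>Redrawing some coordinates of a uniformly distributed point\<close>

lemma measurable_merge_cube [measurable]:
  "merge (- \<alpha>) \<alpha> \<in> measurable (cube UNIV \<Otimes>\<^sub>M cube \<alpha>) (cube UNIV)"
  unfolding cube_def
proof (rule measurable_PiM_single')
  fix n
  show "(\<lambda>z. merge (- \<alpha>) \<alpha> z n)
      \<in> measurable (Pi\<^sub>M UNIV (\<lambda>_. restrict_space lborel {0..<1}) \<Otimes>\<^sub>M Pi\<^sub>M \<alpha> (\<lambda>_. restrict_space lborel {0..<1}))
          (restrict_space lborel {0..<1::real})"
    by (cases "n \<in> \<alpha>") (auto simp: merge_def split_def intro!: measurable_compose[OF measurable_fst]
      measurable_compose[OF measurable_snd] measurable_component_singleton)
qed (auto simp: merge_def space_pair_measure space_PiM PiE_iff space_restrict_space)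

text \<open>Redrawing the coordinates in \<alpha> independently of the others does not change the
  uniform distribution. Here \<open>k\<close> keeps all its coordinates, those in \<alpha> being
  overwritten, so that averages remain functions on the full cube and can be composed.\<close>

lemma distr_merge_cube:
  "distr (cube UNIV \<Otimes>\<^sub>M cube \<alpha>) (cube UNIV) (merge (- \<alpha>) \<alpha>) = cube (UNIV :: 'n::finite set)"
proof -
  let ?u = "restrict_space lborel {0..<1::real}"
  let ?D = "distr (cube UNIV \<Otimes>\<^sub>M cube \<alpha>) (cube UNIV) (merge (- \<alpha>) \<alpha>)"
  have "?D = Pi\<^sub>M (UNIV :: 'n set) (\<lambda>_. ?u)"
  proof (rule unit_prod.PiM_eqI)
    show "sets ?D = sets (Pi\<^sub>M UNIV (\<lambda>_. ?u))" by (simp add: cube_def)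
    fix A :: "'n \<Rightarrow> real set" assume A: "\<And>i. i \<in> UNIV \<Longrightarrow> A i \<in> sets ?u"
    \<comment> \<open>\<open>merge\<close> discards the \<alpha>-coordinates of the first point, so
      a box puts no condition on them; these factors have measure 1.\<close>
    define A' where "A' n = (if n \<in> \<alpha> then {0..<1} else A n)" for n
    have A': "A' n \<in> sets ?u" for n
      using A sets.top[of ?u] by (auto simp: A'_def space_restrict_space)
    have sub: "A n \<subseteq> {0..<1}" for n
      using sets.sets_into_space[of "A n" ?u] A by (auto simp: space_restrict_space)
    have pre: "merge (- \<alpha>) \<alpha> -` Pi\<^sub>E UNIV A \<inter> space (cube UNIV \<Otimes>\<^sub>M cube \<alpha>)
        = Pi\<^sub>E UNIV A' \<times> Pi\<^sub>E \<alpha> A"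
    proof (rule equalityI; rule subsetI)
      fix z assume "z \<in> merge (- \<alpha>) \<alpha> -` Pi\<^sub>E UNIV A \<inter> space (cube UNIV \<Otimes>\<^sub>M cube \<alpha>)"
      hence 1: "\<And>n. merge (- \<alpha>) \<alpha> z n \<in> A n"
        and 2: "\<And>n. fst z n \<in> {0..<1}" and 3: "snd z \<in> extensional \<alpha>"
        by (auto simp: space_pair_measure cube_def space_PiM space_restrict_space PiE_iff)
      have "fst z n \<in> A' n" for n using 1[of n] 2[of n] by (auto simp: A'_def merge_def split_def)
      moreover have "snd z n \<in> A n" if "n \<in> \<alpha>" for n using 1[of n] that by (auto simp: merge_def split_def)
      ultimately show "z \<in> Pi\<^sub>E UNIV A' \<times> Pi\<^sub>E \<alpha> A"
        using 3 by (cases z) (auto simp: PiE_iff)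
    next
      fix z assume "z \<in> Pi\<^sub>E UNIV A' \<times> Pi\<^sub>E \<alpha> A"
      hence 1: "\<And>n. fst z n \<in> A' n" and 2: "\<And>n. n \<in> \<alpha> \<Longrightarrow> snd z n \<in> A n" and 3: "snd z \<in> extensional \<alpha>"
        by (auto simp: PiE_iff)
      have "merge (- \<alpha>) \<alpha> z n \<in> A n" for n
        using 1[of n] 2[of n] by (auto simp: A'_def merge_def split_def)
      moreover have "fst z n \<in> {0..<1}" for n
        using 1[of n] sub[of n] by (auto simp: A'_def split: if_splits)
      moreover have "snd z n \<in> {0..<1}" if "n \<in> \<alpha>" for n
        using 2[OF that] sub[of n] by auto
      ultimately show "z \<in> merge (- \<alpha>) \<alpha> -` Pi\<^sub>E UNIV A \<inter> space (cube UNIV \<Otimes>\<^sub>M cube \<alpha>)"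
        using 3 by (cases z) (auto simp: space_pair_measure cube_def space_PiM space_restrict_space PiE_iff)
    qed
    have "emeasure ?D (Pi\<^sub>E UNIV A) = emeasure (cube UNIV \<Otimes>\<^sub>M cube \<alpha>) (Pi\<^sub>E UNIV A' \<times> Pi\<^sub>E \<alpha> A)"
      unfolding pre[symmetric]
      by (rule emeasure_distr) (use A in \<open>simp_all add: cube_def sets_PiM_I_finite measurable_merge_cube[unfolded cube_def]\<close>)
    also have "\<dots> = emeasure (cube UNIV) (Pi\<^sub>E UNIV A') * emeasure (cube \<alpha>) (Pi\<^sub>E \<alpha> A)"
      by (rule sigma_finite_measure.emeasure_pair_measure_Times[OF cube.sigma_finite_measure_axioms])
         (use A A' in \<open>auto simp: cube_def intro!: sets_PiM_I_finite\<close>)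
    also have "\<dots> = (\<Prod>n\<in>UNIV. emeasure ?u (A' n)) * (\<Prod>n\<in>\<alpha>. emeasure ?u (A n))"
      using A A' by (simp add: cube_def unit_prod.emeasure_PiM)
    also have "(\<Prod>n\<in>UNIV. emeasure ?u (A' n)) = (\<Prod>n\<in>- \<alpha>. emeasure ?u (A n))"
    proof -
      have "emeasure ?u {0..<1} = 1"
        using prob_space.emeasure_space_1[OF prob_space_unit] by (simp add: space_restrict_space)
      thus ?thesis
        by (subst prod.mono_neutral_cong_right[of UNIV "- \<alpha>" _ "\<lambda>n. emeasure ?u (A n)"]) (auto simp: A'_def)
    qed
    also have "\<dots> * (\<Prod>n\<in>\<alpha>. emeasure ?u (A n)) = (\<Prod>n\<in>UNIV. emeasure ?u (A n))"
      by (subst prod.union_disjoint[symmetric]) (auto intro: prod.cong)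
    finally show "emeasure ?D (Pi\<^sub>E UNIV A) = (\<Prod>n\<in>UNIV. emeasure ?u (A n))" .
  qed auto
  thus ?thesis by (simp add: cube_def)
qed

lemma sq_integrable_imp_integrable:
  assumes "sq_integrable f" shows "integrable (cube UNIV) f"
  using sq_integrable_mult_cnj[OF assms sq_integrable_const[of 1]] by simp

lemma integrable_merge_cube:
  fixes f :: "('n::finite \<Rightarrow> real) \<Rightarrow> 'b::{banach, second_countable_topology}"
  assumes "integrable (cube UNIV) f"
  shows "integrable (cube UNIV \<Otimes>\<^sub>M cube \<alpha>) (\<lambda>z. f (merge (- \<alpha>) \<alpha> z))"
proof -
  have [measurable]: "f \<in> borel_measurable (cube UNIV)"
    using assms by simp
  have "integrable (distr (cube UNIV \<Otimes>\<^sub>M cube \<alpha>) (cube UNIV) (merge (- \<alpha>) \<alpha>)) f"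
    using assms by (simp only: distr_merge_cube)
  thus ?thesis
    by (subst (asm) integrable_distr_eq) measurable
qed

lemma integral_merge_cube:
  fixes f :: "('n::finite \<Rightarrow> real) \<Rightarrow> 'b::{banach, second_countable_topology}"
  assumes "integrable (cube UNIV) f"
  shows "(LINT k|cube UNIV. LINT x|cube \<alpha>. f (merge (- \<alpha>) \<alpha> (k, x))) = (LINT k|cube UNIV. f k)"
proof -
  have [measurable]: "f \<in> borel_measurable (cube UNIV)"
    using assms by simp
  have "(LINT k|cube UNIV. LINT x|cube \<alpha>. f (merge (- \<alpha>) \<alpha> (k, x)))
     = (LINT z|(cube UNIV \<Otimes>\<^sub>M cube \<alpha>). f (merge (- \<alpha>) \<alpha> z))"
    using cube_pair.integral_fst'[OF integrable_merge_cube[OF assms, of \<alpha>]] by simp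
  also have "\<dots> = (LINT k|cube UNIV. f k)"
    using integral_distr[OF measurable_merge_cube[of \<alpha>], of f] by (simp add: distr_merge_cube)
  finally show ?thesis .
qed

lemma AE_integrable_merge_cube:
  fixes f :: "('n::finite \<Rightarrow> real) \<Rightarrow> 'b::{banach, second_countable_topology}"
  assumes "integrable (cube UNIV) f"
  shows "AE k in cube UNIV. integrable (cube \<alpha>) (\<lambda>x. f (merge (- \<alpha>) \<alpha> (k, x)))"
  using cube_pair.AE_integrable_fst'[OF integrable_merge_cube[OF assms, of \<alpha>]] by simp

lemma AE_merge_cube:
  assumes "AE k in cube (UNIV :: 'n::finite set). P k"
  shows "AE k in cube UNIV. AE x in cube \<alpha>. P (merge (- \<alpha>) \<alpha> (k, x))"
proof -
  \<comment> \<open>\<open>P\<close> need not be measurable, so the exceptional set is enlarged to a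
    measurable null set before it is pulled back along \<open>merge\<close>.\<close>
  obtain S where S: "S \<in> sets (cube UNIV)" "emeasure (cube UNIV) S = 0" "{k\<in>space (cube UNIV). \<not> P k} \<subseteq> S"
    using assms by (auto elim!: AE_E)
  have "AE k in cube UNIV. k \<notin> S"
    using S by (intro AE_not_in) (auto simp: null_sets_def)
  hence "AE k in distr (cube UNIV \<Otimes>\<^sub>M cube \<alpha>) (cube UNIV) (merge (- \<alpha>) \<alpha>). k \<notin> S"
    by (simp only: distr_merge_cube)
  hence "AE z in (cube UNIV \<Otimes>\<^sub>M cube \<alpha>). merge (- \<alpha>) \<alpha> z \<notin> S"
    using S(1) by (subst (asm) AE_distr_iff) auto
  hence "AE z in (cube UNIV \<Otimes>\<^sub>M cube \<alpha>). P (merge (- \<alpha>) \<alpha> z)"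
  proof (rule AE_mp, intro AE_I2 impI)
    fix z assume z: "z \<in> space (cube UNIV \<Otimes>\<^sub>M cube \<alpha>)" "merge (- \<alpha>) \<alpha> z \<notin> S"
    have "merge (- \<alpha>) \<alpha> z \<in> space (cube UNIV)"
      using measurable_space[OF measurable_merge_cube[of \<alpha>] z(1)] by simp
    thus "P (merge (- \<alpha>) \<alpha> z)" using S(3) z(2) by auto
  qed
  from cube_pair.AE_pair[OF this] show ?thesis by simp
qed

text \<open>The conditional expectation given the coordinates off \<alpha>, with the library's value
  0 where the slice is not integrable; hence additivity and Fubini are available only almost
  everywhere.\<close>

definition average :: "'n::finite set \<Rightarrow> (('n \<Rightarrow> real) \<Rightarrow> complex) \<Rightarrow> ('n \<Rightarrow> real) \<Rightarrow> complex"
  where "average \<alpha> f k = (LINT x|cube \<alpha>. f (merge (- \<alpha>) \<alpha> (k, x)))"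

lemma borel_measurable_average [measurable]:
  assumes [measurable]: "f \<in> borel_measurable (cube UNIV)"
  shows "average \<alpha> f \<in> borel_measurable (cube UNIV)"
proof -
  have "(\<lambda>z. f (merge (- \<alpha>) \<alpha> z)) \<in> borel_measurable (cube UNIV \<Otimes>\<^sub>M cube \<alpha>)"
    by measurable
  from cube.borel_measurable_lebesgue_integral[of "\<lambda>k x. f (merge (- \<alpha>) \<alpha> (k, x))" "cube UNIV" \<alpha>] this
  show ?thesis by (simp add: average_def[abs_def] split_def)
qed

lemma average_cong_AE:
  assumes "AE k in cube UNIV. f k = g k"
    and [measurable]: "f \<in> borel_measurable (cube UNIV)" "g \<in> borel_measurable (cube UNIV)"
  shows "AE k in cube UNIV. average \<alpha> f k = average \<alpha> g k"
  using AE_merge_cube[OF assms(1), of \<alpha>] AE_space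
proof eventually_elim
  case (elim k)
  have [measurable]: "(\<lambda>x. merge (- \<alpha>) \<alpha> (k, x)) \<in> measurable (cube \<alpha>) (cube UNIV)"
    using measurable_compose[OF measurable_Pair1'[OF elim(2)] measurable_merge_cube[of \<alpha>]] by simp
  show ?case unfolding average_def
    by (rule integral_cong_AE) (use elim in auto)
qed

text \<open>Fubini on the slice over the union, which is known to be integrable for almost every
  \<open>k\<close> only.\<close>

lemma average_disjoint:
  fixes f :: "('n::finite \<Rightarrow> real) \<Rightarrow> complex"
  assumes "\<alpha> \<inter> \<beta> = {}" "integrable (cube UNIV) f"
  shows "AE k in cube UNIV. average \<alpha> (average \<beta> f) k = average (\<alpha> \<union> \<beta>) f k"
  using AE_integrable_merge_cube[OF assms(2), of "\<alpha> \<union> \<beta>"]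
proof eventually_elim
  case (elim k)
  have m: "merge (- \<beta>) \<beta> (merge (- \<alpha>) \<alpha> (k, x), y) = merge (- (\<alpha> \<union> \<beta>)) (\<alpha> \<union> \<beta>) (k, merge \<alpha> \<beta> (x, y))" for x y
    using assms(1) by (auto simp: merge_def fun_eq_iff)
  show ?case unfolding average_def m
    using unit_prod.product_integral_fold[OF assms(1) _ _ elim[unfolded cube_def]]
    by (simp add: cube_def)
qed

text \<open>Jensen's inequality for the square, read off from the nonnegative variance of
  \<open>cmod (f x)\<close>.\<close>

lemma integral_cmod_square:
  assumes "prob_space M" "f \<in> borel_measurable M" "integrable M (\<lambda>x. (cmod (f x))\<^sup>2)"
  shows "(cmod (LINT x|M. f x))\<^sup>2 \<le> (LINT x|M. (cmod (f x))\<^sup>2)"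
proof -
  interpret prob_space M by fact
  note [measurable] = assms(2)
  have le: "cmod (f x) \<le> 1 + (cmod (f x))\<^sup>2" for x
  proof -
    have "0 \<le> (t - 1)\<^sup>2 + t\<^sup>2 + 1" for t :: real by simp
    from this[of "cmod (f x)"] show ?thesis by (simp add: power2_eq_square algebra_simps)
  qed
  have i: "integrable M (\<lambda>x. cmod (f x))"
    by (rule Bochner_Integration.integrable_bound[of M "\<lambda>x. 1 + (cmod (f x))\<^sup>2"])
       (use assms(3) in \<open>simp_all add: le\<close>)
  have "(cmod (LINT x|M. f x))\<^sup>2 \<le> (LINT x|M. cmod (f x))\<^sup>2"
    by (rule power_mono[OF integral_norm_bound norm_ge_zero])
  also have "\<dots> \<le> (LINT x|M. (cmod (f x))\<^sup>2)"
    using variance_eq[OF i assms(3)] variance_positive[of "\<lambda>x. cmod (f x)"] by simp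
  finally show ?thesis .
qed

text \<open>Jensen on each slice; integrating over \<open>k\<close> then gives back the full
  integral because redrawing coordinates preserves the measure.\<close>

lemma
  fixes f :: "('n::finite \<Rightarrow> real) \<Rightarrow> complex"
  assumes "sq_integrable f"
  shows sq_integrable_average: "sq_integrable (average \<alpha> f)"
    and average_norm_le: "(LINT k|cube UNIV. (cmod (average \<alpha> f k))\<^sup>2) \<le> (LINT k|cube UNIV. (cmod (f k))\<^sup>2)"
proof -
  have [measurable]: "f \<in> borel_measurable (cube UNIV)" and i: "integrable (cube UNIV) (\<lambda>x. (cmod (f x))\<^sup>2)"
    using assms by (auto simp: sq_integrable_def)
  define g where "g k = (LINT x|cube \<alpha>. (cmod (f (merge (- \<alpha>) \<alpha> (k, x))))\<^sup>2)" for k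
  have gi: "integrable (cube UNIV) g"
    unfolding g_def using cube_pair.integrable_fst'[OF integrable_merge_cube[OF i, of \<alpha>]] by simp
  have le: "AE k in cube UNIV. (cmod (average \<alpha> f k))\<^sup>2 \<le> g k"
    using AE_integrable_merge_cube[OF i, of \<alpha>] AE_space
  proof eventually_elim
    case (elim k)
    have [measurable]: "(\<lambda>x. merge (- \<alpha>) \<alpha> (k, x)) \<in> measurable (cube \<alpha>) (cube UNIV)"
      using measurable_compose[OF measurable_Pair1'[OF elim(2)] measurable_merge_cube[of \<alpha>]] by simp
    show ?case unfolding average_def g_def
      by (rule integral_cmod_square[OF prob_space_cube _ elim(1)]) measurable
  qed
  have "integrable (cube UNIV) (\<lambda>k. (cmod (average \<alpha> f k))\<^sup>2)"
    by (rule Bochner_Integration.integrable_bound[OF gi]) (use le in \<open>auto elim!: eventually_mono\<close>)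
  thus "sq_integrable (average \<alpha> f)" by (simp add: sq_integrable_def)
  have "(LINT k|cube UNIV. (cmod (average \<alpha> f k))\<^sup>2) \<le> (LINT k|cube UNIV. g k)"
    by (rule integral_mono_AE) fact+
  also have "\<dots> = (LINT k|cube UNIV. (cmod (f k))\<^sup>2)"
    unfolding g_def by (rule integral_merge_cube[OF i])
  finally show "(LINT k|cube UNIV. (cmod (average \<alpha> f k))\<^sup>2) \<le> (LINT k|cube UNIV. (cmod (f k))\<^sup>2)" .
qed

section \<open>Operators given by maps on functions\<close>

lemma clinop_ext: "(\<And>u. clinop_apply S u = clinop_apply T u) \<Longrightarrow> S = T"
  by (rule clinop_eqI) (simp add: clinop_apply.rep_eq)

lemma clinop_apply_add: "clinop_apply (S + T) u = clinop_apply S u + clinop_apply T u"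
  by transfer (simp add: plus_blinfun.rep_eq)

lemma clinop_apply_zero [simp]: "clinop_apply 0 u = 0"
  by transfer simp

lemma clinop_apply_scaleC: "clinop_apply (c *\<^sub>C T) u = c *\<^sub>C clinop_apply T u"
  by (simp add: clinop_apply.rep_eq scaleC_clinop_apply)

lemma clinop_apply_one [simp]: "clinop_apply 1 u = u"
  by transfer simp

lemma clinop_apply_mult: "clinop_apply (S * T) u = clinop_apply S (clinop_apply T u)"
  by transfer simp

lemma clinop_apply_sum: "clinop_apply (\<Sum>i\<in>I. T i) u = (\<Sum>i\<in>I. clinop_apply (T i) u)"
  by (induction I rule: infinite_finite_induct) (simp_all add: clinop_apply_add)

lemma bounded_linear_clinop_apply: "bounded_linear (clinop_apply T)"
  by transfer (rule blinfun.bounded_linear_right)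

lemma clinop_apply_scaleC_right: "clinop_apply T (c *\<^sub>C u) = c *\<^sub>C clinop_apply T u"
  by transfer simp

lemma scaleC_one [simp]: "1 *\<^sub>C x = (x :: 'a::complex_normed_vector)"
  using scaleR_scaleC[of 1 x] by simp

lemma scaleC_zero_left [simp]: "0 *\<^sub>C x = (0 :: 'a::complex_normed_vector)"
  using scaleR_scaleC[of 0 x] by simp

lemma scaleC_sum_right: "c *\<^sub>C (\<Sum>i\<in>I. f i) = (\<Sum>i\<in>I. c *\<^sub>C (f i :: 'a::complex_normed_vector))"
  by (induction I rule: infinite_finite_induct) (simp_all add: scaleC_add_right)

lemma scaleC_sum_left: "(\<Sum>i\<in>I. c i) *\<^sub>C x = (\<Sum>i\<in>I. c i *\<^sub>C (x :: 'a::complex_normed_vector))"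
  by (induction I rule: infinite_finite_induct) (simp_all add: scaleC_add_left)

lemma scaleC_eq_0_iff: "c *\<^sub>C x = 0 \<longleftrightarrow> c = 0 \<or> x = (0 :: 'a::complex_normed_vector)"
  using norm_scaleC[of c x] by (metis mult_eq_0_iff norm_eq_zero)

lemma scaleC_diff_left: "(a - b) *\<^sub>C x = a *\<^sub>C x - b *\<^sub>C (x :: 'a::complex_normed_vector)"
  using scaleC_add_left[of "a - b" b x] by simp

lemma mult_scaleC_left: "(c *\<^sub>C S) * T = c *\<^sub>C (S * T :: 'a::{complex_normed_vector, perfect_space} clinop)"
  by (rule clinop_ext) (simp add: clinop_apply_scaleC clinop_apply_mult)

lemma mult_scaleC_right: "S * (c *\<^sub>C T) = c *\<^sub>C (S * T :: 'a::{complex_normed_vector, perfect_space} clinop)"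
  by (rule clinop_ext) (simp add: clinop_apply_scaleC clinop_apply_mult clinop_apply_scaleC_right)

lemma abs_L2_add:
  "sq_integrable f \<Longrightarrow> sq_integrable g \<Longrightarrow> abs_L2 f + abs_L2 g = abs_L2 (\<lambda>x. f x + g x)"
  by (rule plus_L2.abs_eq) (simp_all add: L2_eq_def)

lemma abs_L2_scaleC: "sq_integrable f \<Longrightarrow> c *\<^sub>C abs_L2 f = abs_L2 (\<lambda>x. c * f x)"
  by (rule scaleC_L2.abs_eq) (simp add: L2_eq_def)

lemma rep_abs_L2:
  assumes "sq_integrable f" shows "AE k in cube UNIV. rep_L2 (abs_L2 f) k = f k"
  using L2_abs_eq_iff[OF sq_integrable_rep_L2[of "abs_L2 f"] assms] by (simp add: abs_rep_L2)

text \<open>\<Phi> is a concrete formula acting on representatives, \<open>T\<close> acts on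
  classes. Through this relation an operator identity reduces to an almost-everywhere identity of
  formulas, see \<open>implements_eqI\<close>.\<close>

definition implements ::
  "'n::finite L2 clinop \<Rightarrow> ((('n \<Rightarrow> real) \<Rightarrow> complex) \<Rightarrow> ('n \<Rightarrow> real) \<Rightarrow> complex) \<Rightarrow> bool"
  where "implements T \<Phi> \<longleftrightarrow> (\<forall>f. sq_integrable f \<longrightarrow>
    sq_integrable (\<Phi> f) \<and> clinop_apply T (abs_L2 f) = abs_L2 (\<Phi> f))"

lemma implementsD:
  assumes "implements T \<Phi>" "sq_integrable f"
  shows "sq_integrable (\<Phi> f)" "clinop_apply T (abs_L2 f) = abs_L2 (\<Phi> f)"
  using assms by (auto simp: implements_def)

text \<open>The operator applies \<Phi> to the chosen representative; the almost-everywhere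
  hypotheses make this independent of the choice and linear. A bound by 1 covers both uses:
  averaging is a contraction, and the indicators take the values 0 and 1.\<close>

lemma ex_implements:
  fixes \<Phi> :: "(('n::finite \<Rightarrow> real) \<Rightarrow> complex) \<Rightarrow> ('n \<Rightarrow> real) \<Rightarrow> complex"
  assumes sq: "\<And>f. sq_integrable f \<Longrightarrow> sq_integrable (\<Phi> f)"
    and cong: "\<And>f g. sq_integrable f \<Longrightarrow> sq_integrable g \<Longrightarrow> AE k in cube UNIV. f k = g k \<Longrightarrow>
      AE k in cube UNIV. \<Phi> f k = \<Phi> g k"
    and add: "\<And>f g. sq_integrable f \<Longrightarrow> sq_integrable g \<Longrightarrow>
      AE k in cube UNIV. \<Phi> (\<lambda>x. f x + g x) k = \<Phi> f k + \<Phi> g k"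
    and scale: "\<And>f c. sq_integrable f \<Longrightarrow> AE k in cube UNIV. \<Phi> (\<lambda>x. c * f x) k = c * \<Phi> f k"
    and bound: "\<And>f. sq_integrable f \<Longrightarrow>
      (LINT k|cube UNIV. (cmod (\<Phi> f k))\<^sup>2) \<le> (LINT k|cube UNIV. (cmod (f k))\<^sup>2)"
  shows "\<exists>T. implements T \<Phi>"
proof -
  define L where "L u = abs_L2 (\<Phi> (rep_L2 u))" for u
  have abs: "L (abs_L2 f) = abs_L2 (\<Phi> f)" if "sq_integrable f" for f
    unfolding L_def by (subst L2_abs_eq_iff) (use that in \<open>auto intro!: sq cong rep_abs_L2 sq_integrable_rep_L2\<close>)
  have Ladd: "L (u + v) = L u + L v" for u v
  proof -
    have "L (abs_L2 (rep_L2 u) + abs_L2 (rep_L2 v)) = L (abs_L2 (rep_L2 u)) + L (abs_L2 (rep_L2 v))"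
      by (simp add: abs_L2_add abs sq sq_integrable_add sq_integrable_rep_L2 L2_abs_eq_iff add)
    thus ?thesis by (simp add: abs_rep_L2)
  qed
  have Lscale: "L (c *\<^sub>C u) = c *\<^sub>C L u" for c u
  proof -
    have "L (c *\<^sub>C abs_L2 (rep_L2 u)) = c *\<^sub>C L (abs_L2 (rep_L2 u))"
      by (simp add: abs_L2_scaleC abs sq sq_integrable_cmult sq_integrable_rep_L2 L2_abs_eq_iff scale)
    thus ?thesis by (simp add: abs_rep_L2)
  qed
  have Lnorm: "norm (L u) \<le> norm u * 1" for u
  proof -
    have "norm (L (abs_L2 (rep_L2 u))) \<le> norm (abs_L2 (rep_L2 u))"
      by (simp add: norm_abs_L2 abs sq sq_integrable_rep_L2 bound)
    thus ?thesis by (simp add: abs_rep_L2)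
  qed
  have bl: "bounded_linear L"
    by (rule bounded_linear_intro[OF Ladd _ Lnorm]) (simp add: scaleR_scaleC Lscale)
  have "clinop_apply (Clinop (Blinfun L)) = L"
    by (simp add: clinop_apply.rep_eq Clinop_inverse bounded_linear_Blinfun_apply[OF bl] Lscale)
  thus ?thesis
    by (intro exI[of _ "Clinop (Blinfun L)"]) (simp add: implements_def abs sq)
qed

lemma implements_eqI:
  assumes "implements S \<Phi>" "implements T \<Psi>"
    and "\<And>f. sq_integrable f \<Longrightarrow> AE k in cube UNIV. \<Phi> f k = \<Psi> f k"
  shows "S = T"
proof (rule clinop_ext)
  fix u
  have "clinop_apply S (abs_L2 (rep_L2 u)) = clinop_apply T (abs_L2 (rep_L2 u))"
    using assms sq_integrable_rep_L2[of u]
    by (simp add: implementsD L2_abs_eq_iff)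
  thus "clinop_apply S u = clinop_apply T u" by (simp add: abs_rep_L2)
qed

lemma implements_mult:
  "implements S \<Phi> \<Longrightarrow> implements T \<Psi> \<Longrightarrow> implements (S * T) (\<lambda>f. \<Phi> (\<Psi> f))"
  by (simp add: implements_def clinop_apply_mult)

lemma implements_one: "implements 1 (\<lambda>f. f)"
  by (simp add: implements_def)

lemma implements_zero: "implements 0 (\<lambda>f k. 0)"
  by (simp add: implements_def zero_L2_def)

lemma implements_add:
  "implements S \<Phi> \<Longrightarrow> implements T \<Psi> \<Longrightarrow> implements (S + T) (\<lambda>f k. \<Phi> f k + \<Psi> f k)"
  by (simp add: implements_def clinop_apply_add abs_L2_add sq_integrable_add)

lemma implements_scaleC:
  "implements T \<Psi> \<Longrightarrow> implements (c *\<^sub>C T) (\<lambda>f k. c * \<Psi> f k)"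
  by (simp add: implements_def clinop_apply_scaleC abs_L2_scaleC sq_integrable_cmult)

lemma implements_sum:
  "(\<And>i. i \<in> I \<Longrightarrow> implements (T i) (\<Phi> i)) \<Longrightarrow> implements (\<Sum>i\<in>I. T i) (\<lambda>f k. \<Sum>i\<in>I. \<Phi> i f k)"
  by (induction I rule: infinite_finite_induct) (simp_all add: implements_zero implements_add)

section \<open>Averaging operators and multiplication by indicators of cells\<close>

text \<open>A choice without ambiguity: by \<open>implements_eqI\<close> at most one operator
  implements a given map.\<close>

definition Avg :: "'n::finite set \<Rightarrow> 'n L2 clinop"
  where "Avg \<alpha> = (SOME T. implements T (average \<alpha>))"

lemma implements_Avg: "implements (Avg \<alpha>) (average (\<alpha> :: 'n::finite set))"
  unfolding Avg_def
proof (rule someI_ex, rule ex_implements)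
  fix f g :: "('n \<Rightarrow> real) \<Rightarrow> complex" and c :: complex
  assume f: "sq_integrable f"
  show "sq_integrable (average \<alpha> f)"
    "(LINT k|cube UNIV. (cmod (average \<alpha> f k))\<^sup>2) \<le> (LINT k|cube UNIV. (cmod (f k))\<^sup>2)"
    using f by (rule sq_integrable_average average_norm_le)+
  show "AE k in cube UNIV. average \<alpha> (\<lambda>x. c * f x) k = c * average \<alpha> f k"
    by (simp add: average_def)
  assume g: "sq_integrable g"
  show "AE k in cube UNIV. average \<alpha> (\<lambda>x. f x + g x) k = average \<alpha> f k + average \<alpha> g k"
    using AE_integrable_merge_cube[OF sq_integrable_imp_integrable[OF f], of \<alpha>]
      AE_integrable_merge_cube[OF sq_integrable_imp_integrable[OF g], of \<alpha>]
    by eventually_elim (simp add: average_def)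
  assume "AE k in cube UNIV. f k = g k"
  thus "AE k in cube UNIV. average \<alpha> f k = average \<alpha> g k"
    using f g by (intro average_cong_AE) (auto simp: sq_integrable_def)
qed

section \<open>Multiplication by indicators of boxes\<close>

definition cell :: "nat \<Rightarrow> 'n set \<Rightarrow> ('n \<Rightarrow> nat) \<Rightarrow> ('n \<Rightarrow> real) \<Rightarrow> complex"
  where "cell p \<alpha> i k = (\<Prod>n\<in>\<alpha>. chi p (i n) (k n))"

lemma measurable_chi [measurable]: "chi p r \<in> borel_measurable (restrict_space lborel {0..<1})"
  unfolding chi_def by (rule measurable_restrict_space1) measurable

lemma borel_measurable_cell [measurable]:
  assumes "\<alpha> \<subseteq> \<beta>" shows "cell p \<alpha> i \<in> borel_measurable (cube \<beta>)"
  unfolding cell_def cube_def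
proof (intro borel_measurable_prod)
  fix n assume "n \<in> \<alpha>"
  hence "(\<lambda>k. k n) \<in> measurable (Pi\<^sub>M \<beta> (\<lambda>_. restrict_space lborel {0..<1})) (restrict_space lborel {0..<1::real})"
    using assms by (intro measurable_component_singleton) auto
  from measurable_compose[OF this measurable_chi]
  show "(\<lambda>k. chi p (i n) (k n)) \<in> borel_measurable (Pi\<^sub>M \<beta> (\<lambda>_. restrict_space lborel {0..<1}))" .
qed

lemma chi_mult:
  assumes "p \<ge> 1" shows "chi p r y * chi p s y = (if r = s then chi p r y else 0)"
proof -
  have "r = s" if "(real r - 1) / real p \<le> y" "y < real r / real p" "(real s - 1) / real p \<le> y" "y < real s / real p"
  proof -
    have "real r - 1 \<le> y * p" "y * p < real r" "real s - 1 \<le> y * p" "y * p < real s"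
      using that assms by (simp_all add: field_simps)
    hence "real r < real s + 1" "real s < real r + 1" by linarith+
    thus ?thesis by linarith
  qed
  thus ?thesis by (auto simp: chi_def indicator_def)
qed

lemma sum_chi:
  assumes "p \<ge> 1" "y \<in> {0..<1}" shows "(\<Sum>r\<in>{1..p}. chi p r y) = 1"
proof -
  \<comment> \<open>The number of the cell containing \<open>y\<close>; the shift by one is due to
    cells being counted from 1. Multiplying the sum by \<open>chi p s y\<close>, which is 1, leaves
    one term.\<close>
  define s where "s = nat \<lfloor>y * p\<rfloor> + 1"
  have "0 \<le> y * p" "y * p < p" using assms by auto
  hence 1: "real s - 1 \<le> y * p" "y * p < real s" "1 \<le> s"
    unfolding s_def by (auto, linarith)
  have "real s < real p + 1" using 1(1) \<open>y * p < p\<close> by linarith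
  hence "s \<le> p" by linarith
  note * = 1(1,2) and sp = \<open>1 \<le> s\<close> \<open>s \<le> p\<close>
  hence s: "chi p s y = 1"
    using assms(1) by (auto simp: chi_def indicator_def field_simps)
  have "(\<Sum>r\<in>{1..p}. chi p r y) = (\<Sum>r\<in>{1..p}. chi p r y * chi p s y)"
    by (simp add: s)
  also have "\<dots> = (\<Sum>r\<in>{1..p}. if r = s then chi p r y else 0)"
    by (simp only: chi_mult[OF assms(1)])
  also have "\<dots> = 1"
    using sp s by simp
  finally show ?thesis .
qed

lemma integral_chi:
  assumes "p \<ge> 1" "r \<in> {1..p}"
  shows "(LINT y|restrict_space lborel {0..<1}. chi p r y) = 1 / of_nat p"
proof -
  have sub: "{(real r - 1) / p..<r / p} \<subseteq> {0..<1}"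
    using assms by (auto simp: field_simps)
  have "(LINT y|restrict_space lborel {0..<1}. chi p r y)
      = (LINT y|lborel. indicator {0..<1} y *\<^sub>R chi p r y)"
    by (rule integral_restrict_space) simp
  also have "\<dots> = (LINT y|lborel. complex_of_real (indicator {(real r - 1) / p..<r / p} y))"
    by (rule Bochner_Integration.integral_cong) (use sub in \<open>auto simp: chi_def indicator_def\<close>)
  also have "\<dots> = of_real (real r / p - (real r - 1) / p)"
    using assms(1) by (simp add: field_simps)
  also have "real r / p - (real r - 1) / p = 1 / p"
    by (simp add: diff_divide_distrib)
  finally show ?thesis by simp
qed

lemma cell_cases: "cell p \<alpha> i k = 0 \<or> cell p \<alpha> i (k :: 'n::finite \<Rightarrow> real) = 1"
  unfolding cell_def by (induction \<alpha> rule: infinite_finite_induct) (auto simp: chi_def indicator_def)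

lemma cell_mult:
  assumes "p \<ge> 1"
  shows "cell p \<alpha> i k * cell p \<alpha> j k = (if \<forall>n\<in>\<alpha>. i n = j n then cell p \<alpha> i (k :: 'n::finite \<Rightarrow> real) else 0)"
proof -
  have "cell p \<alpha> i k * cell p \<alpha> j k = (\<Prod>n\<in>\<alpha>. if i n = j n then chi p (i n) (k n) else 0)"
    by (simp only: cell_def chi_mult[OF assms] flip: prod.distrib)
  also have "\<dots> = (if \<forall>n\<in>\<alpha>. i n = j n then cell p \<alpha> i k else 0)"
    by (auto simp: cell_def)
  finally show ?thesis .
qed

lemma cell_union:
  "\<alpha> \<inter> \<beta> = {} \<Longrightarrow> cell p (\<alpha> \<union> \<beta>) i k = cell p \<alpha> i k * cell p \<beta> i (k :: 'n::finite \<Rightarrow> real)"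
  unfolding cell_def by (rule prod.union_disjoint) auto

definition Cell :: "nat \<Rightarrow> 'n::finite set \<Rightarrow> ('n \<Rightarrow> nat) \<Rightarrow> 'n L2 clinop"
  where "Cell p \<alpha> i = (SOME T. implements T (\<lambda>f k. cell p \<alpha> i k * f k))"

lemma implements_Cell: "implements (Cell p \<alpha> i) (\<lambda>f k. cell p \<alpha> i k * f (k :: 'n::finite \<Rightarrow> real))"
  unfolding Cell_def
proof (rule someI_ex, rule ex_implements)
  fix f g :: "('n \<Rightarrow> real) \<Rightarrow> complex" and c :: complex
  assume f: "sq_integrable f"
  hence [measurable]: "f \<in> borel_measurable (cube UNIV)" and i: "integrable (cube UNIV) (\<lambda>k. (cmod (f k))\<^sup>2)"
    by (auto simp: sq_integrable_def)
  have le: "(cmod (cell p \<alpha> i k * f k))\<^sup>2 \<le> (cmod (f k))\<^sup>2" for k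
    using cell_cases[of p \<alpha> i k] by auto
  have i2: "integrable (cube UNIV) (\<lambda>k. (cmod (cell p \<alpha> i k * f k))\<^sup>2)"
    by (rule Bochner_Integration.integrable_bound[OF i]) (use le in auto)
  thus "sq_integrable (\<lambda>k. cell p \<alpha> i k * f k)" by (simp add: sq_integrable_def)
  show "(LINT k|cube UNIV. (cmod (cell p \<alpha> i k * f k))\<^sup>2) \<le> (LINT k|cube UNIV. (cmod (f k))\<^sup>2)"
    by (rule integral_mono[OF i2 i le])
qed (auto simp: algebra_simps elim: eventually_mono)

lemma Cell_cong: "(\<And>n. n \<in> \<alpha> \<Longrightarrow> i n = j n) \<Longrightarrow> Cell p \<alpha> i = Cell p \<alpha> j"
  by (rule implements_eqI[OF implements_Cell implements_Cell]) (simp add: cell_def)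

lemma Cell_mult:
  assumes "p \<ge> 1"
  shows "Cell p \<alpha> i * Cell p \<alpha> j = (if \<forall>n\<in>\<alpha>. i n = j n then Cell p \<alpha> i else 0)"
proof (cases "\<forall>n\<in>\<alpha>. i n = j n")
  case True
  hence c: "cell p \<alpha> i k * (cell p \<alpha> j k * y) = cell p \<alpha> i k * y" for k y
    unfolding mult.assoc[symmetric] cell_mult[OF assms] by auto
  have "Cell p \<alpha> i * Cell p \<alpha> j = Cell p \<alpha> i"
    by (rule implements_eqI[OF implements_mult[OF implements_Cell implements_Cell] implements_Cell])
       (simp add: c)
  thus ?thesis using True by simp
next
  case False
  hence c: "cell p \<alpha> i k * (cell p \<alpha> j k * y) = 0" for k y
    unfolding mult.assoc[symmetric] cell_mult[OF assms] by auto
  have "Cell p \<alpha> i * Cell p \<alpha> j = 0"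
    by (rule implements_eqI[OF implements_mult[OF implements_Cell implements_Cell] implements_zero])
       (simp only: c, simp)
  thus ?thesis using False by auto
qed

lemma Cell_commute: "Cell p \<alpha> i * Cell p \<beta> j = Cell p \<beta> j * Cell p \<alpha> i"
  by (rule implements_eqI[OF implements_mult[OF implements_Cell implements_Cell]
      implements_mult[OF implements_Cell implements_Cell]]) (simp add: mult_ac)

lemma Cell_union: "\<alpha> \<inter> \<beta> = {} \<Longrightarrow> Cell p (\<alpha> \<union> \<beta>) i = Cell p \<alpha> i * Cell p \<beta> i"
  by (rule implements_eqI[OF implements_Cell implements_mult[OF implements_Cell implements_Cell]])
     (simp add: cell_union mult.assoc)

lemma Cell_empty [simp]: "Cell p {} i = 1"
  by (rule implements_eqI[OF implements_Cell implements_one]) (simp add: cell_def)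

lemma finite_multi_idx [simp]: "finite (multi_idx p (\<alpha> :: 'n::finite set))"
  by (simp add: multi_idx_def finite_PiE)

text \<open>Obtained by expanding the product over all coordinates of the sums
  \<open>\<Sum>r\<in>{1..p}. chi p r (k n)\<close>, each equal to 1 for \<open>k\<close> in the
  cube.\<close>

lemma sum_Cell:
  assumes "p \<ge> 1" shows "(\<Sum>i\<in>multi_idx p UNIV. Cell p UNIV i) = (1 :: 'n::finite L2 clinop)"
proof (rule implements_eqI[OF implements_sum[OF implements_Cell] implements_one])
  fix f :: "('n \<Rightarrow> real) \<Rightarrow> complex"
  show "AE k in cube UNIV. (\<Sum>i\<in>multi_idx p UNIV. cell p UNIV i k * f k) = f k"
    using AE_space
  proof eventually_elim
    case (elim k)
    hence "k n \<in> {0..<1}" for n by (auto simp: cube_def space_PiM space_restrict_space PiE_iff)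
    hence "(\<Prod>n\<in>UNIV. \<Sum>r\<in>{1..p}. chi p r (k n)) = 1"
      by (intro prod.neutral ballI sum_chi[OF assms])
    hence "(\<Sum>i\<in>multi_idx p UNIV. cell p UNIV i k) = 1"
      unfolding cell_def multi_idx_def by (subst prod_sum_PiE[symmetric]) auto
    thus ?case by (simp flip: sum_distrib_right)
  qed
qed

lemma Avg_empty [simp]: "Avg {} = (1 :: 'n::finite L2 clinop)"
proof (rule implements_eqI[OF implements_Avg implements_one])
  fix f :: "('n \<Rightarrow> real) \<Rightarrow> complex"
  have "average {} f k = f k" for k
    by (simp add: average_def merge_def cube.prob_space)
  thus "AE k in cube UNIV. average {} f k = f k" by simp
qed

lemma Avg_disjoint: "\<alpha> \<inter> \<beta> = {} \<Longrightarrow> Avg \<alpha> * Avg \<beta> = Avg (\<alpha> \<union> \<beta>)"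
  by (rule implements_eqI[OF implements_mult[OF implements_Avg implements_Avg] implements_Avg])
     (rule average_disjoint[OF _ sq_integrable_imp_integrable])

lemma Avg_Cell_commute:
  assumes "\<alpha> \<inter> \<beta> = {}" shows "Avg \<alpha> * Cell p \<beta> i = Cell p \<beta> i * Avg (\<alpha> :: 'n::finite set)"
proof (rule implements_eqI[OF implements_mult[OF implements_Avg implements_Cell]
      implements_mult[OF implements_Cell implements_Avg]])
  fix f :: "('n \<Rightarrow> real) \<Rightarrow> complex"
  have "cell p \<beta> i (merge (- \<alpha>) \<alpha> (k, x)) = cell p \<beta> i k" for k x
    unfolding cell_def by (rule prod.cong) (use assms in \<open>auto simp: merge_def\<close>)
  thus "AE k in cube UNIV. average \<alpha> (\<lambda>k. cell p \<beta> i k * f k) k = cell p \<beta> i k * average \<alpha> f k"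
    by (simp add: average_def)
qed

lemma integral_cell:
  assumes "p \<ge> 1" "\<And>n. n \<in> \<alpha> \<Longrightarrow> i n \<in> {1..p}"
  shows "(LINT x|cube \<alpha>. cell p \<alpha> i x) = 1 / of_nat (p ^ card (\<alpha> :: 'n::finite set))"
proof -
  have "integrable (restrict_space lborel {0..<1}) (chi p r)" for r
    by (rule finite_measure.integrable_const_bound[where B = 1])
       (use prob_space_unit in \<open>auto simp: prob_space_def chi_def indicator_def\<close>)
  hence "(LINT x|cube \<alpha>. cell p \<alpha> i x) = (\<Prod>n\<in>\<alpha>. LINT y|restrict_space lborel {0..<1}. chi p (i n) y)"
    unfolding cube_def cell_def by (intro unit_prod.product_integral_prod) auto
  also have "\<dots> = (\<Prod>n\<in>\<alpha>. 1 / of_nat p)"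
    by (rule prod.cong) (use assms in \<open>auto simp: integral_chi\<close>)
  also have "\<dots> = 1 / of_nat (p ^ card \<alpha>)"
    by (simp add: power_one_over)
  finally show ?thesis .
qed

text \<open>The inner average no longer depends on the coordinates in \<alpha>, so it leaves the
  outer integral, and what remains there is the volume of a cell.\<close>

lemma Avg_Cell_Avg:
  assumes "p \<ge> 1" "\<And>n. n \<in> \<alpha> \<Longrightarrow> i n \<in> {1..p}"
  shows "Avg \<alpha> * Cell p \<alpha> i * Avg \<alpha> = (1 / of_nat (p ^ card \<alpha>)) *\<^sub>C Avg (\<alpha> :: 'n::finite set)"
proof (rule implements_eqI[OF implements_mult[OF implements_mult[OF implements_Avg implements_Cell] implements_Avg]
      implements_scaleC[OF implements_Avg]])
  fix f :: "('n \<Rightarrow> real) \<Rightarrow> complex"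
  have "average \<alpha> f (merge (- \<alpha>) \<alpha> (k, x)) = average \<alpha> f k" for k x
    by (simp add: average_def merge_def)
       (rule arg_cong[where f = "\<lambda>g. LINT x|cube \<alpha>. f (g x)"], auto simp: fun_eq_iff)
  moreover have "cell p \<alpha> i (merge (- \<alpha>) \<alpha> (k, x)) = cell p \<alpha> i x" for k x
    unfolding cell_def by (rule prod.cong) (auto simp: merge_def)
  ultimately have "average \<alpha> (\<lambda>k. cell p \<alpha> i k * average \<alpha> f k) k = 1 / of_nat (p ^ card \<alpha>) * average \<alpha> f k" for k
    using integral_cell[OF assms(1), of \<alpha> i] assms(2) by (simp add: average_def[of \<alpha> "\<lambda>k. cell p \<alpha> i k * average \<alpha> f k"])
  thus "AE k in cube UNIV. average \<alpha> (\<lambda>k. cell p \<alpha> i k * average \<alpha> f k) k = 1 / of_nat (p ^ card \<alpha>) * average \<alpha> f k"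
    by simp
qed

section \<open>Kernel units and matrix units\<close>

text \<open>The operator that belongs to a single coefficient equal to 1. With the factor
  \<open>p ^ card \<alpha>\<close>, the reciprocal of the volume of a cell, products of such
  operators are again such operators or 0.\<close>

definition kernel_unit :: "nat \<Rightarrow> 'n::finite set \<Rightarrow> ('n \<Rightarrow> nat) \<Rightarrow> ('n \<Rightarrow> nat) \<Rightarrow> 'n L2 clinop"
  where "kernel_unit p \<alpha> i m = of_nat (p ^ card \<alpha>) *\<^sub>C (Cell p UNIV i * Avg \<alpha> * Cell p \<alpha> m)"

lemma kernel_unit_cong:
  "(\<And>n. n \<in> \<alpha> \<Longrightarrow> m n = m' n) \<Longrightarrow> kernel_unit p \<alpha> i m = kernel_unit p \<alpha> i m'"
  unfolding kernel_unit_def using Cell_cong[of \<alpha> m m' p] by metis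

text \<open>Only the coordinates in \<alpha> \<inter> \<beta> are averaged twice. There
  \<open>Avg_Cell_Avg\<close> produces the factor; the part of the cell on \<alpha> - \<beta>
  commutes with \<open>Avg \<beta>\<close>.\<close>

lemma Avg_Cell_Avg_union:
  assumes "p \<ge> 1" "\<And>n. n \<in> \<alpha> \<Longrightarrow> m n \<in> {1..p}"
  shows "Avg \<alpha> * Cell p \<alpha> m * Avg \<beta> =
    (1 / of_nat (p ^ card (\<alpha> \<inter> \<beta>))) *\<^sub>C (Avg (\<alpha> \<union> \<beta>) * Cell p (\<alpha> - \<beta>) (m :: 'n::finite \<Rightarrow> nat))"
proof -
  let ?\<gamma> = "\<alpha> \<inter> \<beta>"
  have a: "Avg \<alpha> = Avg (\<alpha> - \<beta>) * Avg ?\<gamma>"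
    by (subst Avg_disjoint) (auto intro: arg_cong[where f = Avg])
  have b: "Avg \<beta> = Avg ?\<gamma> * Avg (\<beta> - \<alpha>)"
    by (subst Avg_disjoint) (auto intro: arg_cong[where f = Avg])
  have u: "Avg (\<alpha> - \<beta>) * (Avg ?\<gamma> * Avg (\<beta> - \<alpha>)) = Avg (\<alpha> \<union> \<beta>)"
    unfolding b[symmetric] by (subst Avg_disjoint) (auto intro: arg_cong[where f = Avg])
  have c: "Cell p \<alpha> m = Cell p ?\<gamma> m * Cell p (\<alpha> - \<beta>) m"
    by (subst Cell_union[symmetric]) (auto intro: arg_cong[where f = "\<lambda>\<alpha>. Cell p \<alpha> m"])
  have "Avg \<alpha> * Cell p \<alpha> m * Avg \<beta> = Avg \<alpha> * Cell p ?\<gamma> m * (Cell p (\<alpha> - \<beta>) m * Avg \<beta>)"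
    by (simp add: c mult.assoc)
  also have "Cell p (\<alpha> - \<beta>) m * Avg \<beta> = Avg \<beta> * Cell p (\<alpha> - \<beta>) m"
    by (rule Avg_Cell_commute[symmetric]) auto
  also have "Avg \<alpha> * Cell p ?\<gamma> m * (Avg \<beta> * Cell p (\<alpha> - \<beta>) m) =
      Avg (\<alpha> - \<beta>) * (Avg ?\<gamma> * Cell p ?\<gamma> m * Avg ?\<gamma>) * Avg (\<beta> - \<alpha>) * Cell p (\<alpha> - \<beta>) m"
    by (simp add: a b mult.assoc)
  also have "Avg ?\<gamma> * Cell p ?\<gamma> m * Avg ?\<gamma> = (1 / of_nat (p ^ card ?\<gamma>)) *\<^sub>C Avg ?\<gamma>"
    by (rule Avg_Cell_Avg) (use assms in auto)
  finally show ?thesis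
    by (simp add: mult_scaleC_left mult_scaleC_right mult.assoc flip: u)
qed

text \<open>In a coordinate outside \<alpha> the left factor only multiplies by an indicator, so its
  output index \<open>i n\<close> must equal \<open>j n\<close>; in \<alpha> its input index
  \<open>m n\<close> must. In the product, a coordinate in \<beta> takes its input index from the
  right factor, and one in \<alpha> - \<beta> keeps \<open>m n\<close>.\<close>

lemma kernel_unit_mult:
  assumes p: "p \<ge> 1" and m: "\<And>n. n \<in> \<alpha> \<Longrightarrow> m n \<in> {1..p}"
  shows "kernel_unit p \<alpha> i m * kernel_unit p \<beta> j l =
    (if (\<forall>n\<in>- \<alpha>. i n = j n) \<and> (\<forall>n\<in>\<alpha>. m n = j n)
     then kernel_unit p (\<alpha> \<union> \<beta>) i (\<lambda>n. if n \<in> \<beta> then l n else m n) else (0 :: 'n::finite L2 clinop))"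
proof -
  let ?u = "UNIV :: 'n set"
  have j: "Cell p ?u j = Cell p \<alpha> j * Cell p (- \<alpha>) j"
    by (subst Cell_union[symmetric]) auto
  have i: "Cell p ?u i = Cell p \<alpha> i * Cell p (- \<alpha>) i"
    by (subst Cell_union[symmetric]) auto
  let ?c = "of_nat (p ^ card \<alpha>) * of_nat (p ^ card \<beta>) :: complex"
  have "kernel_unit p \<alpha> i m * kernel_unit p \<beta> j l =
      ?c *\<^sub>C (Cell p ?u i * Avg \<alpha> * (Cell p \<alpha> m * Cell p ?u j) * Avg \<beta> * Cell p \<beta> l)"
    by (simp add: kernel_unit_def mult_scaleC_left mult_scaleC_right scaleC_scaleC mult.assoc mult.commute)
  also have "Cell p \<alpha> m * Cell p ?u j = (if \<forall>n\<in>\<alpha>. m n = j n then Cell p (- \<alpha>) j * Cell p \<alpha> m else 0)"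
    unfolding j mult.assoc[symmetric] Cell_mult[OF p] by (simp add: Cell_commute[of p \<alpha>])
  finally have 1: "kernel_unit p \<alpha> i m * kernel_unit p \<beta> j l =
      (if \<forall>n\<in>\<alpha>. m n = j n then ?c *\<^sub>C (Cell p ?u i * (Avg \<alpha> * Cell p (- \<alpha>) j) * Cell p \<alpha> m * Avg \<beta> * Cell p \<beta> l)
       else 0)"
    by (simp add: mult.assoc)
  have 2: "Avg \<alpha> * Cell p (- \<alpha>) j = Cell p (- \<alpha>) j * Avg \<alpha>"
    by (rule Avg_Cell_commute) auto
  have 3: "Cell p ?u i * Cell p (- \<alpha>) j = (if \<forall>n\<in>- \<alpha>. i n = j n then Cell p ?u i else 0)"
    unfolding i mult.assoc Cell_mult[OF p] by simp
  have 4: "Cell p ?u i * (Avg \<alpha> * Cell p (- \<alpha>) j) * Cell p \<alpha> m * Avg \<beta> * Cell p \<beta> l =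
     (if \<forall>n\<in>- \<alpha>. i n = j n then Cell p ?u i * (Avg \<alpha> * Cell p \<alpha> m * Avg \<beta>) * Cell p \<beta> l else 0)"
    using 3 unfolding 2 by (simp flip: mult.assoc)
  have 5: "Cell p (\<alpha> - \<beta>) m * Cell p \<beta> l = Cell p (\<alpha> \<union> \<beta>) (\<lambda>n. if n \<in> \<beta> then l n else m n)"
  proof -
    let ?l = "\<lambda>n. if n \<in> \<beta> then l n else m n"
    have "Cell p (\<alpha> - \<beta>) m * Cell p \<beta> l = Cell p (\<alpha> - \<beta>) ?l * Cell p \<beta> ?l"
      by (intro arg_cong2[where f = "(*)"] Cell_cong) auto
    also have "\<dots> = Cell p ((\<alpha> - \<beta>) \<union> \<beta>) ?l"
      by (rule Cell_union[symmetric]) auto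
    finally show ?thesis by simp
  qed
  have av: "Avg \<alpha> * Cell p \<alpha> m * Avg \<beta> =
      (1 / of_nat (p ^ card (\<alpha> \<inter> \<beta>))) *\<^sub>C (Avg (\<alpha> \<union> \<beta>) * Cell p (\<alpha> - \<beta>) m)"
    using p m by (rule Avg_Cell_Avg_union)
  have 6: "Cell p ?u i * (Avg \<alpha> * Cell p \<alpha> m * Avg \<beta>) * Cell p \<beta> l =
     (1 / of_nat (p ^ card (\<alpha> \<inter> \<beta>))) *\<^sub>C (Cell p ?u i * Avg (\<alpha> \<union> \<beta>) * Cell p (\<alpha> \<union> \<beta>) (\<lambda>n. if n \<in> \<beta> then l n else m n))"
    unfolding av 5[symmetric]
    by (simp add: mult_scaleC_left mult_scaleC_right mult.assoc)
  \<comment> \<open>The surplus factor of the two normalisations,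
    \<open>p ^ card (\<alpha> \<inter> \<beta>)\<close>, cancels the volume coming from
    \<open>av\<close>.\<close>
  have "p ^ card \<alpha> * p ^ card \<beta> = p ^ card (\<alpha> \<union> \<beta>) * p ^ card (\<alpha> \<inter> \<beta>)"
    using card_Un_Int[of \<alpha> \<beta>] by (simp flip: power_add)
  hence "?c = of_nat (p ^ card (\<alpha> \<union> \<beta>)) * of_nat (p ^ card (\<alpha> \<inter> \<beta>))"
    by (simp only: of_nat_mult[symmetric])
  hence 7: "?c * (1 / of_nat (p ^ card (\<alpha> \<inter> \<beta>))) = of_nat (p ^ card (\<alpha> \<union> \<beta>))"
    using p by simp
  have 8: "kernel_unit p (\<alpha> \<union> \<beta>) i (\<lambda>n. if n \<in> \<beta> then l n else m n) =
      ?c *\<^sub>C (1 / of_nat (p ^ card (\<alpha> \<inter> \<beta>))) *\<^sub>C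
        (Cell p ?u i * Avg (\<alpha> \<union> \<beta>) * Cell p (\<alpha> \<union> \<beta>) (\<lambda>n. if n \<in> \<beta> then l n else m n))"
    unfolding kernel_unit_def scaleC_scaleC 7 ..
  show ?thesis
    unfolding 1 4 6 8 by simp
qed

text \<open>In a single coordinate, write \<open>X r\<close> for the multiplication by \<open>chi p r\<close> and \<open>Y r s\<close> for the integral
  operator with kernel \<open>p * chi p r k * chi p s x\<close>; then \<open>kernel_unit p \<alpha> i m\<close> is the tensor product of
  \<open>Y (i n) (m n)\<close> over \<open>n \<in> \<alpha>\<close> and of \<open>X (i n)\<close> over the other \<open>n\<close>. The operators \<open>Y r s\<close> are matrix units, and
  the \<open>X r - Y r r\<close> are orthogonal idempotents annihilated by all of them, on both sides. So replacing
  \<open>X\<close> by \<open>X - Y\<close> off \<open>\<alpha>\<close> yields matrix units for the whole algebra; the sum below is this tensor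
  product, expanded.\<close>

definition mat_unit :: "nat \<Rightarrow> 'n::finite set \<Rightarrow> ('n \<Rightarrow> nat) \<Rightarrow> ('n \<Rightarrow> nat) \<Rightarrow> 'n L2 clinop"
  where "mat_unit p \<alpha> i m =
    (\<Sum>\<delta> | \<alpha> \<subseteq> \<delta>. (- 1) ^ card (\<delta> - \<alpha>) *\<^sub>C kernel_unit p \<delta> i (\<lambda>n. if n \<in> \<alpha> then m n else i n))"

lemma mat_unit_cong:
  assumes "\<And>n. n \<in> \<alpha> \<Longrightarrow> m n = m' n" shows "mat_unit p \<alpha> i m = mat_unit p \<alpha> i m'"
proof -
  have "(\<lambda>n. if n \<in> \<alpha> then m n else i n) = (\<lambda>n. if n \<in> \<alpha> then m' n else i n)"
    using assms by auto
  thus ?thesis by (simp add: mat_unit_def)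
qed

text \<open>The terms cancel in pairs under adding \<open>n\<^sub>0\<close> to \<open>\<delta>\<close> or removing it.\<close>

lemma sum_alternating_zero:
  fixes h :: "'n::finite set \<Rightarrow> 'a::complex_normed_vector"
  assumes "n\<^sub>0 \<notin> \<alpha>" and "\<And>\<delta>. h (insert n\<^sub>0 \<delta>) = h (\<delta> - {n\<^sub>0})"
  shows "(\<Sum>\<delta> | \<alpha> \<subseteq> \<delta>. (- 1) ^ card (\<delta> - \<alpha>) *\<^sub>C h \<delta>) = 0"
proof -
  define t where "t \<delta> = (if n\<^sub>0 \<in> \<delta> then \<delta> - {n\<^sub>0} else insert n\<^sub>0 \<delta>)" for \<delta>
  define S where "S = (\<Sum>\<delta> | \<alpha> \<subseteq> \<delta>. (- 1) ^ card (\<delta> - \<alpha>) *\<^sub>C h \<delta>)"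
  have ins: "card (insert n\<^sub>0 \<delta> - \<alpha>) = Suc (card (\<delta> - \<alpha>))" if "n\<^sub>0 \<notin> \<delta>" for \<delta>
    using assms(1) that by (simp add: insert_Diff_if)
  have sgn: "(- 1 :: complex) ^ card (t \<delta> - \<alpha>) = - ((- 1) ^ card (\<delta> - \<alpha>))" for \<delta>
  proof (cases "n\<^sub>0 \<in> \<delta>")
    case True
    then obtain \<delta>' where "\<delta> = insert n\<^sub>0 \<delta>'" "n\<^sub>0 \<notin> \<delta>'" by (meson Set.set_insert)
    thus ?thesis using ins[of \<delta>'] by (simp add: t_def)
  next
    case False
    thus ?thesis using ins[of \<delta>] by (simp add: t_def)
  qed
  have ht: "h (t \<delta>) = h \<delta>" for \<delta>
    using assms(2)[of \<delta>] by (auto simp: t_def insert_absorb)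
  have "S = (\<Sum>\<delta> | \<alpha> \<subseteq> \<delta>. (- 1) ^ card (t \<delta> - \<alpha>) *\<^sub>C h (t \<delta>))"
    unfolding S_def
    by (rule sum.reindex_bij_witness[where i = t and j = t]) (use assms(1) in \<open>auto simp: t_def insert_absorb\<close>)
  also have "\<dots> = (- 1) *\<^sub>C S"
    unfolding S_def scaleC_sum_right by (simp only: sgn ht scaleC_scaleC mult_minus1)
  finally have "2 *\<^sub>C S = 0"
    using scaleC_add_left[of 1 1 S] scaleC_add_left[of 1 "-1" S] by simp
  thus ?thesis by (simp add: S_def scaleC_eq_0_iff)
qed

text \<open>A coordinate of \<gamma> outside \<beta> gives zero, since there \<open>Y\<close> meets
  \<open>X - Y\<close>. In the expanded form this is a cancellation: for such
  \<open>n\<^sub>0\<close> the set \<gamma> \<union> \<delta> is the same whether or not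
  \<open>n\<^sub>0\<close> lies in \<delta>. If \<gamma> \<subseteq> \<beta>, then \<gamma> \<union>
  \<delta> = \<delta>, and the terms are those of a unit again.\<close>

lemma kernel_unit_mult_mat_unit:
  assumes p: "p \<ge> 1" and m: "\<And>n. n \<in> \<gamma> \<Longrightarrow> m n \<in> {1..p}"
  shows "kernel_unit p \<gamma> i m * mat_unit p \<beta> j l =
    (if \<gamma> \<subseteq> \<beta> \<and> (\<forall>n\<in>- \<gamma>. i n = j n) \<and> (\<forall>n\<in>\<gamma>. m n = j n)
     then mat_unit p \<beta> i l else (0 :: 'n::finite L2 clinop))"
proof -
  have km: "kernel_unit p \<gamma> i m * kernel_unit p \<delta> j l' =
    (if (\<forall>n\<in>- \<gamma>. i n = j n) \<and> (\<forall>n\<in>\<gamma>. m n = j n)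
     then kernel_unit p (\<gamma> \<union> \<delta>) i (\<lambda>n. if n \<in> \<delta> then l' n else m n) else 0)" for \<delta> l'
    using p m by (rule kernel_unit_mult)
  show ?thesis
  proof (cases "(\<forall>n\<in>- \<gamma>. i n = j n) \<and> (\<forall>n\<in>\<gamma>. m n = j n)")
  case False
  have "kernel_unit p \<gamma> i m * mat_unit p \<beta> j l = 0"
    unfolding mat_unit_def sum_distrib_left mult_scaleC_right km if_not_P[OF False] by simp
  thus ?thesis using False by auto
next
  case True
  let ?l = "\<lambda>n. if n \<in> \<beta> then l n else j n"
  have *: "kernel_unit p \<gamma> i m * mat_unit p \<beta> j l =
      (\<Sum>\<delta> | \<beta> \<subseteq> \<delta>. (- 1) ^ card (\<delta> - \<beta>) *\<^sub>C kernel_unit p (\<gamma> \<union> \<delta>) i ?l)"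
    unfolding mat_unit_def sum_distrib_left mult_scaleC_right km if_P[OF True]
    by (intro sum.cong refl arg_cong[where f = "scaleC _"] kernel_unit_cong) (use True in auto)
  show ?thesis
  proof (cases "\<gamma> \<subseteq> \<beta>")
    case sub: True
    have "kernel_unit p (\<gamma> \<union> \<delta>) i ?l = kernel_unit p \<delta> i (\<lambda>n. if n \<in> \<beta> then l n else i n)" if "\<beta> \<subseteq> \<delta>" for \<delta>
    proof -
      have "\<gamma> \<union> \<delta> = \<delta>" using sub that by auto
      moreover have "j n = i n" if "n \<notin> \<beta>" for n using True sub that by (metis ComplI subsetD)
      ultimately show ?thesis by (auto intro!: kernel_unit_cong)
    qed
    thus ?thesis
      using True sub unfolding * by (simp add: mat_unit_def)
  next
    case False
    then obtain n\<^sub>0 where n0: "n\<^sub>0 \<in> \<gamma>" "n\<^sub>0 \<notin> \<beta>" by auto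
    have "\<gamma> \<union> insert n\<^sub>0 \<delta> = \<gamma> \<union> (\<delta> - {n\<^sub>0})" for \<delta> using n0 by auto
    hence "kernel_unit p (\<gamma> \<union> insert n\<^sub>0 \<delta>) i ?l = kernel_unit p (\<gamma> \<union> (\<delta> - {n\<^sub>0})) i ?l" for \<delta>
      by simp
    from sum_alternating_zero[of n\<^sub>0 \<beta> "\<lambda>\<delta>. kernel_unit p (\<gamma> \<union> \<delta>) i ?l", OF n0(2) this]
    show ?thesis unfolding * using False by simp
  qed
qed
qed

text \<open>Summed over \<alpha>, the factors \<open>Y\<close> and \<open>X - Y\<close> add up to
  \<open>X\<close> in every coordinate, which leaves the multiplication by a cell. Expanded, the
  coefficient of the term \<delta> is (1 - 1)^|\<delta>|.\<close>

lemma sum_mat_unit_diagonal: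
  assumes "p \<ge> 1"
  shows "(\<Sum>\<alpha>\<in>UNIV. \<Sum>i\<in>multi_idx p UNIV. mat_unit p \<alpha> i i) = (1 :: 'n::finite L2 clinop)"
proof -
  have "(\<Sum>\<alpha>\<in>UNIV. mat_unit p \<alpha> i i) = Cell p UNIV i" for i :: "'n \<Rightarrow> nat"
  proof -
    have "(\<Sum>\<alpha>\<in>UNIV. mat_unit p \<alpha> i i) =
        (\<Sum>\<alpha>\<in>UNIV. \<Sum>\<delta> | \<alpha> \<subseteq> \<delta>. (- 1) ^ card (\<delta> - \<alpha>) *\<^sub>C kernel_unit p \<delta> i i)"
      by (simp add: mat_unit_def)
    also have "\<dots> = (\<Sum>\<delta>\<in>UNIV. \<Sum>\<alpha> | \<alpha> \<subseteq> \<delta>. (- 1) ^ card (\<delta> - \<alpha>) *\<^sub>C kernel_unit p \<delta> i i)"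
      using sum.swap_restrict[of UNIV UNIV "\<lambda>\<alpha> \<delta>. (- 1) ^ card (\<delta> - \<alpha>) *\<^sub>C kernel_unit p \<delta> i i" "(\<subseteq>)"] by simp
    also have "\<dots> = (\<Sum>\<delta>\<in>(UNIV :: 'n set set). if \<delta> = {} then kernel_unit p {} i i else 0)"
    proof (rule sum.cong[OF refl])
      fix \<delta> :: "'n set"
      have "(\<Sum>\<alpha> | \<alpha> \<subseteq> \<delta>. (- 1) ^ card (\<delta> - \<alpha>)) = (if \<delta> = {} then 1 else (0 :: complex))"
        using prod_add[of \<delta> "\<lambda>_. 1 :: complex" "\<lambda>_. - 1", symmetric]
        by (cases "\<delta> = {}") (simp_all add: Pow_def power_0_left)
      thus "(\<Sum>\<alpha> | \<alpha> \<subseteq> \<delta>. (- 1) ^ card (\<delta> - \<alpha>) *\<^sub>C kernel_unit p \<delta> i i) = (if \<delta> = {} then kernel_unit p {} i i else 0)"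
        unfolding scaleC_sum_left[symmetric] by simp
    qed
    also have "\<dots> = Cell p UNIV i"
      by (simp add: kernel_unit_def)
    finally show ?thesis .
  qed
  thus ?thesis
    by (subst sum.swap) (simp add: sum_Cell[OF assms])
qed

section \<open>Coefficients\<close>

definition combine :: "nat \<Rightarrow> 'n::finite coeffs \<Rightarrow> 'n L2 clinop"
  where "combine p a = (\<Sum>\<alpha>\<in>UNIV. \<Sum>(i, m)\<in>multi_idx p UNIV \<times> multi_idx p \<alpha>. a \<alpha> i m *\<^sub>C kernel_unit p \<alpha> i m)"

lemma implements_kernel_unit:
  "implements (kernel_unit p \<alpha> i m) (\<lambda>f k. of_nat (p ^ card \<alpha>) *
     (cell p UNIV i k * average \<alpha> (\<lambda>k. cell p \<alpha> m k * f k) (k :: 'n::finite \<Rightarrow> real)))"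
  unfolding kernel_unit_def
  using implements_scaleC[OF implements_mult[OF implements_mult[OF implements_Cell implements_Avg] implements_Cell]] .

text \<open>Taking the finite sum out of the integral requires every slice to be integrable; there
  are finitely many pairs of \<alpha> and \<open>m\<close>, so one null set serves for all of
  them.\<close>

lemma mixed_integral_eq_sum:
  assumes "sq_integrable f"
  shows "AE k in cube UNIV. mixed_integral p a f k = (\<Sum>\<alpha>\<in>UNIV. \<Sum>(i, m)\<in>multi_idx p UNIV \<times> multi_idx p \<alpha>.
    a \<alpha> i m * (of_nat (p ^ card \<alpha>) * (cell p UNIV i k * average \<alpha> (\<lambda>k. cell p \<alpha> m k * f k) (k :: 'n::finite \<Rightarrow> real))))"
proof -
  have c: "cell p \<alpha> m (merge (- \<alpha>) \<alpha> (k, x)) = cell p \<alpha> m x" for \<alpha> m and k x :: "'n \<Rightarrow> real"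
    unfolding cell_def by (rule prod.cong) (auto simp: merge_def)
  have "AE k in cube UNIV. \<forall>\<alpha>. \<forall>m\<in>multi_idx p \<alpha>.
      integrable (cube \<alpha>) (\<lambda>x. cell p \<alpha> m x * f (merge (- \<alpha>) \<alpha> (k, x)))"
  proof (rule AE_all_countable[THEN iffD2, rule_format], rule AE_ball_countable[THEN iffD2, rule_format])
    fix \<alpha> :: "'n set" and m
    have "sq_integrable (\<lambda>k. cell p \<alpha> m k * f k)"
      using implementsD(1)[OF implements_Cell assms] .
    from AE_integrable_merge_cube[OF sq_integrable_imp_integrable[OF this], of \<alpha>]
    show "AE k in cube UNIV. integrable (cube \<alpha>) (\<lambda>x. cell p \<alpha> m x * f (merge (- \<alpha>) \<alpha> (k, x)))"
      by (simp add: c)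
  qed (auto intro: countable_finite)
  thus ?thesis
  proof eventually_elim
    case (elim k)
    show ?case unfolding mixed_integral_def
    proof (rule sum.cong[OF refl])
      fix \<alpha> :: "'n set"
      have "(LINT x|cube \<alpha>. Defs.kernel p a \<alpha> k x * f (merge (- \<alpha>) \<alpha> (k, x))) =
          (LINT x|cube \<alpha>. (\<Sum>(i, m)\<in>multi_idx p UNIV \<times> multi_idx p \<alpha>.
            a \<alpha> i m * of_nat (p ^ card \<alpha>) * cell p UNIV i k * (cell p \<alpha> m x * f (merge (- \<alpha>) \<alpha> (k, x)))))"
        by (intro Bochner_Integration.integral_cong refl)
           (auto simp: Defs.kernel_def cell_def sum_distrib_left sum_distrib_right split_def mult_ac intro!: sum.cong)
      also have "\<dots> = (\<Sum>(i, m)\<in>multi_idx p UNIV \<times> multi_idx p \<alpha>.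
            a \<alpha> i m * of_nat (p ^ card \<alpha>) * cell p UNIV i k * (LINT x|cube \<alpha>. cell p \<alpha> m x * f (merge (- \<alpha>) \<alpha> (k, x))))"
        unfolding split_def using elim
        by (subst Bochner_Integration.integral_sum) auto
      finally show "(LINT x|cube \<alpha>. Defs.kernel p a \<alpha> k x * f (merge (- \<alpha>) \<alpha> (k, x))) =
         (\<Sum>(i, m)\<in>multi_idx p UNIV \<times> multi_idx p \<alpha>. a \<alpha> i m *
            (of_nat (p ^ card \<alpha>) * (cell p UNIV i k * average \<alpha> (\<lambda>k. cell p \<alpha> m k * f k) k)))"
        by (simp add: average_def c mult.assoc)
    qed
  qed
qed

text \<open>The defining condition, quantified over functions and almost all points, becomes one
  equation between operators. From here on the coefficients are treated algebraically.\<close>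

lemma has_coeffs_iff:
  fixes T :: "'n::finite L2 clinop"
  shows "has_coeffs p T a \<longleftrightarrow>
    (\<forall>\<alpha> i m. (i, m) \<notin> multi_idx p UNIV \<times> multi_idx p \<alpha> \<longrightarrow> a \<alpha> i m = 0) \<and> T = combine p a"
proof -
  define \<Phi> where "\<Phi> f k = (\<Sum>\<alpha>\<in>UNIV. \<Sum>z\<in>multi_idx p UNIV \<times> multi_idx p \<alpha>.
    a \<alpha> (fst z) (snd z) * (of_nat (p ^ card \<alpha>) * (cell p UNIV (fst z) k * average \<alpha> (\<lambda>k. cell p \<alpha> (snd z) k * f k) k)))"
    for f and k :: "'n \<Rightarrow> real"
  have impl: "implements (combine p a) \<Phi>"
    unfolding combine_def \<Phi>_def[abs_def] split_def
    by (intro implements_sum implements_scaleC implements_kernel_unit)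
  have AE: "AE k in cube UNIV. mixed_integral p a f k = \<Phi> f k" if "sq_integrable f" for f
    using mixed_integral_eq_sum[OF that, of p a] by (simp add: \<Phi>_def split_def)
  have "(\<forall>f. sq_integrable f \<longrightarrow> (AE k in cube UNIV. rep_L2 (clinop_apply T (abs_L2 f)) k = mixed_integral p a f k))
      \<longleftrightarrow> T = combine p a"
  proof
    assume T: "\<forall>f. sq_integrable f \<longrightarrow> (AE k in cube UNIV. rep_L2 (clinop_apply T (abs_L2 f)) k = mixed_integral p a f k)"
    show "T = combine p a"
    proof (rule implements_eqI[OF _ impl])
      show "implements T (\<lambda>f. rep_L2 (clinop_apply T (abs_L2 f)))"
        by (simp add: implements_def sq_integrable_rep_L2 abs_rep_L2)
      fix f :: "('n \<Rightarrow> real) \<Rightarrow> complex" assume f: "sq_integrable f"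
      show "AE k in cube UNIV. rep_L2 (clinop_apply T (abs_L2 f)) k = \<Phi> f k"
        using T[rule_format, OF f] AE[OF f] by eventually_elim simp
    qed
  next
    assume T: "T = combine p a"
    show "\<forall>f. sq_integrable f \<longrightarrow> (AE k in cube UNIV. rep_L2 (clinop_apply T (abs_L2 f)) k = mixed_integral p a f k)"
    proof (intro allI impI)
      fix f :: "('n \<Rightarrow> real) \<Rightarrow> complex" assume f: "sq_integrable f"
      show "AE k in cube UNIV. rep_L2 (clinop_apply T (abs_L2 f)) k = mixed_integral p a f k"
        using rep_abs_L2[OF implementsD(1)[OF impl f]] AE[OF f]
        by eventually_elim (simp add: T implementsD(2)[OF impl f])
    qed
  qed
  thus ?thesis by (simp add: has_coeffs_def)
qed

lemma combine_in_mixed_algebra: "combine p a \<in> mixed_algebra p"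
proof -
  \<comment> \<open>\<open>combine\<close> reads only valid indices, whereas
    \<open>has_coeffs\<close> demands zeros at the others.\<close>
  define a' where "a' \<alpha> i m = (if (i, m) \<in> multi_idx p UNIV \<times> multi_idx p \<alpha> then a \<alpha> i m else 0)" for \<alpha> i m
  have "combine p a = combine p a'"
    unfolding combine_def by (intro sum.cong refl) (auto simp: a'_def)
  hence "has_coeffs p (combine p a) a'"
    by (simp add: has_coeffs_iff a'_def)
  thus ?thesis by (auto simp: mixed_algebra_def)
qed

lemma mixed_algebra_eq_range: "mixed_algebra p = range (combine p)"
  using combine_in_mixed_algebra by (auto simp: mixed_algebra_def has_coeffs_iff)

lemma mixed_algebra_add:
  assumes "S \<in> mixed_algebra p" "T \<in> mixed_algebra p" shows "S + T \<in> mixed_algebra p"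
proof -
  obtain a b where "S = combine p a" "T = combine p b"
    using assms by (auto simp: mixed_algebra_eq_range)
  hence "S + T = combine p (\<lambda>\<alpha> i m. a \<alpha> i m + b \<alpha> i m)"
    by (simp add: combine_def split_def scaleC_add_left sum.distrib)
  thus ?thesis by (simp add: mixed_algebra_eq_range)
qed

lemma mixed_algebra_scaleC:
  assumes "T \<in> mixed_algebra p" shows "c *\<^sub>C T \<in> mixed_algebra p"
proof -
  obtain a where "T = combine p a"
    using assms by (auto simp: mixed_algebra_eq_range)
  hence "c *\<^sub>C T = combine p (\<lambda>\<alpha> i m. c * a \<alpha> i m)"
    by (simp add: combine_def split_def scaleC_sum_right scaleC_scaleC)
  thus ?thesis by (simp add: mixed_algebra_eq_range)
qed

lemma mixed_algebra_sum: "(\<And>x. x \<in> I \<Longrightarrow> T x \<in> mixed_algebra p) \<Longrightarrow> (\<Sum>x\<in>I. T x) \<in> mixed_algebra p"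
proof (induction I rule: infinite_finite_induct)
  case (insert x I)
  thus ?case by (simp add: mixed_algebra_add)
qed (use mixed_algebra_scaleC[OF combine_in_mixed_algebra, of 0] in simp_all)

lemma kernel_unit_in_mixed_algebra:
  assumes "i \<in> multi_idx p UNIV" "\<And>n. n \<in> \<alpha> \<Longrightarrow> m n \<in> {1..p}"
  shows "kernel_unit p \<alpha> i m \<in> mixed_algebra p"
proof -
  \<comment> \<open>The index \<open>m\<close> is arbitrary off \<alpha>, but coefficients are
    indexed by functions that are \<open>undefined\<close> there.\<close>
  let ?m = "restrict m \<alpha>"
  have m: "?m \<in> multi_idx p \<alpha>" using assms(2) by (auto simp: multi_idx_def)
  have "combine p (\<lambda>\<alpha>' i' m'. if \<alpha>' = \<alpha> \<and> (i', m') = (i, ?m) then 1 else 0) =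
      (\<Sum>\<alpha>'\<in>UNIV. if \<alpha>' = \<alpha> then kernel_unit p \<alpha> i ?m else 0)"
    unfolding combine_def
  proof (rule sum.cong[OF refl])
    fix \<alpha>' :: "'a set"
    show "(\<Sum>(i', m')\<in>multi_idx p UNIV \<times> multi_idx p \<alpha>'.
        (if \<alpha>' = \<alpha> \<and> (i', m') = (i, ?m) then 1 else 0) *\<^sub>C kernel_unit p \<alpha>' i' m') =
        (if \<alpha>' = \<alpha> then kernel_unit p \<alpha> i ?m else 0)"
    proof (cases "\<alpha>' = \<alpha>")
      case True
      have "(\<Sum>(i', m')\<in>multi_idx p UNIV \<times> multi_idx p \<alpha>'.
          (if \<alpha>' = \<alpha> \<and> (i', m') = (i, ?m) then 1 else 0) *\<^sub>C kernel_unit p \<alpha>' i' m') =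
        (\<Sum>z\<in>multi_idx p UNIV \<times> multi_idx p \<alpha>. if z = (i, ?m) then kernel_unit p \<alpha> i ?m else 0)"
        by (rule sum.cong) (auto simp: True split: if_splits)
      thus ?thesis using True assms(1) m by simp
    qed auto
  qed
  also have "\<dots> = kernel_unit p \<alpha> i ?m" by simp
  also have "\<dots> = kernel_unit p \<alpha> i m" by (rule kernel_unit_cong) auto
  finally show ?thesis using combine_in_mixed_algebra[of p] by metis
qed

lemma mat_unit_in_mixed_algebra:
  assumes "i \<in> multi_idx p UNIV" "\<And>n. n \<in> \<alpha> \<Longrightarrow> m n \<in> {1..p}"
  shows "mat_unit p \<alpha> i m \<in> mixed_algebra p"
  unfolding mat_unit_def
  by (intro mixed_algebra_sum mixed_algebra_scaleC kernel_unit_in_mixed_algebra assms(1))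
     (use assms in \<open>auto simp: multi_idx_def PiE_iff\<close>)

section \<open>Ranks of the matrix units\<close>

text \<open>The functions \<open>wave p r N\<close>, \<open>N = 0, 1, \<dots>\<close>, live on disjoint subintervals of the \<open>r\<close>-th cell and
  have mean zero there, so that averaging kills them.\<close>

definition wave :: "nat \<Rightarrow> nat \<Rightarrow> nat \<Rightarrow> real \<Rightarrow> complex"
  where "wave p r N y =
    (let a = (real r - 1) / p + 1 / (p * (real N + 2)); b = (real r - 1) / p + 1 / (p * (real N + 1))
     in indicator {a..<(a + b) / 2} y - indicator {(a + b) / 2..<b} y)"

lemma measurable_wave [measurable]: "wave p r N \<in> borel_measurable (restrict_space lborel {0..<1})"
  unfolding wave_def Let_def by (rule measurable_restrict_space1) measurable

text \<open>Measured from the left end of the cell, the interval number \<open>N\<close> is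
  [1/(p(N+2)), 1/(p(N+1))): consecutive intervals touch, and they shrink towards that end.\<close>

lemma wave_endpoints:
  fixes p :: nat
  assumes "p \<ge> 1"
  shows "(real r - 1) / p \<le> (real r - 1) / p + 1 / (p * (real N + 2))"
    "(real r - 1) / p + 1 / (p * (real N + 2)) < (real r - 1) / p + 1 / (p * (real N + 1))"
    "(real r - 1) / p + 1 / (p * (real N + 1)) \<le> real r / p"
proof -
  have "1 / (p * (real N + 2)) < 1 / (p * (real N + 1))"
    by (rule divide_strict_left_mono) (use assms in auto)
  thus "(real r - 1) / p + 1 / (p * (real N + 2)) < (real r - 1) / p + 1 / (p * (real N + 1))" by simp
  have "1 / (p * (real N + 1)) \<le> 1 / (p * 1)"
    by (rule divide_left_mono) (use assms in auto)
  thus "(real r - 1) / p + 1 / (p * (real N + 1)) \<le> real r / p"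
    by (simp add: diff_divide_distrib)
qed auto

lemma wave_cases: "wave p r N y = 0 \<or> wave p r N y = 1 \<or> wave p r N y = - 1"
  by (auto simp: wave_def Let_def indicator_def)

lemma wave_support:
  assumes "p \<ge> 1" "wave p r N y \<noteq> 0"
  shows "(real r - 1) / p + 1 / (p * (real N + 2)) \<le> y" "y < (real r - 1) / p + 1 / (p * (real N + 1))"
proof -
  define a where "a = (real r - 1) / p + 1 / (p * (real N + 2))"
  define b where "b = (real r - 1) / p + 1 / (p * (real N + 1))"
  have "a < b" unfolding a_def b_def by (rule wave_endpoints(2)[OF assms(1)])
  moreover have "wave p r N y = indicator {a..<(a + b) / 2} y - indicator {(a + b) / 2..<b} y"
    by (simp only: wave_def Let_def a_def b_def)
  ultimately have "a \<le> y \<and> y < b"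
    using assms(2) by (cases "a \<le> y"; cases "y < b") (auto simp: indicator_def)
  thus "(real r - 1) / p + 1 / (p * (real N + 2)) \<le> y" "y < (real r - 1) / p + 1 / (p * (real N + 1))"
    by (simp_all only: a_def b_def)
qed

lemma chi_wave:
  assumes "p \<ge> 1" shows "chi p r y * wave p r N y = wave p r N y"
proof (cases "wave p r N y = 0")
  case False
  note wave_support[OF assms False]
  hence "(real r - 1) / p \<le> y" "y < real r / p"
    using wave_endpoints(1,3)[OF assms, of r N] by linarith+
  hence "chi p r y = 1" by (simp add: chi_def)
  thus ?thesis by simp
qed auto

lemma wave_disjoint:
  assumes "p \<ge> 1" "N \<noteq> M" shows "wave p r N y * wave p r M y = 0"
proof -
  have *: "wave p r N y * wave p r M y = 0" if "N < M" for N M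
  proof (rule ccontr)
    assume "wave p r N y * wave p r M y \<noteq> 0"
    hence 1: "(real r - 1) / p + 1 / (p * (real N + 2)) \<le> y" and 2: "y < (real r - 1) / p + 1 / (p * (real M + 1))"
      using wave_support[OF assms(1)] by auto
    have "1 / (p * (real M + 1)) \<le> 1 / (p * (real N + 2))"
      by (rule divide_left_mono) (use assms(1) that in auto)
    thus False using 1 2 by linarith
  qed
  show ?thesis using *[of N M] *[of M N] assms(2) by (cases "N < M") (auto simp: mult.commute)
qed

lemma unit_integral_indicator:
  assumes "0 \<le> a" "a \<le> b" "b \<le> 1"
  shows "integrable (restrict_space lborel {0..<1}) (\<lambda>y. complex_of_real (indicator {a..<b} y))"
    "(LINT y|restrict_space lborel {0..<1}. complex_of_real (indicator {a..<b} y)) = of_real (b - a)"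
proof -
  interpret prob_space "restrict_space lborel {0..<1::real}" by (rule prob_space_unit)
  have m: "(\<lambda>y. complex_of_real (indicator {a..<b} y)) \<in> borel_measurable (restrict_space lborel {0..<1})"
    by (rule measurable_restrict_space1) measurable
  show "integrable (restrict_space lborel {0..<1}) (\<lambda>y. complex_of_real (indicator {a..<b} y))"
    by (rule integrable_const_bound[where B = 1, OF _ m]) (auto simp: indicator_def)
  have "(LINT y|restrict_space lborel {0..<1}. complex_of_real (indicator {a..<b} y))
      = (LINT y|lborel. indicator {0..<1} y *\<^sub>R complex_of_real (indicator {a..<b} y))"
    by (rule integral_restrict_space) simp
  also have "\<dots> = (LINT y|lborel. complex_of_real (indicator {a..<b} y))"
    by (rule Bochner_Integration.integral_cong) (use assms in \<open>auto simp: indicator_def\<close>)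
  also have "\<dots> = of_real (b - a)"
    using assms by simp
  finally show "(LINT y|restrict_space lborel {0..<1}. complex_of_real (indicator {a..<b} y)) = of_real (b - a)" .
qed

text \<open>The two halves have the same length and opposite signs, while the square is the
  indicator of the whole interval, which has positive length.\<close>

lemma integral_wave:
  assumes p: "p \<ge> 1" and r: "r \<in> {1..p}"
  shows "integrable (restrict_space lborel {0..<1}) (wave p r N)"
    "(LINT y|restrict_space lborel {0..<1}. wave p r N y) = 0"
    "integrable (restrict_space lborel {0..<1}) (\<lambda>y. (wave p r N y)\<^sup>2)"
    "(LINT y|restrict_space lborel {0..<1}. (wave p r N y)\<^sup>2) \<noteq> 0"
proof -
  define a where "a = (real r - 1) / p + 1 / (p * (real N + 2))"
  define b where "b = (real r - 1) / p + 1 / (p * (real N + 1))"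
  have "0 \<le> (real r - 1) / p" "real r / p \<le> 1" using p r by auto
  hence ab: "0 \<le> a" "a < b" "b \<le> 1"
    using wave_endpoints[OF p, of r N] unfolding a_def b_def by linarith+
  have w: "wave p r N = (\<lambda>y. complex_of_real (indicator {a..<(a + b) / 2} y) - complex_of_real (indicator {(a + b) / 2..<b} y))"
    by (auto simp: wave_def Let_def a_def b_def fun_eq_iff indicator_def)
  have w2: "(\<lambda>y. (wave p r N y)\<^sup>2) = (\<lambda>y. complex_of_real (indicator {a..<b} y))"
    using ab by (auto simp: w fun_eq_iff indicator_def)
  note I1 = unit_integral_indicator[of a "(a + b) / 2"] and I2 = unit_integral_indicator[of "(a + b) / 2" b]
    and I3 = unit_integral_indicator[of a b]
  show "integrable (restrict_space lborel {0..<1}) (wave p r N)"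
    using I1 I2 ab unfolding w by auto
  show "(LINT y|restrict_space lborel {0..<1}. wave p r N y) = 0"
  proof -
    have "(LINT y|restrict_space lborel {0..<1}. wave p r N y) =
        complex_of_real ((a + b) / 2 - a) - complex_of_real (b - (a + b) / 2)"
      using I1 I2 ab unfolding w by (subst Bochner_Integration.integral_diff) auto
    also have "(a + b) / 2 - a = b - (a + b) / 2" by (simp add: field_simps)
    finally show ?thesis by simp
  qed
  show "integrable (restrict_space lborel {0..<1}) (\<lambda>y. (wave p r N y)\<^sup>2)"
    "(LINT y|restrict_space lborel {0..<1}. (wave p r N y)\<^sup>2) \<noteq> 0"
    using I3 ab unfolding w2 by auto
qed

section \<open>Test vectors fixed by the diagonal units\<close>

lemma multi_idx_UNIV: "i \<in> multi_idx p UNIV \<longleftrightarrow> (\<forall>n. i n \<in> {1..p})"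
  by (auto simp: multi_idx_def PiE_iff)

lemma average_prod:
  fixes \<phi> :: "'n::finite \<Rightarrow> real \<Rightarrow> complex"
  assumes "\<And>n. integrable (restrict_space lborel {0..<1}) (\<phi> n)"
  shows "average \<alpha> (\<lambda>k. \<Prod>n\<in>UNIV. \<phi> n (k n)) k =
    (\<Prod>n\<in>\<alpha>. LINT y|restrict_space lborel {0..<1}. \<phi> n y) * (\<Prod>n\<in>- \<alpha>. \<phi> n (k n))"
proof -
  have "(\<Prod>n\<in>UNIV. \<phi> n (merge (- \<alpha>) \<alpha> (k, x) n)) = (\<Prod>n\<in>\<alpha>. \<phi> n (x n)) * (\<Prod>n\<in>- \<alpha>. \<phi> n (k n))" for x
  proof -
    have "(\<Prod>n\<in>UNIV. \<phi> n (merge (- \<alpha>) \<alpha> (k, x) n)) =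
        (\<Prod>n\<in>\<alpha>. \<phi> n (merge (- \<alpha>) \<alpha> (k, x) n)) * (\<Prod>n\<in>- \<alpha>. \<phi> n (merge (- \<alpha>) \<alpha> (k, x) n))"
      by (subst prod.union_disjoint[symmetric]) (auto intro: prod.cong)
    thus ?thesis by (simp add: merge_def)
  qed
  thus ?thesis
    using unit_prod.product_integral_prod[of \<alpha> \<phi>] assms by (simp add: average_def cube_def)
qed

text \<open>Coordinatewise model of a vector in the range of the diagonal unit for \<alpha> and
  \<open>i\<close>: in \<alpha> the indicator of the cell, which \<open>Y\<close> fixes, elsewhere a
  wave, which \<open>X\<close> fixes and \<open>Y\<close> kills. The number \<open>N\<close>
  supplies infinitely many such vectors when \<alpha> is not the full set.\<close>

definition test_factor :: "nat \<Rightarrow> 'n set \<Rightarrow> ('n \<Rightarrow> nat) \<Rightarrow> nat \<Rightarrow> 'n \<Rightarrow> real \<Rightarrow> complex"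
  where "test_factor p \<alpha> i N n = (if n \<in> \<alpha> then chi p (i n) else wave p (i n) N)"

definition test_fun :: "nat \<Rightarrow> 'n::finite set \<Rightarrow> ('n \<Rightarrow> nat) \<Rightarrow> nat \<Rightarrow> ('n \<Rightarrow> real) \<Rightarrow> complex"
  where "test_fun p \<alpha> i N k = (\<Prod>n\<in>UNIV. test_factor p \<alpha> i N n (k n))"

lemma integrable_chi: "integrable (restrict_space lborel {0..<1}) (chi p r)"
  by (rule finite_measure.integrable_const_bound[where B = 1])
     (use prob_space_unit in \<open>auto simp: prob_space_def chi_def indicator_def\<close>)

lemma test_factor_cases:
  "test_factor p \<alpha> i N n y = 0 \<or> test_factor p \<alpha> i N n y = 1 \<or> test_factor p \<alpha> i N n y = - 1"
  using wave_cases[of p "i n" N y] by (auto simp: test_factor_def chi_def indicator_def)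

lemma cell_test_fun:
  assumes "p \<ge> 1"
  shows "cell p \<beta> i k * test_fun p \<alpha> i N k = test_fun p \<alpha> i N k"
proof -
  have "cell p \<beta> i k * test_fun p \<alpha> i N k =
      (\<Prod>n\<in>UNIV. (if n \<in> \<beta> then chi p (i n) (k n) else 1) * test_factor p \<alpha> i N n (k n))"
    by (simp add: cell_def test_fun_def prod.distrib prod.If_cases)
  also have "\<dots> = test_fun p \<alpha> i N k"
    unfolding test_fun_def
  proof (rule prod.cong[OF refl])
    fix n :: 'a
    have "chi p (i n) (k n) * test_factor p \<alpha> i N n (k n) = test_factor p \<alpha> i N n (k n)"
      using chi_wave[OF assms, of "i n" "k n" N] chi_mult[OF assms, of "i n" "k n" "i n"]
      by (simp add: test_factor_def)
    thus "(if n \<in> \<beta> then chi p (i n) (k n) else 1) * test_factor p \<alpha> i N n (k n) = test_factor p \<alpha> i N n (k n)"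
      by simp
  qed
  finally show ?thesis .
qed

lemma measurable_test_factor [measurable]:
  "test_factor p \<alpha> i N n \<in> borel_measurable (restrict_space lborel {0..<1})"
  by (simp add: test_factor_def)

lemma measurable_test_fun [measurable]: "test_fun p \<alpha> i N \<in> borel_measurable (cube UNIV)"
  unfolding test_fun_def[abs_def] cube_def
proof (intro borel_measurable_prod)
  fix n :: 'a
  have "(\<lambda>k. k n) \<in> measurable (Pi\<^sub>M UNIV (\<lambda>_. restrict_space lborel {0..<1})) (restrict_space lborel {0..<1::real})"
    by (intro measurable_component_singleton) auto
  from measurable_compose[OF this measurable_test_factor]
  show "(\<lambda>k. test_factor p \<alpha> i N n (k n)) \<in> borel_measurable (Pi\<^sub>M UNIV (\<lambda>_. restrict_space lborel {0..<1}))" .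
qed

lemma sq_integrable_test_fun: "sq_integrable (test_fun p \<alpha> i N)"
proof -
  have "cmod (test_fun p \<alpha> i N k) \<le> 1" for k
  proof -
    have "cmod (test_factor p \<alpha> i N n (k n)) \<le> 1" for n
      using test_factor_cases[of p \<alpha> i N n "k n"] by auto
    thus ?thesis unfolding test_fun_def prod_norm[symmetric] by (intro prod_le_1) auto
  qed
  hence "(cmod (test_fun p \<alpha> i N k))\<^sup>2 \<le> 1" for k
    by (simp add: power_le_one)
  hence "integrable (cube UNIV) (\<lambda>k. (cmod (test_fun p \<alpha> i N k))\<^sup>2)"
    by (intro finite_measure.integrable_const_bound[where B = 1]) (auto simp: cube.finite_measure_axioms)
  thus ?thesis by (simp add: sq_integrable_def)
qed

definition test_vec :: "nat \<Rightarrow> 'n::finite set \<Rightarrow> ('n \<Rightarrow> nat) \<Rightarrow> nat \<Rightarrow> 'n L2"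
  where "test_vec p \<alpha> i N = abs_L2 (test_fun p \<alpha> i N)"

text \<open>If \<delta> is strictly larger than \<alpha>, some wave is integrated, with result 0. If
  \<delta> = \<alpha>, only indicators are integrated; their means \<open>1 / p\<close> cancel the
  normalisation, and multiplication by the cell restores the indicators.\<close>

lemma kernel_unit_test_vec:
  assumes p: "p \<ge> 1" and i: "i \<in> multi_idx p UNIV" and \<alpha>: "\<alpha> \<subseteq> \<delta>"
  shows "clinop_apply (kernel_unit p \<delta> i i) (test_vec p \<alpha> i N) =
    (if \<delta> = \<alpha> then test_vec p \<alpha> i N else (0 :: 'n::finite L2))"
proof -
  have in_range: "i n \<in> {1..p}" for n using i by (simp add: multi_idx_UNIV)
  define \<Phi> where "\<Phi> k = of_nat (p ^ card \<delta>) * (cell p UNIV i k *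
      average \<delta> (\<lambda>k. cell p \<delta> i k * test_fun p \<alpha> i N k) k)" for k
  have app: "clinop_apply (kernel_unit p \<delta> i i) (test_vec p \<alpha> i N) = abs_L2 \<Phi>"
    unfolding test_vec_def \<Phi>_def[abs_def]
    by (rule implementsD(2)[OF implements_kernel_unit sq_integrable_test_fun])
  have int: "integrable (restrict_space lborel {0..<1}) (test_factor p \<alpha> i N n)" for n
    using integrable_chi integral_wave(1)[OF p in_range] by (simp add: test_factor_def)
  have av: "average \<delta> (\<lambda>k. cell p \<delta> i k * test_fun p \<alpha> i N k) k =
     (\<Prod>n\<in>\<delta>. LINT y|restrict_space lborel {0..<1}. test_factor p \<alpha> i N n y) *
     (\<Prod>n\<in>- \<delta>. test_factor p \<alpha> i N n (k n))" for k
    unfolding cell_test_fun[OF p] unfolding test_fun_def by (rule average_prod[OF int])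
  have "\<Phi> = (if \<delta> = \<alpha> then test_fun p \<alpha> i N else (\<lambda>k. 0))"
  proof (cases "\<delta> = \<alpha>")
    case True
    have "(\<Prod>n\<in>\<delta>. LINT y|restrict_space lborel {0..<1}. test_factor p \<alpha> i N n y) = (\<Prod>n\<in>\<delta>. 1 / of_nat p)"
      by (rule prod.cong) (use True integral_chi[OF p in_range] in \<open>auto simp: test_factor_def\<close>)
    hence 1: "of_nat (p ^ card \<delta>) * (\<Prod>n\<in>\<delta>. LINT y|restrict_space lborel {0..<1}. test_factor p \<alpha> i N n y) = 1"
      using p by (simp add: power_one_over)
    have "cell p UNIV i k * (\<Prod>n\<in>- \<delta>. test_factor p \<alpha> i N n (k n)) = test_fun p \<alpha> i N k" for k
    proof -
      have "cell p UNIV i k = cell p \<alpha> i k * cell p (- \<alpha>) i k"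
        by (subst cell_union[symmetric]) auto
      also have "cell p \<alpha> i k = (\<Prod>n\<in>\<alpha>. test_factor p \<alpha> i N n (k n))"
        unfolding cell_def by (rule prod.cong) (auto simp: test_factor_def)
      finally have "cell p UNIV i k * (\<Prod>n\<in>- \<delta>. test_factor p \<alpha> i N n (k n)) =
          cell p (- \<alpha>) i k * ((\<Prod>n\<in>\<alpha>. test_factor p \<alpha> i N n (k n)) * (\<Prod>n\<in>- \<alpha>. test_factor p \<alpha> i N n (k n)))"
        using True by simp
      also have "(\<Prod>n\<in>\<alpha>. test_factor p \<alpha> i N n (k n)) * (\<Prod>n\<in>- \<alpha>. test_factor p \<alpha> i N n (k n)) = test_fun p \<alpha> i N k"
        unfolding test_fun_def by (subst prod.union_disjoint[symmetric]) (auto intro: prod.cong)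
      finally show ?thesis by (simp add: cell_test_fun[OF p])
    qed
    moreover have "\<Phi> k = (of_nat (p ^ card \<delta>) * (\<Prod>n\<in>\<delta>. LINT y|restrict_space lborel {0..<1}. test_factor p \<alpha> i N n y)) *
       (cell p UNIV i k * (\<Prod>n\<in>- \<delta>. test_factor p \<alpha> i N n (k n)))" for k
      unfolding \<Phi>_def av by (simp only: mult_ac)
    ultimately show ?thesis using True 1 by (simp add: fun_eq_iff)
  next
    case False
    then obtain n\<^sub>0 where n0: "n\<^sub>0 \<in> \<delta>" "n\<^sub>0 \<notin> \<alpha>" using \<alpha> by auto
    hence "(LINT y|restrict_space lborel {0..<1}. test_factor p \<alpha> i N n\<^sub>0 y) = 0"
      using integral_wave(2)[OF p in_range] by (simp add: test_factor_def)
    hence "(\<Prod>n\<in>\<delta>. LINT y|restrict_space lborel {0..<1}. test_factor p \<alpha> i N n y) = 0"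
      using n0(1) by (intro prod_zero) auto
    thus ?thesis using False by (simp add: \<Phi>_def av fun_eq_iff)
  qed
  thus ?thesis unfolding app by (simp add: test_vec_def zero_L2_def)
qed

lemma mat_unit_test_vec:
  assumes "p \<ge> 1" "i \<in> multi_idx p UNIV"
  shows "clinop_apply (mat_unit p \<alpha> i i) (test_vec p \<alpha> i N) = test_vec p \<alpha> (i :: 'n::finite \<Rightarrow> nat) N"
proof -
  have "clinop_apply (mat_unit p \<alpha> i i) (test_vec p \<alpha> i N) =
     (\<Sum>\<delta> | \<alpha> \<subseteq> \<delta>. (- 1) ^ card (\<delta> - \<alpha>) *\<^sub>C clinop_apply (kernel_unit p \<delta> i i) (test_vec p \<alpha> i N))"
    by (simp add: mat_unit_def clinop_apply_sum clinop_apply_scaleC)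
  also have "\<dots> = (\<Sum>\<delta> | \<alpha> \<subseteq> \<delta>. if \<delta> = \<alpha> then test_vec p \<alpha> i N else 0)"
    by (rule sum.cong) (simp_all add: kernel_unit_test_vec[OF assms])
  also have "\<dots> = test_vec p \<alpha> i N" by simp
  finally show ?thesis .
qed

text \<open>The values are 0, 1 and -1, so the square of the function is its squared modulus, and
  its integral factors over the coordinates into nonzero integrals.\<close>

lemma test_vec_nonzero:
  assumes p: "p \<ge> 1" and i: "i \<in> multi_idx p UNIV"
  shows "test_vec p \<alpha> i N \<noteq> (0 :: 'n::finite L2)"
proof
  have in_range: "i n \<in> {1..p}" for n using i by (simp add: multi_idx_UNIV)
  assume "test_vec p \<alpha> i N = (0 :: 'n L2)"
  hence "AE k in cube UNIV. test_fun p \<alpha> i N k = 0"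
    by (simp add: test_vec_def zero_L2_def L2_abs_eq_iff sq_integrable_test_fun)
  hence "AE k in cube UNIV. (test_fun p \<alpha> i N k)\<^sup>2 = 0"
    by eventually_elim simp
  hence "(LINT k|cube UNIV. (test_fun p \<alpha> i N k)\<^sup>2) = 0"
    by (rule integral_eq_zero_AE)
  also have "(LINT k|cube UNIV. (test_fun p \<alpha> i N k)\<^sup>2) =
      (LINT k|cube UNIV. (\<Prod>n\<in>UNIV. (test_factor p \<alpha> i N n (k n))\<^sup>2))"
    by (simp add: test_fun_def prod_power_distrib)
  also have "\<dots> = (\<Prod>n\<in>UNIV. LINT y|restrict_space lborel {0..<1}. (test_factor p \<alpha> i N n y)\<^sup>2)"
    unfolding cube_def
  proof (rule unit_prod.product_integral_prod)
    fix n
    show "integrable (restrict_space lborel {0..<1}) (\<lambda>y. (test_factor p \<alpha> i N n y)\<^sup>2)"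
      using integrable_chi integral_wave(3)[OF p in_range] chi_mult[OF p] by (auto simp: test_factor_def power2_eq_square)
  qed simp
  finally obtain n where "(LINT y|restrict_space lborel {0..<1}. (test_factor p \<alpha> i N n y)\<^sup>2) = 0"
    by auto
  thus False
    using integral_wave(4)[OF p in_range, of n N] integral_chi[OF p in_range, of n] p chi_mult[OF p]
    by (auto simp: test_factor_def power2_eq_square split: if_splits)
qed

lemma test_vec_orthogonal:
  assumes "p \<ge> 1" "N \<noteq> M" "\<alpha> \<noteq> UNIV"
  shows "inner (test_vec p \<alpha> i N) (test_vec p \<alpha> i M :: 'n::finite L2) = 0"
proof -
  \<comment> \<open>In a coordinate outside \<alpha> the two factors are waves with disjoint
    supports.\<close>
  obtain n where n: "n \<notin> \<alpha>" using assms(3) by auto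
  have "test_fun p \<alpha> i N k * cnj (test_fun p \<alpha> i M k) = 0" for k
  proof -
    have "wave p (i n) N (k n) = 0 \<or> wave p (i n) M (k n) = 0"
      using wave_disjoint[OF assms(1,2), of "i n" "k n"] by simp
    hence "test_fun p \<alpha> i N k = 0 \<or> test_fun p \<alpha> i M k = 0"
      using n by (auto simp: test_fun_def test_factor_def)
    thus ?thesis by auto
  qed
  moreover have "inner (test_vec p \<alpha> i N) (test_vec p \<alpha> i M) =
      (LINT k|cube UNIV. Re (test_fun p \<alpha> i N k * cnj (test_fun p \<alpha> i M k)))"
    unfolding test_vec_def by (rule inner_L2.abs_eq) (simp_all add: L2_eq_refl sq_integrable_test_fun)
  ultimately show ?thesis by (simp only:) simp
qed

section \<open>Dimensions of the ranges of units\<close>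

lemma finite_dimensional_mono: "finite_dimensional W \<Longrightarrow> V \<subseteq> W \<Longrightarrow> finite_dimensional V"
  by (auto simp: finite_dimensional_def)

lemma finite_dimensional_image:
  assumes "finite_dimensional V" "linear f" shows "finite_dimensional (f ` V)"
proof -
  obtain S where "finite S" "V \<subseteq> span S" using assms(1) by (auto simp: finite_dimensional_def)
  hence "f ` V \<subseteq> span (f ` S)" using linear_span_image[OF assms(2), of S] by auto
  thus ?thesis using \<open>finite S\<close> by (auto simp: finite_dimensional_def)
qed

text \<open>The test vectors are fixed by the unit, nonzero and pairwise orthogonal, so they form an
  infinite independent subset of the range.\<close>

lemma infinite_dimensional_mat_unit:
  assumes "p \<ge> 1" "i \<in> multi_idx p UNIV" "\<alpha> \<noteq> UNIV"
  shows "\<not> finite_dimensional (range (clinop_apply (mat_unit p \<alpha> i (i :: 'n::finite \<Rightarrow> nat))))"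
proof
  assume "finite_dimensional (range (clinop_apply (mat_unit p \<alpha> i i)))"
  then obtain S where S: "finite S" "range (clinop_apply (mat_unit p \<alpha> i i)) \<subseteq> span S"
    by (auto simp: finite_dimensional_def)
  let ?V = "range (test_vec p \<alpha> i)"
  have "test_vec p \<alpha> i N \<in> range (clinop_apply (mat_unit p \<alpha> i i))" for N
    using mat_unit_test_vec[OF assms(1,2), of \<alpha> N] by (metis rangeI)
  hence sub: "?V \<subseteq> span S" using S(2) by auto
  have inj: "inj (test_vec p \<alpha> i)"
  proof (rule injI, rule ccontr)
    fix N M assume "test_vec p \<alpha> i N = test_vec p \<alpha> i M" "N \<noteq> M"
    thus False
      using test_vec_orthogonal[OF assms(1) \<open>N \<noteq> M\<close> assms(3), of i] test_vec_nonzero[OF assms(1,2), of \<alpha> M] by simp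
  qed
  have "independent ?V"
  proof (rule pairwise_orthogonal_independent)
    show "pairwise real_inner_class.orthogonal ?V"
      using test_vec_orthogonal[OF assms(1) _ assms(3), of _ _ i]
      unfolding pairwise_def real_inner_class.orthogonal_def by (metis rangeE)
    show "0 \<notin> ?V" using test_vec_nonzero[OF assms(1,2), of \<alpha>] by (metis rangeE)
  qed
  hence "finite ?V" using independent_span_bound[OF S(1) _ sub] by blast
  thus False using inj finite_imageD infinite_UNIV_nat by blast
qed

lemma mat_unit_UNIV: "mat_unit p UNIV i m = kernel_unit p UNIV i m"
proof -
  have "{\<delta>. (UNIV :: 'a set) \<subseteq> \<delta>} = {UNIV}" by auto
  thus ?thesis by (simp add: mat_unit_def)
qed

lemma finite_dimensional_mat_unit_UNIV:
  "finite_dimensional (range (clinop_apply (mat_unit p UNIV i (m :: 'n::finite \<Rightarrow> nat))))"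
proof -
  have c: "sq_integrable (cell p UNIV i :: ('n \<Rightarrow> real) \<Rightarrow> complex)"
    using implementsD(1)[OF implements_Cell sq_integrable_const[of 1]] by simp
  let ?c = "abs_L2 (cell p UNIV i) :: 'n L2"
  \<comment> \<open>\<open>span\<close> is the real span, so a complex line needs the second
    generator \<open>\<i> *\<^sub>C ?c\<close>.\<close>
  have "clinop_apply (mat_unit p UNIV i m) u \<in> span {?c, \<i> *\<^sub>C ?c}" for u
  proof -
    let ?g = "\<lambda>k. cell p UNIV m k * rep_L2 u k"
    define z where "z = of_nat (p ^ card (UNIV :: 'n set)) * (LINT x|cube UNIV. ?g x)"
    have "average UNIV ?g k = (LINT x|cube UNIV. ?g x)" for k
      by (simp add: average_def merge_def)
    hence "clinop_apply (mat_unit p UNIV i m) (abs_L2 (rep_L2 u)) = abs_L2 (\<lambda>k. z * cell p UNIV i k)"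
      unfolding mat_unit_UNIV implementsD(2)[OF implements_kernel_unit sq_integrable_rep_L2]
      by (simp add: z_def mult_ac)
    also have "\<dots> = z *\<^sub>C ?c" by (simp add: abs_L2_scaleC c)
    also have "\<dots> = Re z *\<^sub>R ?c + Im z *\<^sub>R \<i> *\<^sub>C ?c"
      by (simp add: scaleR_scaleC scaleC_scaleC flip: scaleC_add_left)
         (metis complex_eq mult.commute)
    also have "\<dots> \<in> span {?c, \<i> *\<^sub>C ?c}"
      by (intro span_add span_scale span_base) auto
    finally show ?thesis by (simp add: abs_rep_L2)
  qed
  thus ?thesis
    unfolding finite_dimensional_def by (intro exI[of _ "{?c, \<i> *\<^sub>C ?c}"]) auto
qed

text \<open>A unit off the diagonal is moved to the diagonal by a kernel unit on its left, and a
  diagonal unit fixes a nonzero test vector.\<close>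

lemma mat_unit_nonzero:
  assumes "p \<ge> 1" "i \<in> multi_idx p UNIV" "\<And>n. n \<in> \<alpha> \<Longrightarrow> m n \<in> {1..p}"
  shows "mat_unit p \<alpha> i m \<noteq> (0 :: 'n::finite L2 clinop)"
proof
  let ?j = "\<lambda>n. if n \<in> \<alpha> then m n else i n"
  have j: "?j \<in> multi_idx p UNIV" using assms by (auto simp: multi_idx_UNIV)
  assume "mat_unit p \<alpha> i m = (0 :: 'n L2 clinop)"
  moreover have "kernel_unit p \<alpha> ?j i * mat_unit p \<alpha> i m = mat_unit p \<alpha> ?j m"
    using assms(1,2) by (subst kernel_unit_mult_mat_unit) (auto simp: multi_idx_UNIV)
  moreover have "mat_unit p \<alpha> ?j m = mat_unit p \<alpha> ?j ?j"
    by (rule mat_unit_cong) auto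
  ultimately have "mat_unit p \<alpha> ?j ?j = (0 :: 'n L2 clinop)" by simp
  thus False
    using mat_unit_test_vec[OF assms(1) j, where \<alpha> = \<alpha> and N = 0]
      test_vec_nonzero[OF assms(1) j, where \<alpha> = \<alpha> and N = 0] by simp
qed

section \<open>The action of the algebra on the matrix units\<close>

text \<open>The formula of \<open>b_coeff\<close> for arbitrary coefficients: the action on the
  units has to be computed before \<open>coeffs_of\<close> is known to be meaningful.\<close>

definition b_of :: "'n::finite coeffs \<Rightarrow> 'n set \<Rightarrow> ('n \<Rightarrow> nat) \<Rightarrow> ('n \<Rightarrow> nat) \<Rightarrow> complex"
  where "b_of a \<alpha> i m =
    (\<Sum>\<beta>\<in>Pow \<alpha>. (if restrict i (\<alpha> - \<beta>) = restrict m (\<alpha> - \<beta>) then 1 else 0) * a \<beta> i (restrict m \<beta>))"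

lemma b_coeff_eq_b_of: "b_coeff p T = b_of (coeffs_of p T)"
  by (simp add: b_coeff_def b_of_def fun_eq_iff)

lemma multi_idx_range: "r \<in> multi_idx p \<alpha> \<Longrightarrow> n \<in> \<alpha> \<Longrightarrow> r n \<in> {1..p}"
  by (auto simp: multi_idx_def PiE_iff)

lemma merge_in_multi_idx:
  "i \<in> multi_idx p (- \<alpha>) \<Longrightarrow> r \<in> multi_idx p \<alpha> \<Longrightarrow> merge (- \<alpha>) \<alpha> (i, r) \<in> multi_idx p UNIV"
  by (auto simp: multi_idx_def PiE_iff merge_def)

lemma merge_restrict: "merge (- \<alpha>) \<alpha> (restrict i (- \<alpha>), restrict i \<alpha>) = i"
  by (auto simp: merge_def fun_eq_iff)

lemma restrict_in_multi_idx: "i \<in> multi_idx p UNIV \<Longrightarrow> restrict i \<alpha> \<in> multi_idx p \<alpha>"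
  by (auto simp: multi_idx_def PiE_iff)

lemma multi_idx_eqI:
  "r \<in> multi_idx p \<alpha> \<Longrightarrow> r' \<in> multi_idx p \<alpha> \<Longrightarrow> (\<And>n. n \<in> \<alpha> \<Longrightarrow> r n = r' n) \<Longrightarrow> r = r'"
  unfolding multi_idx_def by (rule PiE_ext)

text \<open>Here the formula for b arises. The kernel unit with \<beta>, \<open>i'\<close>,
  \<open>m\<close> sends row \<open>j\<close> to row \<open>i'\<close> if \<beta> \<subseteq>
  \<alpha>, \<open>m\<close> equals \<open>j\<close> on \<beta>, and \<open>i'\<close> equals
  \<open>j\<close> off \<beta>; otherwise it gives 0. Off \<alpha> the last condition says that the
  block is preserved; on \<alpha> - \<beta> it is the Kronecker delta.\<close>

lemma combine_mult_mat_unit: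
  assumes p: "p \<ge> 1" and i: "i \<in> multi_idx p (- \<alpha>)" and r: "r \<in> multi_idx p \<alpha>"
  shows "combine p a * mat_unit p \<alpha> (merge (- \<alpha>) \<alpha> (i, r)) c =
    (\<Sum>r'\<in>multi_idx p \<alpha>. b_of a \<alpha> (merge (- \<alpha>) \<alpha> (i, r')) r *\<^sub>C mat_unit p \<alpha> (merge (- \<alpha>) \<alpha> (i, r')) (c :: 'n::finite \<Rightarrow> nat))"
proof -
  define j where "j = merge (- \<alpha>) \<alpha> (i, r)"
  have j: "j \<in> multi_idx p UNIV" unfolding j_def by (rule merge_in_multi_idx[OF i r])
  \<comment> \<open>The coefficient that is left once the sum over \<open>m\<close> has collapsed to
    \<open>restrict j \<beta>\<close>.\<close>
  define g where "g \<beta> i' = (if \<beta> \<subseteq> \<alpha> \<and> (\<forall>n\<in>- \<beta>. i' n = j n) then a \<beta> i' (restrict j \<beta>) else 0)" for \<beta> i'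
  have inner: "(\<Sum>m\<in>multi_idx p \<beta>. a \<beta> i' m *\<^sub>C (kernel_unit p \<beta> i' m * mat_unit p \<alpha> j c)) = g \<beta> i' *\<^sub>C mat_unit p \<alpha> i' c"
    for \<beta> i'
  proof -
    have "(\<Sum>m\<in>multi_idx p \<beta>. a \<beta> i' m *\<^sub>C (kernel_unit p \<beta> i' m * mat_unit p \<alpha> j c)) =
        (\<Sum>m\<in>multi_idx p \<beta>. if m = restrict j \<beta> then g \<beta> i' *\<^sub>C mat_unit p \<alpha> i' c else 0)"
    proof (rule sum.cong[OF refl])
      fix m assume m: "m \<in> multi_idx p \<beta>"
      have eq: "(\<forall>n\<in>\<beta>. m n = j n) \<longleftrightarrow> m = restrict j \<beta>"
        using multi_idx_eqI[OF m restrict_in_multi_idx[OF j]] by auto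
      have "kernel_unit p \<beta> i' m * mat_unit p \<alpha> j c =
         (if \<beta> \<subseteq> \<alpha> \<and> (\<forall>n\<in>- \<beta>. i' n = j n) \<and> (\<forall>n\<in>\<beta>. m n = j n) then mat_unit p \<alpha> i' c else 0)"
        using p multi_idx_range[OF m] by (rule kernel_unit_mult_mat_unit)
      thus "a \<beta> i' m *\<^sub>C (kernel_unit p \<beta> i' m * mat_unit p \<alpha> j c) =
          (if m = restrict j \<beta> then g \<beta> i' *\<^sub>C mat_unit p \<alpha> i' c else 0)"
        unfolding eq by (auto simp: g_def)
    qed
    also have "\<dots> = g \<beta> i' *\<^sub>C mat_unit p \<alpha> i' c"
      using restrict_in_multi_idx[OF j] by simp
    finally show ?thesis .
  qed
  have "combine p a * mat_unit p \<alpha> j c =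
      (\<Sum>\<beta>\<in>UNIV. \<Sum>i'\<in>multi_idx p UNIV. \<Sum>m\<in>multi_idx p \<beta>. a \<beta> i' m *\<^sub>C (kernel_unit p \<beta> i' m * mat_unit p \<alpha> j c))"
    by (simp add: combine_def sum_distrib_right mult_scaleC_left sum.cartesian_product split_def)
  also have "\<dots> = (\<Sum>i'\<in>multi_idx p UNIV. (\<Sum>\<beta>\<in>UNIV. g \<beta> i') *\<^sub>C mat_unit p \<alpha> i' c)"
    unfolding inner scaleC_sum_left by (rule sum.swap)
  \<comment> \<open>An index outside this image leaves the block, and all its coefficients vanish
    because only \<beta> \<subseteq> \<alpha> contribute.\<close>
  also have "\<dots> = (\<Sum>i'\<in>(\<lambda>r'. merge (- \<alpha>) \<alpha> (i, r')) ` multi_idx p \<alpha>. (\<Sum>\<beta>\<in>UNIV. g \<beta> i') *\<^sub>C mat_unit p \<alpha> i' c)"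
  proof (rule sum.mono_neutral_right)
    show "(\<lambda>r'. merge (- \<alpha>) \<alpha> (i, r')) ` multi_idx p \<alpha> \<subseteq> multi_idx p UNIV"
      using merge_in_multi_idx[OF i] by auto
    show "\<forall>i'\<in>multi_idx p UNIV - (\<lambda>r'. merge (- \<alpha>) \<alpha> (i, r')) ` multi_idx p \<alpha>.
        (\<Sum>\<beta>\<in>UNIV. g \<beta> i') *\<^sub>C mat_unit p \<alpha> i' c = 0"
    proof
      fix i' assume i': "i' \<in> multi_idx p UNIV - (\<lambda>r'. merge (- \<alpha>) \<alpha> (i, r')) ` multi_idx p \<alpha>"
      have "\<exists>n\<in>- \<alpha>. i' n \<noteq> j n"
      proof (rule ccontr)
        assume *: "\<not> (\<exists>n\<in>- \<alpha>. i' n \<noteq> j n)"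
        have "i' = merge (- \<alpha>) \<alpha> (i, restrict i' \<alpha>)"
          using * by (auto simp: merge_def fun_eq_iff j_def)
        thus False using i' restrict_in_multi_idx[of i' p \<alpha>] by blast
      qed
      hence "g \<beta> i' = 0" for \<beta> by (auto simp: g_def)
      thus "(\<Sum>\<beta>\<in>UNIV. g \<beta> i') *\<^sub>C mat_unit p \<alpha> i' c = 0" by simp
    qed
  qed simp
  also have "\<dots> = (\<Sum>r'\<in>multi_idx p \<alpha>. (\<Sum>\<beta>\<in>UNIV. g \<beta> (merge (- \<alpha>) \<alpha> (i, r'))) *\<^sub>C mat_unit p \<alpha> (merge (- \<alpha>) \<alpha> (i, r')) c)"
  proof (rule sum.reindex[unfolded o_def], rule inj_onI)
    fix r1 r2 assume "r1 \<in> multi_idx p \<alpha>" "r2 \<in> multi_idx p \<alpha>"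
      and eq: "merge (- \<alpha>) \<alpha> (i, r1) = merge (- \<alpha>) \<alpha> (i, r2)"
    thus "r1 = r2"
    proof (rule_tac multi_idx_eqI)
      show "r1 n = r2 n" if "n \<in> \<alpha>" for n
        using fun_cong[OF eq, of n] that by (simp add: merge_def)
    qed
  qed
  also have "\<dots> = (\<Sum>r'\<in>multi_idx p \<alpha>. b_of a \<alpha> (merge (- \<alpha>) \<alpha> (i, r')) r *\<^sub>C mat_unit p \<alpha> (merge (- \<alpha>) \<alpha> (i, r')) c)"
  proof (rule sum.cong[OF refl])
    fix r'
    have "(\<Sum>\<beta>\<in>UNIV. g \<beta> (merge (- \<alpha>) \<alpha> (i, r'))) = (\<Sum>\<beta>\<in>Pow \<alpha>. g \<beta> (merge (- \<alpha>) \<alpha> (i, r')))"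
      by (rule sum.mono_neutral_right) (auto simp: g_def)
    also have "\<dots> = b_of a \<alpha> (merge (- \<alpha>) \<alpha> (i, r')) r"
      unfolding b_of_def
    proof (rule sum.cong[OF refl])
      fix \<beta> assume "\<beta> \<in> Pow \<alpha>"
      hence \<beta>: "\<beta> \<subseteq> \<alpha>" by simp
      have 1: "(\<forall>n\<in>- \<beta>. merge (- \<alpha>) \<alpha> (i, r') n = j n) \<longleftrightarrow>
          restrict (merge (- \<alpha>) \<alpha> (i, r')) (\<alpha> - \<beta>) = restrict r (\<alpha> - \<beta>)"
        using \<beta> by (auto simp: j_def merge_def fun_eq_iff restrict_def)
      have 2: "restrict j \<beta> = restrict r \<beta>"
        using \<beta> by (auto simp: j_def merge_def fun_eq_iff restrict_def)
      show "g \<beta> (merge (- \<alpha>) \<alpha> (i, r')) =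
         (if restrict (merge (- \<alpha>) \<alpha> (i, r')) (\<alpha> - \<beta>) = restrict r (\<alpha> - \<beta>) then 1 else 0) *
           a \<beta> (merge (- \<alpha>) \<alpha> (i, r')) (restrict r \<beta>)"
        unfolding g_def 1 2 using \<beta> by simp
    qed
    finally show "(\<Sum>\<beta>\<in>UNIV. g \<beta> (merge (- \<alpha>) \<alpha> (i, r'))) *\<^sub>C mat_unit p \<alpha> (merge (- \<alpha>) \<alpha> (i, r')) c =
        b_of a \<alpha> (merge (- \<alpha>) \<alpha> (i, r')) r *\<^sub>C mat_unit p \<alpha> (merge (- \<alpha>) \<alpha> (i, r')) c" by simp
  qed
  finally show ?thesis by (simp add: j_def)
qed

lemma kernel_unit_selects:
  assumes p: "p \<ge> 1" and r: "r \<in> multi_idx p \<alpha>" and r': "r' \<in> multi_idx p \<alpha>"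
  shows "kernel_unit p \<alpha> (merge (- \<alpha>) \<alpha> (i, l)) r * mat_unit p \<alpha> (merge (- \<alpha>) \<alpha> (i, r')) c =
    (if r' = r then mat_unit p \<alpha> (merge (- \<alpha>) \<alpha> (i, l)) c else (0 :: 'n::finite L2 clinop))"
proof -
  have "(\<forall>n\<in>\<alpha>. r n = merge (- \<alpha>) \<alpha> (i, r') n) \<longleftrightarrow> r' = r"
    using multi_idx_eqI[OF r r'] by (auto simp: merge_def)
  moreover have "\<forall>n\<in>- \<alpha>. merge (- \<alpha>) \<alpha> (i, l) n = merge (- \<alpha>) \<alpha> (i, r') n"
    by (auto simp: merge_def)
  ultimately show ?thesis
    using kernel_unit_mult_mat_unit[where \<gamma> = \<alpha> and \<beta> = \<alpha> and i = "merge (- \<alpha>) \<alpha> (i, l)" and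
        j = "merge (- \<alpha>) \<alpha> (i, r')" and l = c, OF p multi_idx_range[OF r]] by simp
qed

lemma mat_unit_independent:
  assumes p: "p \<ge> 1" and i: "i \<in> multi_idx p (- \<alpha>)" and c: "\<And>n. n \<in> \<alpha> \<Longrightarrow> c n \<in> {1..p}"
    and eq: "(\<Sum>r\<in>multi_idx p \<alpha>. x r *\<^sub>C mat_unit p \<alpha> (merge (- \<alpha>) \<alpha> (i, r)) c) =
      (\<Sum>r\<in>multi_idx p \<alpha>. y r *\<^sub>C mat_unit p \<alpha> (merge (- \<alpha>) \<alpha> (i, r)) (c :: 'n::finite \<Rightarrow> nat))"
    and r: "r \<in> multi_idx p \<alpha>"
  shows "x r = y r"
proof -
  let ?K = "kernel_unit p \<alpha> (merge (- \<alpha>) \<alpha> (i, r)) r"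
  let ?F = "mat_unit p \<alpha> (merge (- \<alpha>) \<alpha> (i, r)) c"
  have *: "?K * (\<Sum>r\<in>multi_idx p \<alpha>. z r *\<^sub>C mat_unit p \<alpha> (merge (- \<alpha>) \<alpha> (i, r)) c) = z r *\<^sub>C ?F" for z
  proof -
    have "?K * (\<Sum>r\<in>multi_idx p \<alpha>. z r *\<^sub>C mat_unit p \<alpha> (merge (- \<alpha>) \<alpha> (i, r)) c) =
       (\<Sum>r'\<in>multi_idx p \<alpha>. if r' = r then z r *\<^sub>C ?F else 0)"
      unfolding sum_distrib_left mult_scaleC_right
      by (rule sum.cong) (use r in \<open>simp_all add: kernel_unit_selects[OF p]\<close>)
    thus ?thesis using r by simp
  qed
  have "(x r - y r) *\<^sub>C ?F = 0"
    using *[of x] *[of y] eq by (simp add: scaleC_diff_left)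
  moreover have "?F \<noteq> 0"
    using p merge_in_multi_idx[OF i r] c by (rule mat_unit_nonzero)
  ultimately show ?thesis by (simp add: scaleC_eq_0_iff)
qed

text \<open>Equal operators act equally on the units, and these are independent. The index
  \<open>i\<close> is cut into its part off \<alpha>, which names the block, and its part on
  \<alpha>, which names the row; \<open>m\<close> serves both as the row acted on and as the passive
  column.\<close>

lemma combine_eq_imp_b_of_eq:
  assumes p: "p \<ge> 1" and eq: "combine p a = combine p (a' :: 'n::finite coeffs)"
    and i: "i \<in> multi_idx p UNIV" and m: "m \<in> multi_idx p \<alpha>"
  shows "b_of a \<alpha> i m = b_of a' \<alpha> i m"
proof -
  let ?i = "restrict i (- \<alpha>)"
  have i': "?i \<in> multi_idx p (- \<alpha>)" by (rule restrict_in_multi_idx[OF i])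
  have "(\<Sum>r'\<in>multi_idx p \<alpha>. b_of a \<alpha> (merge (- \<alpha>) \<alpha> (?i, r')) m *\<^sub>C mat_unit p \<alpha> (merge (- \<alpha>) \<alpha> (?i, r')) m) =
      (\<Sum>r'\<in>multi_idx p \<alpha>. b_of a' \<alpha> (merge (- \<alpha>) \<alpha> (?i, r')) m *\<^sub>C mat_unit p \<alpha> (merge (- \<alpha>) \<alpha> (?i, r')) m)"
    unfolding combine_mult_mat_unit[OF p i' m, symmetric] eq ..
  from mat_unit_independent[OF p i' multi_idx_range[OF m] this restrict_in_multi_idx[OF i]]
  show ?thesis by (simp only: merge_restrict)
qed

text \<open>The passage from \<open>a\<close> to \<open>b\<close> is unitriangular with respect to inclusion of the index sets \<open>\<alpha>\<close>.\<close>

lemma b_of_inject: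
  assumes supp: "\<And>\<alpha> i m. (i, m) \<notin> multi_idx p UNIV \<times> multi_idx p \<alpha> \<Longrightarrow> a \<alpha> i m = 0"
    and supp': "\<And>\<alpha> i m. (i, m) \<notin> multi_idx p UNIV \<times> multi_idx p \<alpha> \<Longrightarrow> a' \<alpha> i m = 0"
    and eq: "\<And>\<alpha> i m. i \<in> multi_idx p UNIV \<Longrightarrow> m \<in> multi_idx p \<alpha> \<Longrightarrow> b_of a \<alpha> i m = b_of a' \<alpha> i m"
  shows "a = (a' :: 'n::finite coeffs)"
proof -
  have "\<forall>i\<in>multi_idx p UNIV. \<forall>m\<in>multi_idx p \<alpha>. a \<alpha> i m = a' \<alpha> i m" for \<alpha>
  proof (induction "card \<alpha>" arbitrary: \<alpha> rule: less_induct)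
    case less
    show ?case
    proof (intro ballI)
      fix i :: "'n \<Rightarrow> nat" and m assume i: "i \<in> multi_idx p UNIV" and m: "m \<in> multi_idx p \<alpha>"
      have ext: "restrict m \<alpha> = m"
        using m by (auto simp: multi_idx_def PiE_iff extensional_restrict)
      \<comment> \<open>In the term \<beta> = \<alpha> the Kronecker delta compares two empty
        multi-indices and equals 1.\<close>
      have split: "b_of x \<alpha> i m = x \<alpha> i m + (\<Sum>\<beta>\<in>Pow \<alpha> - {\<alpha>}.
          (if restrict i (\<alpha> - \<beta>) = restrict m (\<alpha> - \<beta>) then 1 else 0) * x \<beta> i (restrict m \<beta>))" for x
        unfolding b_of_def by (subst sum.remove[of _ \<alpha>]) (auto simp: ext)
      have lower: "a \<beta> i (restrict m \<beta>) = a' \<beta> i (restrict m \<beta>)" if "\<beta> \<in> Pow \<alpha> - {\<alpha>}" for \<beta>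
      proof -
        have "\<beta> \<subset> \<alpha>" using that by auto
        hence "card \<beta> < card \<alpha>" by (intro psubset_card_mono) auto
        moreover have "restrict m \<beta> \<in> multi_idx p \<beta>"
          using m \<open>\<beta> \<subset> \<alpha>\<close> by (auto simp: multi_idx_def PiE_iff)
        ultimately show ?thesis using less i by blast
      qed
      have "(\<Sum>\<beta>\<in>Pow \<alpha> - {\<alpha>}. (if restrict i (\<alpha> - \<beta>) = restrict m (\<alpha> - \<beta>) then 1 else 0) * a \<beta> i (restrict m \<beta>)) =
          (\<Sum>\<beta>\<in>Pow \<alpha> - {\<alpha>}. (if restrict i (\<alpha> - \<beta>) = restrict m (\<alpha> - \<beta>) then 1 else 0) * a' \<beta> i (restrict m \<beta>))"
        by (rule sum.cong) (simp_all only: lower)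
      thus "a \<alpha> i m = a' \<alpha> i m"
        using eq[OF i m] unfolding split by simp
    qed
  qed
  hence "a \<alpha> i m = a' \<alpha> i m" for \<alpha> i m
    using supp[of i m \<alpha>] supp'[of i m \<alpha>] by (cases "(i, m) \<in> multi_idx p UNIV \<times> multi_idx p \<alpha>") auto
  thus ?thesis by (simp add: fun_eq_iff)
qed

text \<open>This is what justifies the definite description in \<open>coeffs_of\<close>.\<close>

lemma has_coeffs_unique:
  assumes "p \<ge> 1" "has_coeffs p T a" "has_coeffs p T a'"
  shows "a = (a' :: 'n::finite coeffs)"
proof (rule b_of_inject[of p])
  have "combine p a = combine p a'" using assms(2,3) by (simp add: has_coeffs_iff)
  from combine_eq_imp_b_of_eq[OF assms(1) this]
  show "b_of a \<alpha> i m = b_of a' \<alpha> i m" if "i \<in> multi_idx p UNIV" "m \<in> multi_idx p \<alpha>" for \<alpha> i m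
    using that .
qed (use assms(2,3) in \<open>simp_all add: has_coeffs_iff\<close>)

lemma combine_coeffs_of:
  assumes "p \<ge> 1" "T \<in> mixed_algebra p" shows "combine p (coeffs_of p T) = (T :: 'n::finite L2 clinop)"
proof -
  obtain a where a: "has_coeffs p T a" using assms(2) by (auto simp: mixed_algebra_def)
  have "coeffs_of p T = a"
    unfolding coeffs_of_def using a has_coeffs_unique[OF assms(1) _ a] by (rule the_equality)
  thus ?thesis using a by (simp add: has_coeffs_iff)
qed

section \<open>Blocks\<close>

definition idx :: "nat \<Rightarrow> 'n::finite set \<Rightarrow> nat \<Rightarrow> 'n \<Rightarrow> nat"
  where "idx p \<alpha> = from_nat_into (multi_idx p \<alpha>)"

definition bsize :: "nat \<Rightarrow> 'n set \<times> ('n \<Rightarrow> nat) \<Rightarrow> nat"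
  where "bsize p s = p ^ card (fst s)"

definition bmat :: "nat \<Rightarrow> 'n::finite L2 clinop \<Rightarrow> 'n set \<times> ('n \<Rightarrow> nat) \<Rightarrow> complex mat"
  where "bmat p T s = B_mat p T (fst s) (snd s)"

definition bidx :: "nat \<Rightarrow> 'n::finite set \<times> ('n \<Rightarrow> nat) \<Rightarrow> nat \<Rightarrow> 'n \<Rightarrow> nat"
  where "bidx p s r = merge (- fst s) (fst s) (snd s, idx p (fst s) r)"

text \<open>The row index carries the block label as well, being extended by it off the index set.
  The column index is left unextended, since \<open>mat_unit\<close> reads it on the index set
  only.\<close>

definition bunit :: "nat \<Rightarrow> 'n::finite set \<times> ('n \<Rightarrow> nat) \<Rightarrow> nat \<Rightarrow> nat \<Rightarrow> 'n L2 clinop"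
  where "bunit p s r c = mat_unit p (fst s) (bidx p s r) (idx p (fst s) c)"

lemma card_multi_idx: "card (multi_idx p (\<alpha> :: 'n::finite set)) = p ^ card \<alpha>"
  by (simp add: multi_idx_def card_PiE)

lemma bij_betw_idx: "bij_betw (idx p \<alpha>) {..<p ^ card \<alpha>} (multi_idx p (\<alpha> :: 'n::finite set))"
  using bij_betw_from_nat_into_finite[of "multi_idx p \<alpha>"] by (simp add: idx_def card_multi_idx)

lemma idx_in: "r < p ^ card \<alpha> \<Longrightarrow> idx p \<alpha> r \<in> multi_idx p \<alpha>"
  using bij_betw_idx[of p \<alpha>] by (auto simp: bij_betw_def)

lemma idx_eq_iff: "r < p ^ card \<alpha> \<Longrightarrow> r' < p ^ card \<alpha> \<Longrightarrow> idx p \<alpha> r = idx p \<alpha> r' \<longleftrightarrow> r = r'"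
  using bij_betw_idx[of p \<alpha>] by (auto simp: bij_betw_def inj_on_eq_iff)

lemma finite_blocks [simp]: "finite (blocks p :: ('n::finite set \<times> ('n \<Rightarrow> nat)) set)"
  by (simp add: blocks_def)

lemma bmat_carrier [simp]: "bmat p T s \<in> carrier_mat (bsize p s) (bsize p s)"
  by (simp add: bmat_def bsize_def B_mat_def Let_def)

lemma bmat_dim [simp]: "dim_row (bmat p T s) = bsize p s" "dim_col (bmat p T s) = bsize p s"
  using bmat_carrier[of p T s] by (auto simp del: bmat_carrier)

lemma bmat_index:
  "r < bsize p s \<Longrightarrow> c < bsize p s \<Longrightarrow>
    bmat p T s $$ (r, c) = b_of (coeffs_of p T) (fst s) (bidx p s r) (idx p (fst s) c)"
  by (simp add: bmat_def bsize_def B_mat_def Let_def b_coeff_eq_b_of bidx_def idx_def)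

lemma bidx_in: "s \<in> blocks p \<Longrightarrow> r < bsize p s \<Longrightarrow> bidx p s r \<in> multi_idx p UNIV"
  by (auto simp: blocks_def bidx_def bsize_def intro!: merge_in_multi_idx idx_in)

lemma bunit_nonzero:
  assumes "p \<ge> 1" "s \<in> blocks p" "r < bsize p s" "c < bsize p s" shows "bunit p s r c \<noteq> (0 :: 'n::finite L2 clinop)"
  unfolding bunit_def using assms(1) bidx_in[OF assms(2,3)]
  by (rule mat_unit_nonzero) (use assms(4) in \<open>auto dest!: idx_in multi_idx_range simp: bsize_def\<close>)

lemma bunit_in_mixed_algebra:
  assumes "s \<in> blocks p" "r < bsize p s" "c < bsize p s" shows "bunit p s r c \<in> mixed_algebra p"
  unfolding bunit_def using bidx_in[OF assms(1,2)]
  by (rule mat_unit_in_mixed_algebra) (use assms(3) in \<open>auto dest!: idx_in multi_idx_range simp: bsize_def\<close>)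

lemma mult_bunit:
  assumes p: "p \<ge> 1" and T: "T \<in> mixed_algebra p" and s: "s \<in> blocks p" and c: "c < bsize p s"
  shows "T * bunit p s c d = (\<Sum>r<bsize p s. bmat p T s $$ (r, c) *\<^sub>C bunit p s r (d :: nat) :: 'n::finite L2 clinop)"
proof -
  obtain \<alpha> i where s_eq: "s = (\<alpha>, i)" by (cases s)
  have i: "i \<in> multi_idx p (- \<alpha>)" and c': "c < p ^ card \<alpha>"
    using s c by (auto simp: s_eq blocks_def bsize_def)
  have "T * bunit p s c d = combine p (coeffs_of p T) * bunit p s c d"
    by (simp add: combine_coeffs_of[OF p T])
  also have "\<dots> = (\<Sum>r'\<in>multi_idx p \<alpha>. b_of (coeffs_of p T) \<alpha> (merge (- \<alpha>) \<alpha> (i, r')) (idx p \<alpha> c) *\<^sub>C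
      mat_unit p \<alpha> (merge (- \<alpha>) \<alpha> (i, r')) (idx p \<alpha> d))"
    unfolding bunit_def bidx_def s_eq fst_conv snd_conv by (rule combine_mult_mat_unit[OF p i idx_in[OF c']])
  also have "\<dots> = (\<Sum>r<p ^ card \<alpha>. b_of (coeffs_of p T) \<alpha> (merge (- \<alpha>) \<alpha> (i, idx p \<alpha> r)) (idx p \<alpha> c) *\<^sub>C
      mat_unit p \<alpha> (merge (- \<alpha>) \<alpha> (i, idx p \<alpha> r)) (idx p \<alpha> d))"
    by (rule sum.reindex_bij_betw[OF bij_betw_idx, symmetric])
  also have "\<dots> = (\<Sum>r<bsize p s. bmat p T s $$ (r, c) *\<^sub>C bunit p s r d)"
    by (rule sum.cong) (use c in \<open>auto simp: bmat_index s_eq bunit_def bidx_def bsize_def\<close>)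
  finally show ?thesis .
qed

text \<open>Multiplication by \<open>bselect p s r c\<close> from the left moves row \<open>c\<close> of block \<open>s\<close> to row \<open>r\<close> and kills its other rows,
  so it reads off coefficients with respect to the units of that block.\<close>

definition bselect :: "nat \<Rightarrow> 'n::finite set \<times> ('n \<Rightarrow> nat) \<Rightarrow> nat \<Rightarrow> nat \<Rightarrow> 'n L2 clinop"
  where "bselect p s r c = kernel_unit p (fst s) (bidx p s r) (idx p (fst s) c)"

lemma bselect_bunit:
  assumes "p \<ge> 1" "c < bsize p s" "r' < bsize p s"
  shows "bselect p s r c * bunit p s r' d = (if r' = c then bunit p s r d else (0 :: 'n::finite L2 clinop))"
  using kernel_unit_selects[OF assms(1), of "idx p (fst s) c" "fst s" "idx p (fst s) r'" "snd s" "idx p (fst s) r" "idx p (fst s) d"] assms(2,3)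
  by (simp add: bselect_def bunit_def bidx_def idx_in bsize_def idx_eq_iff)

lemma bselect_sum:
  assumes "p \<ge> 1" "c < bsize p s"
  shows "bselect p s r c * (\<Sum>r'<bsize p s. x r' *\<^sub>C bunit p s r' d) = x c *\<^sub>C (bunit p s r d :: 'n::finite L2 clinop)"
proof -
  have "bselect p s r c * (\<Sum>r'<bsize p s. x r' *\<^sub>C bunit p s r' d) =
      (\<Sum>r'<bsize p s. if r' = c then x c *\<^sub>C bunit p s r d else 0)"
    unfolding sum_distrib_left mult_scaleC_right
    by (rule sum.cong) (use assms in \<open>auto simp: bselect_bunit\<close>)
  thus ?thesis using assms(2) by simp
qed

lemma bunit_independent:
  assumes p: "p \<ge> 1" and s: "s \<in> blocks p" and d: "d < bsize p s"
    and eq: "(\<Sum>r<bsize p s. x r *\<^sub>C bunit p s r d) = (\<Sum>r<bsize p s. y r *\<^sub>C bunit p s r (d :: nat) :: 'n::finite L2 clinop)"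
    and r: "r < bsize p s"
  shows "x r = y r"
proof -
  have "(x r - y r) *\<^sub>C bunit p s r d = 0"
    using bselect_sum[OF p r, of r x d] bselect_sum[OF p r, of r y d] eq by (simp add: scaleC_diff_left)
  thus ?thesis using bunit_nonzero[OF p s r d] by (simp add: scaleC_eq_0_iff)
qed

lemma sum_bunit_diagonal:
  assumes p: "p \<ge> 1" shows "(\<Sum>s\<in>blocks p. \<Sum>r<bsize p s. bunit p s r r) = (1 :: 'n::finite L2 clinop)"
proof -
  have "(\<Sum>s\<in>blocks p. \<Sum>r<bsize p s. bunit p s r r) =
      (\<Sum>\<alpha>\<in>UNIV. \<Sum>i\<in>multi_idx p (- \<alpha>). \<Sum>r<bsize p (\<alpha>, i). bunit p (\<alpha>, i) r r)"
    unfolding blocks_def by (subst sum.Sigma) (auto simp: split_def)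
  also have "\<dots> = (\<Sum>\<alpha>\<in>UNIV. \<Sum>j\<in>multi_idx p UNIV. mat_unit p \<alpha> j j :: 'n L2 clinop)"
  proof (rule sum.cong[OF refl])
    fix \<alpha> :: "'n set"
    have "(\<Sum>r<bsize p (\<alpha>, i). bunit p (\<alpha>, i) r r) = (\<Sum>r\<in>multi_idx p \<alpha>. mat_unit p \<alpha> (merge (- \<alpha>) \<alpha> (i, r)) r)" for i
      using sum.reindex_bij_betw[OF bij_betw_idx, of "\<lambda>r. mat_unit p \<alpha> (merge (- \<alpha>) \<alpha> (i, r)) r" p \<alpha>]
      by (simp add: bsize_def bunit_def bidx_def)
    hence "(\<Sum>i\<in>multi_idx p (- \<alpha>). \<Sum>r<bsize p (\<alpha>, i). bunit p (\<alpha>, i) r r) =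
       (\<Sum>(i, r)\<in>multi_idx p (- \<alpha>) \<times> multi_idx p \<alpha>. mat_unit p \<alpha> (merge (- \<alpha>) \<alpha> (i, r)) r)"
      by (simp add: sum.cartesian_product)
    also have "\<dots> = (\<Sum>j\<in>multi_idx p UNIV. mat_unit p \<alpha> j j)"
    \<comment> \<open>A full index is the same as a block label off \<alpha> together with a row on
      \<alpha>.\<close>
    proof (rule sum.reindex_bij_witness[where i = "\<lambda>j. (restrict j (- \<alpha>), restrict j \<alpha>)" and j = "\<lambda>(i, r). merge (- \<alpha>) \<alpha> (i, r)"])
      fix z assume z: "z \<in> multi_idx p (- \<alpha>) \<times> multi_idx p \<alpha>"
      obtain i r where [simp]: "z = (i, r)" by (cases z)
      have ext: "i \<in> extensional (- \<alpha>)" "r \<in> extensional \<alpha>"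
        using z by (auto simp: multi_idx_def PiE_iff)
      show "(restrict (case z of (i, r) \<Rightarrow> merge (- \<alpha>) \<alpha> (i, r)) (- \<alpha>), restrict (case z of (i, r) \<Rightarrow> merge (- \<alpha>) \<alpha> (i, r)) \<alpha>) = z"
        using ext by (auto simp: merge_def fun_eq_iff restrict_def extensional_def)
      show "(case z of (i, r) \<Rightarrow> merge (- \<alpha>) \<alpha> (i, r)) \<in> multi_idx p UNIV"
        using z by (auto intro: merge_in_multi_idx)
      show "mat_unit p \<alpha> (case z of (i, r) \<Rightarrow> merge (- \<alpha>) \<alpha> (i, r)) (case z of (i, r) \<Rightarrow> merge (- \<alpha>) \<alpha> (i, r)) =
          (case z of (i, r) \<Rightarrow> mat_unit p \<alpha> (merge (- \<alpha>) \<alpha> (i, r)) r)"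
        by (auto intro!: mat_unit_cong simp: merge_def)
    next
      fix j :: "'n \<Rightarrow> nat" assume "j \<in> multi_idx p UNIV"
      thus "(restrict j (- \<alpha>), restrict j \<alpha>) \<in> multi_idx p (- \<alpha>) \<times> multi_idx p \<alpha>"
        by (auto intro: restrict_in_multi_idx)
      show "(case (restrict j (- \<alpha>), restrict j \<alpha>) of (i, r) \<Rightarrow> merge (- \<alpha>) \<alpha> (i, r)) = j"
        by (simp only: merge_restrict prod.case)
    qed
    finally show "(\<Sum>i\<in>multi_idx p (- \<alpha>). \<Sum>r<bsize p (\<alpha>, i). bunit p (\<alpha>, i) r r) = (\<Sum>j\<in>multi_idx p UNIV. mat_unit p \<alpha> j j)" .
  qed
  finally show ?thesis using sum_mat_unit_diagonal[OF p] by simp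
qed

lemma bunit_eqI:
  assumes "p \<ge> 1" and "\<And>s r. s \<in> blocks p \<Longrightarrow> r < bsize p s \<Longrightarrow> S * bunit p s r r = T * bunit p s r r"
  shows "S = (T :: 'n::finite L2 clinop)"
proof -
  have "S * (\<Sum>s\<in>blocks p. \<Sum>r<bsize p s. bunit p s r r) = T * (\<Sum>s\<in>blocks p. \<Sum>r<bsize p s. bunit p s r r)"
    unfolding sum_distrib_left by (intro sum.cong refl) (use assms in auto)
  thus ?thesis by (simp add: sum_bunit_diagonal[OF assms(1)])
qed

text \<open>\<open>T\<close> is an arbitrary bounded operator. This is what allows the exponential,
  a limit, to be placed in the algebra without a closedness argument.\<close>

lemma mixed_algebra_charI:
  assumes p: "p \<ge> 1" and C: "\<And>s. s \<in> blocks p \<Longrightarrow> C s \<in> carrier_mat (bsize p s) (bsize p s)"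
    and eq: "\<And>s c d. s \<in> blocks p \<Longrightarrow> c < bsize p s \<Longrightarrow> d < bsize p s \<Longrightarrow>
      T * bunit p s c d = (\<Sum>r<bsize p s. C s $$ (r, c) *\<^sub>C bunit p s r d)"
  shows "T \<in> mixed_algebra p" "\<And>s. s \<in> blocks p \<Longrightarrow> bmat p (T :: 'n::finite L2 clinop) s = C s"
proof -
  have "T = T * (\<Sum>s\<in>blocks p. \<Sum>r<bsize p s. bunit p s r r)"
    by (simp add: sum_bunit_diagonal[OF p])
  also have "\<dots> = (\<Sum>s\<in>blocks p. \<Sum>c<bsize p s. \<Sum>r<bsize p s. C s $$ (r, c) *\<^sub>C bunit p s r c)"
    unfolding sum_distrib_left by (intro sum.cong refl) (auto simp: eq)
  also have "\<dots> \<in> mixed_algebra p"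
    by (intro mixed_algebra_sum mixed_algebra_scaleC bunit_in_mixed_algebra) auto
  finally show T: "T \<in> mixed_algebra p" .
  fix s :: "'n set \<times> ('n \<Rightarrow> nat)" assume s: "s \<in> blocks p"
  show "bmat p T s = C s"
  proof (rule eq_matI)
    fix r c assume "r < dim_row (C s)" "c < dim_col (C s)"
    hence rc: "r < bsize p s" "c < bsize p s" using C[OF s] by auto
    have "(\<Sum>r<bsize p s. bmat p T s $$ (r, c) *\<^sub>C bunit p s r c) = (\<Sum>r<bsize p s. C s $$ (r, c) *\<^sub>C bunit p s r c)"
      using mult_bunit[OF p T s rc(2), of c] eq[OF s rc(2) rc(2)] by simp
    from bunit_independent[OF p s rc(2) this rc(1)]
    show "bmat p T s $$ (r, c) = C s $$ (r, c)" .
  qed (use C[OF s] in auto)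
qed

section \<open>Complex matrices\<close>

lemma mat_mult_index:
  assumes "M \<in> carrier_mat n n" "M' \<in> carrier_mat n n" "r < n" "c < n"
  shows "(M * M') $$ (r, c) = (\<Sum>j<n. M $$ (r, j) * M' $$ (j, c))"
  using assms by (auto simp: scalar_prod_def atLeast0LessThan intro!: sum.cong)

lemma mat_trace_mult_commute:
  assumes "M \<in> carrier_mat n n" "M' \<in> carrier_mat n n"
  shows "mat_trace (M * M') = mat_trace (M' * M)"
proof -
  have "mat_trace (M * M') = (\<Sum>r<n. \<Sum>j<n. M $$ (r, j) * M' $$ (j, r))"
    unfolding mat_trace_def
    by (rule sum.cong) (use assms in \<open>simp_all add: mat_mult_index[of _ n] del: index_mult_mat(1)\<close>)
  also have "\<dots> = (\<Sum>j<n. \<Sum>r<n. M' $$ (j, r) * M $$ (r, j))"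
    by (subst sum.swap) (simp add: mult.commute)
  also have "\<dots> = mat_trace (M' * M)"
    unfolding mat_trace_def
    by (rule sum.cong) (use assms in \<open>simp_all add: mat_mult_index[of _ n] del: index_mult_mat(1)\<close>)
  finally show ?thesis .
qed

text \<open>Cramer's form of the inverse. Its entries are quotients of polynomials in the entries of
  \<open>M\<close>, which makes resolvents visibly holomorphic; \<open>mat_inverse\<close> comes
  from Gauss-Jordan elimination.\<close>

definition minv :: "complex mat \<Rightarrow> complex mat"
  where "minv M = (1 / Determinant.det M) \<cdot>\<^sub>m adj_mat M"

lemma minv:
  assumes "M \<in> carrier_mat n n" "Determinant.det M \<noteq> 0"
  shows "minv M \<in> carrier_mat n n" "M * minv M = 1\<^sub>m n" "minv M * M = 1\<^sub>m n"
proof -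
  note adj = adj_mat[OF assms(1)]
  show "minv M \<in> carrier_mat n n" using adj(1) by (simp add: minv_def)
  have "M * minv M = (1 / Determinant.det M) \<cdot>\<^sub>m (M * adj_mat M)"
    unfolding minv_def by (rule mult_smult_distrib[OF assms(1) adj(1)])
  thus "M * minv M = 1\<^sub>m n"
    using assms(2) by (intro eq_matI) (auto simp: adj(2))
  have "minv M * M = (1 / Determinant.det M) \<cdot>\<^sub>m (adj_mat M * M)"
    unfolding minv_def by (rule mult_smult_assoc_mat[OF adj(1) assms(1)])
  thus "minv M * M = 1\<^sub>m n"
    using assms(2) by (intro eq_matI) (auto simp: adj(3))
qed

lemma invertible_mat_iff_det:
  assumes M: "(M :: complex mat) \<in> carrier_mat n n"
  shows "invertible_mat M \<longleftrightarrow> Determinant.det M \<noteq> 0"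
proof
  assume "invertible_mat M"
  then obtain B where B: "M * B = 1\<^sub>m n" "B * M = 1\<^sub>m (dim_row B)"
    using M by (auto simp: invertible_mat_def inverts_mat_def)
  \<comment> \<open>\<open>invertible_mat\<close> says nothing about the shape of \<open>B\<close>;
    its dimensions are read off from the two products.\<close>
  have "dim_col B = dim_col (M * B)" by simp
  hence "dim_col B = n" unfolding B(1) by simp
  moreover have "dim_col (B * M) = n" using M by simp
  hence "dim_row B = n" unfolding B(2) by simp
  ultimately have "B \<in> carrier_mat n n" by auto
  hence "Determinant.det M * Determinant.det B = 1"
    using det_mult[OF M] B(1) by (metis det_one)
  thus "Determinant.det M \<noteq> 0" by auto
next
  assume "Determinant.det M \<noteq> 0"
  from minv[OF M this] show "invertible_mat M"
    using M unfolding invertible_mat_def inverts_mat_def by (auto intro!: exI[of _ "minv M"])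
qed

lemma mat_inverse_eq_minv:
  assumes M: "M \<in> carrier_mat n n" and det: "Determinant.det M \<noteq> 0"
  shows "the (mat_inverse M) = minv M"
proof (cases "mat_inverse M")
  case None
  thus ?thesis
    using mat_inverse(1)[OF M None, of "()"] det_non_zero_imp_unit[OF M det, of "()"] by blast
next
  case (Some B)
  note B = mat_inverse(2)[OF M Some]
  have "B = B * (M * minv M)" using B minv(2)[OF M det] right_mult_one_mat[of B n n] by simp
  also have "\<dots> = minv M"
    using B minv(1)[OF M det] M assoc_mult_mat[of B n n M n "minv M" n] by simp
  finally show ?thesis using Some by simp
qed

section \<open>Determinant of the exponential of a matrix\<close>

lemma upper_triangular_pow:
  assumes T: "T \<in> carrier_mat n n" "upper_triangular (T :: complex mat)"
  shows "upper_triangular (T ^\<^sub>m k)" "r < n \<Longrightarrow> (T ^\<^sub>m k) $$ (r, r) = (T $$ (r, r)) ^ k"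
proof -
  have Tk: "T ^\<^sub>m k \<in> carrier_mat n n" for k using T(1) by simp
  have "(\<forall>r<n. \<forall>c<r. (T ^\<^sub>m k) $$ (r, c) = 0) \<and> (\<forall>r<n. (T ^\<^sub>m k) $$ (r, r) = (T $$ (r, r)) ^ k)"
  proof (induction k)
    case 0
    thus ?case using T(1) by auto
  next
    case (Suc k)
    have idx: "(T ^\<^sub>m Suc k) $$ (r, c) = (\<Sum>j<n. (T ^\<^sub>m k) $$ (r, j) * T $$ (j, c))" if "r < n" "c < n" for r c
      unfolding pow_mat.simps by (rule mat_mult_index[OF Tk T(1) that])
    have up: "T $$ (j, c) = 0" if "j < n" "c < j" for j c
      using T that by (auto simp: upper_triangular_def)
    show ?case
    proof (intro conjI allI impI)
      fix r c assume rc: "r < n" "c < r"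
      have "(T ^\<^sub>m k) $$ (r, j) * T $$ (j, c) = 0" if "j < n" for j
        using Suc.IH up[of j c] rc that by (cases "j < r") auto
      thus "(T ^\<^sub>m Suc k) $$ (r, c) = 0" using rc by (subst idx) (auto intro!: sum.neutral)
    next
      fix r assume r: "r < n"
      have "(\<Sum>j<n. (T ^\<^sub>m k) $$ (r, j) * T $$ (j, r)) = (\<Sum>j<n. if j = r then (T $$ (r, r)) ^ Suc k else 0)"
      proof (rule sum.cong[OF refl])
        fix j assume "j \<in> {..<n}"
        thus "(T ^\<^sub>m k) $$ (r, j) * T $$ (j, r) = (if j = r then (T $$ (r, r)) ^ Suc k else 0)"
          using Suc.IH up[of j r] r by (cases "j < r") auto
      qed
      thus "(T ^\<^sub>m Suc k) $$ (r, r) = (T $$ (r, r)) ^ Suc k" using r by (subst idx) auto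
    qed
  qed
  thus "upper_triangular (T ^\<^sub>m k)" "r < n \<Longrightarrow> (T ^\<^sub>m k) $$ (r, r) = (T $$ (r, r)) ^ k"
    using Tk[of k] by (auto simp: upper_triangular_def)
qed

text \<open>By Schur's decomposition one may assume that \<open>M\<close> is triangular.\<close>

lemma det_exp_mat:
  assumes M: "M \<in> carrier_mat n n" and E: "E \<in> carrier_mat n n"
    and sums: "\<And>r c. r < n \<Longrightarrow> c < n \<Longrightarrow> (\<lambda>k. (M ^\<^sub>m k) $$ (r, c) / fact k) sums (E $$ (r, c))"
  shows "Determinant.det E = exp (mat_trace M)"
proof -
  obtain es where es: "char_poly M = (\<Prod>e\<leftarrow>es. [:- e, 1:])"
    using char_poly_factorized[OF M] by auto
  obtain T P Q where TPQ: "schur_decomposition M es = (T, P, Q)" by (metis prod_cases3)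
  from schur_decomposition[OF M es TPQ]
  have wit: "similar_mat_wit M T P Q" and up: "upper_triangular T" by auto
  from similar_mat_witD2[OF M wit]
  have PQ: "P * Q = 1\<^sub>m n" "Q * P = 1\<^sub>m n" "M = P * T * Q" and T: "T \<in> carrier_mat n n"
    and P: "P \<in> carrier_mat n n" and Q: "Q \<in> carrier_mat n n" by auto
  define F where "F = Q * E * P"
  have F: "F \<in> carrier_mat n n" using P Q E by (simp add: F_def)
  have triple: "(Q * X * P) $$ (r, c) = (\<Sum>j<n. (\<Sum>i<n. Q $$ (r, i) * X $$ (i, j)) * P $$ (j, c))"
    if X: "X \<in> carrier_mat n n" and rc: "r < n" "c < n" for X r c
  proof -
    have QX: "Q * X \<in> carrier_mat n n" using Q X by simp
    show ?thesis
      unfolding mat_mult_index[OF QX P rc]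
      by (rule sum.cong) (use rc in \<open>simp_all add: mat_mult_index[OF Q X] del: index_mult_mat(1)\<close>)
  qed
  have QMP: "Q * M ^\<^sub>m k * P = T ^\<^sub>m k" for k
  proof -
    from similar_mat_witD2[OF _ similar_mat_wit_pow[OF wit, of k], of n n] M
    have Mk: "M ^\<^sub>m k = P * T ^\<^sub>m k * Q" by simp
    have Tk: "T ^\<^sub>m k \<in> carrier_mat n n" using T by simp
    have "Q * M ^\<^sub>m k * P = (Q * P) * T ^\<^sub>m k * (Q * P)"
      unfolding Mk using P Q Tk by (simp add: assoc_mult_mat[of _ n n _ n _ n])
    thus ?thesis by (simp only: PQ(2) left_mult_one_mat[OF Tk] right_mult_one_mat[OF Tk])
  qed
  have Fs: "(\<lambda>k. (T ^\<^sub>m k) $$ (r, c) / fact k) sums (F $$ (r, c))" if rc: "r < n" "c < n" for r c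
  proof -
    \<comment> \<open>Conjugation forms finite linear combinations of entries, so it may be applied
      termwise to the series.\<close>
    have "(\<lambda>k. \<Sum>j<n. (\<Sum>i<n. Q $$ (r, i) * ((M ^\<^sub>m k) $$ (i, j) / fact k)) * P $$ (j, c))
        sums (\<Sum>j<n. (\<Sum>i<n. Q $$ (r, i) * E $$ (i, j)) * P $$ (j, c))"
      by (intro sums_sum sums_mult sums_mult2 sums) auto
    moreover have "(\<Sum>j<n. (\<Sum>i<n. Q $$ (r, i) * ((M ^\<^sub>m k) $$ (i, j) / fact k)) * P $$ (j, c)) =
        (T ^\<^sub>m k) $$ (r, c) / fact k" for k
      unfolding QMP[symmetric] triple[OF pow_carrier_mat[OF M] rc]
      by (simp add: sum_divide_distrib sum_distrib_left sum_distrib_right)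
    ultimately show ?thesis unfolding F_def triple[OF E rc] by simp
  qed
  have Fup: "upper_triangular F"
  proof (rule upper_triangularI)
    fix i j assume ij: "j < i" "i < dim_row F"
    hence rc: "i < n" "j < n" using F by auto
    have "(T ^\<^sub>m k) $$ (i, j) = 0" for k
      using upper_triangular_pow(1)[OF T up, of k] ij rc T by (auto simp: upper_triangular_def)
    thus "F $$ (i, j) = 0" using Fs[OF rc] by (simp add: sums_iff)
  qed
  have Fdiag: "F $$ (r, r) = exp (T $$ (r, r))" if "r < n" for r
  proof -
    have "(\<lambda>k. (T $$ (r, r)) ^ k / fact k) sums (F $$ (r, r))"
      using Fs[OF that that] upper_triangular_pow(2)[OF T up that] by simp
    moreover have "(\<lambda>k. (T $$ (r, r)) ^ k / fact k) sums exp (T $$ (r, r))"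
      using exp_converges[of "T $$ (r, r)"] by (simp add: scaleR_conv_of_real divide_inverse mult.commute)
    ultimately show ?thesis by (rule sums_unique2)
  qed
  have PQdet: "Determinant.det P * Determinant.det Q = 1"
    using det_mult[OF P Q] PQ(1) by simp
  have "Determinant.det F = Determinant.det Q * Determinant.det E * Determinant.det P"
    unfolding F_def using det_mult[OF mult_carrier_mat[OF Q E] P] det_mult[OF Q E] by simp
  also have "\<dots> = Determinant.det E" using PQdet by (simp add: mult.commute mult.left_commute)
  finally have "Determinant.det E = Determinant.det F" ..
  also have "\<dots> = (\<Prod>r<n. F $$ (r, r))"
    unfolding det_upper_triangular[OF Fup F] diag_mat_def
    using F by (simp add: prod.list_conv_set_nth atLeast0LessThan)
  also have "\<dots> = exp (\<Sum>r<n. T $$ (r, r))"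
    by (simp add: Fdiag exp_sum)
  also have "(\<Sum>r<n. T $$ (r, r)) = mat_trace T" using T by (simp add: mat_trace_def)
  also have "mat_trace T = mat_trace M"
  proof -
    have "mat_trace M = mat_trace (Q * (P * T))"
      unfolding PQ(3) by (rule mat_trace_mult_commute[OF mult_carrier_mat[OF P T] Q])
    also have "Q * (P * T) = T" using PQ(2) P Q T by (simp flip: assoc_mult_mat)
    finally show ?thesis by simp
  qed
  finally show ?thesis .
qed

section \<open>The representation by blocks\<close>

lemma bmat_inject:
  assumes "p \<ge> 1" "S \<in> mixed_algebra p" "T \<in> mixed_algebra p"
    and "\<And>s. s \<in> blocks p \<Longrightarrow> bmat p S s = bmat p T s"
  shows "S = (T :: 'n::finite L2 clinop)"
proof (rule bunit_eqI[OF assms(1)])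
  fix s :: "'n set \<times> ('n \<Rightarrow> nat)" and r assume s: "s \<in> blocks p" and r: "r < bsize p s"
  show "S * bunit p s r r = T * bunit p s r r"
    unfolding mult_bunit[OF assms(1,2) s r] mult_bunit[OF assms(1,3) s r] assms(4)[OF s] ..
qed

lemma
  assumes p: "p \<ge> 1" and A: "A \<in> mixed_algebra p" and B: "B \<in> mixed_algebra p"
  shows mixed_algebra_lincomb: "l *\<^sub>C A + m *\<^sub>C B \<in> mixed_algebra p"
    and bmat_lincomb: "s \<in> blocks p \<Longrightarrow> bmat p (l *\<^sub>C A + m *\<^sub>C B) s = l \<cdot>\<^sub>m bmat p A s + m \<cdot>\<^sub>m bmat p (B :: 'n::finite L2 clinop) s"
proof -
  have *: "(l *\<^sub>C A + m *\<^sub>C B) * bunit p s c d =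
      (\<Sum>r<bsize p s. (l \<cdot>\<^sub>m bmat p A s + m \<cdot>\<^sub>m bmat p B s) $$ (r, c) *\<^sub>C bunit p s r d)"
    if "s \<in> blocks p" "c < bsize p s" for s c d
    using that by (simp add: distrib_right mult_scaleC_left mult_bunit[OF p A] mult_bunit[OF p B]
        scaleC_sum_right scaleC_scaleC scaleC_add_left sum.distrib)
  show "l *\<^sub>C A + m *\<^sub>C B \<in> mixed_algebra p"
    by (rule mixed_algebra_charI(1)[OF p, where C = "\<lambda>s. l \<cdot>\<^sub>m bmat p A s + m \<cdot>\<^sub>m bmat p B s"]) (simp_all add: *)
  show "s \<in> blocks p \<Longrightarrow> bmat p (l *\<^sub>C A + m *\<^sub>C B) s = l \<cdot>\<^sub>m bmat p A s + m \<cdot>\<^sub>m bmat p B s"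
    by (rule mixed_algebra_charI(2)[OF p, where C = "\<lambda>s. l \<cdot>\<^sub>m bmat p A s + m \<cdot>\<^sub>m bmat p B s"]) (simp_all add: *)
qed

lemma
  assumes p: "p \<ge> 1" and A: "A \<in> mixed_algebra p" and B: "B \<in> mixed_algebra p"
  shows mixed_algebra_mult: "A * B \<in> mixed_algebra p"
    and bmat_mult: "s \<in> blocks p \<Longrightarrow> bmat p (A * B) s = bmat p A s * bmat p (B :: 'n::finite L2 clinop) s"
proof -
  have *: "(A * B) * bunit p s c d = (\<Sum>r<bsize p s. (bmat p A s * bmat p B s) $$ (r, c) *\<^sub>C bunit p s r d)"
    if s: "s \<in> blocks p" and c: "c < bsize p s" for s c d
  proof -
    have "(A * B) * bunit p s c d = (\<Sum>j<bsize p s. bmat p B s $$ (j, c) *\<^sub>C (A * bunit p s j d))"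
      by (simp add: mult.assoc mult_bunit[OF p B s c] sum_distrib_left mult_scaleC_right)
    also have "\<dots> = (\<Sum>j<bsize p s. \<Sum>r<bsize p s. (bmat p A s $$ (r, j) * bmat p B s $$ (j, c)) *\<^sub>C bunit p s r d)"
      by (rule sum.cong) (simp_all add: mult_bunit[OF p A s] scaleC_sum_right scaleC_scaleC mult.commute)
    also have "\<dots> = (\<Sum>r<bsize p s. (\<Sum>j<bsize p s. bmat p A s $$ (r, j) * bmat p B s $$ (j, c)) *\<^sub>C bunit p s r d)"
      unfolding scaleC_sum_left by (rule sum.swap)
    also have "\<dots> = (\<Sum>r<bsize p s. (bmat p A s * bmat p B s) $$ (r, c) *\<^sub>C bunit p s r d)"
      by (rule sum.cong) (use c in \<open>simp_all add: mat_mult_index[OF bmat_carrier bmat_carrier] del: index_mult_mat(1)\<close>)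
    finally show ?thesis .
  qed
  have C: "bmat p A s * bmat p B s \<in> carrier_mat (bsize p s) (bsize p s)" for s
    by (rule mult_carrier_mat[OF bmat_carrier bmat_carrier])
  show "A * B \<in> mixed_algebra p"
    by (rule mixed_algebra_charI(1)[OF p, where C = "\<lambda>s. bmat p A s * bmat p B s", OF C *])
  show "s \<in> blocks p \<Longrightarrow> bmat p (A * B) s = bmat p A s * bmat p B s"
    by (rule mixed_algebra_charI(2)[OF p, where C = "\<lambda>s. bmat p A s * bmat p B s", OF C *])
qed

lemma
  assumes p: "p \<ge> 1"
  shows mixed_algebra_one: "(1 :: 'n::finite L2 clinop) \<in> mixed_algebra p"
    and bmat_one: "s \<in> blocks p \<Longrightarrow> bmat p (1 :: 'n L2 clinop) s = 1\<^sub>m (bsize p s)"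
proof -
  have *: "(1 :: 'n L2 clinop) * bunit p s c d = (\<Sum>r<bsize p s. 1\<^sub>m (bsize p s) $$ (r, c) *\<^sub>C bunit p s r d)"
    if c: "c < bsize p s" for s c d
  proof -
    have "(\<Sum>r<bsize p s. 1\<^sub>m (bsize p s) $$ (r, c) *\<^sub>C bunit p s r d) =
        (\<Sum>r<bsize p s. if r = c then bunit p s c d else 0 :: 'n L2 clinop)"
      by (rule sum.cong) (use c in auto)
    thus ?thesis using c by simp
  qed
  show "(1 :: 'n L2 clinop) \<in> mixed_algebra p"
    by (rule mixed_algebra_charI(1)[OF p, where C = "\<lambda>s. 1\<^sub>m (bsize p s)", OF _ *]) auto
  show "s \<in> blocks p \<Longrightarrow> bmat p (1 :: 'n L2 clinop) s = 1\<^sub>m (bsize p s)"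
    by (rule mixed_algebra_charI(2)[OF p, where C = "\<lambda>s. 1\<^sub>m (bsize p s)", OF _ *]) auto
qed

lemma
  assumes p: "p \<ge> 1" and A: "A \<in> mixed_algebra p"
  shows mixed_algebra_pow: "A ^ k \<in> mixed_algebra p"
    and bmat_pow: "s \<in> blocks p \<Longrightarrow> bmat p (A ^ k) s = bmat p (A :: 'n::finite L2 clinop) s ^\<^sub>m k"
proof -
  show 1: "A ^ k \<in> mixed_algebra p" for k
    by (induction k) (simp_all add: mixed_algebra_one[OF p] mixed_algebra_mult[OF p A])
  show "s \<in> blocks p \<Longrightarrow> bmat p (A ^ k) s = bmat p A s ^\<^sub>m k"
  proof (induction k)
    case (Suc k)
    \<comment> \<open>Operator powers are built by adding a factor on the left, matrix powers on the
      right.\<close>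
    have "A ^ Suc k = A ^ k * A" by (rule power_Suc2)
    thus ?case using Suc bmat_mult[OF p 1 A] by simp
  qed (simp add: bmat_one[OF p])
qed

text \<open>Every term \<delta> of the left unit meets the right unit through
  \<open>kernel_unit_mult_mat_unit\<close>, which gives zero unless \<delta> \<subseteq> \<beta>.
  For \<alpha> = \<beta> only \<delta> = \<alpha> remains; for \<beta> strictly inside \<alpha>
  nothing does; and if \<beta> has an element outside \<alpha>, adding it to \<delta> changes only
  the sign, so that the terms cancel.\<close>

lemma mat_unit_mult:
  assumes p: "p \<ge> 1" and i: "i \<in> multi_idx p UNIV" and m: "\<And>n. n \<in> \<alpha> \<Longrightarrow> m n \<in> {1..p}"
  shows "mat_unit p \<alpha> i m * mat_unit p \<beta> j l =
    (if \<alpha> = \<beta> \<and> (\<forall>n\<in>- \<alpha>. i n = j n) \<and> (\<forall>n\<in>\<alpha>. m n = j n)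
     then mat_unit p \<beta> i l else (0 :: 'n::finite L2 clinop))"
proof -
  define C where "C \<longleftrightarrow> (\<forall>n\<in>- \<alpha>. i n = j n) \<and> (\<forall>n\<in>\<alpha>. m n = j n)"
  define h where "h \<delta> = (if \<delta> \<subseteq> \<beta> \<and> C then mat_unit p \<beta> i l else 0)" for \<delta>
  have "kernel_unit p \<delta> i (\<lambda>n. if n \<in> \<alpha> then m n else i n) * mat_unit p \<beta> j l = h \<delta>" if "\<alpha> \<subseteq> \<delta>" for \<delta>
  proof -
    have "((\<forall>n\<in>- \<delta>. i n = j n) \<and> (\<forall>n\<in>\<delta>. (if n \<in> \<alpha> then m n else i n) = j n)) \<longleftrightarrow> C"
    proof -
      have "(\<forall>n\<in>- \<delta>. i n = j n) \<longleftrightarrow> (\<forall>n\<in>- \<delta>. (if n \<in> \<alpha> then m n else i n) = j n)"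
        using that by (intro ball_cong refl) auto
      hence "((\<forall>n\<in>- \<delta>. i n = j n) \<and> (\<forall>n\<in>\<delta>. (if n \<in> \<alpha> then m n else i n) = j n)) \<longleftrightarrow>
          (\<forall>n. (if n \<in> \<alpha> then m n else i n) = j n)" by blast
      also have "\<dots> \<longleftrightarrow> C" unfolding C_def by (auto split: if_splits)
      finally show ?thesis .
    qed
    moreover have "kernel_unit p \<delta> i (\<lambda>n. if n \<in> \<alpha> then m n else i n) * mat_unit p \<beta> j l =
       (if \<delta> \<subseteq> \<beta> \<and> (\<forall>n\<in>- \<delta>. i n = j n) \<and> (\<forall>n\<in>\<delta>. (if n \<in> \<alpha> then m n else i n) = j n)
        then mat_unit p \<beta> i l else 0)"
    proof (rule kernel_unit_mult_mat_unit[OF p])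
      show "(if n \<in> \<alpha> then m n else i n) \<in> {1..p}" for n
        using i m[of n] by (simp add: multi_idx_UNIV)
    qed
    ultimately show ?thesis by (simp add: h_def)
  qed
  hence *: "mat_unit p \<alpha> i m * mat_unit p \<beta> j l = (\<Sum>\<delta> | \<alpha> \<subseteq> \<delta>. (- 1) ^ card (\<delta> - \<alpha>) *\<^sub>C h \<delta>)"
    by (simp add: mat_unit_def[of p \<alpha>] sum_distrib_right mult_scaleC_left)
  show ?thesis
  proof (cases "\<alpha> = \<beta>")
    case True
    have "(\<Sum>\<delta> | \<alpha> \<subseteq> \<delta>. (- 1) ^ card (\<delta> - \<alpha>) *\<^sub>C h \<delta>) = (\<Sum>\<delta> | \<alpha> \<subseteq> \<delta>. if \<delta> = \<alpha> then h \<alpha> else 0)"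
      by (rule sum.cong) (use True in \<open>auto simp: h_def\<close>)
    thus ?thesis unfolding * using True by (simp add: h_def C_def)
  next
    case False
    have "(\<Sum>\<delta> | \<alpha> \<subseteq> \<delta>. (- 1) ^ card (\<delta> - \<alpha>) *\<^sub>C h \<delta>) = 0"
    proof (cases "\<beta> \<subseteq> \<alpha>")
      case True
      hence "h \<delta> = 0" if "\<alpha> \<subseteq> \<delta>" for \<delta> using that False by (auto simp: h_def)
      thus ?thesis by (intro sum.neutral) auto
    next
      case False
      then obtain n\<^sub>0 where n0: "n\<^sub>0 \<in> \<beta>" "n\<^sub>0 \<notin> \<alpha>" by auto
      show ?thesis by (rule sum_alternating_zero[OF n0(2)]) (use n0(1) in \<open>auto simp: h_def\<close>)
    qed
    thus ?thesis unfolding * using False by simp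
  qed
qed

lemma bunit_mult:
  assumes p: "p \<ge> 1" and s: "s \<in> blocks p" "r < bsize p s" "c < bsize p s"
    and s': "s' \<in> blocks p" "c' < bsize p s'"
  shows "bunit p s r c * bunit p s' c' d = (if s = s' \<and> c = c' then bunit p s' r d else (0 :: 'n::finite L2 clinop))"
proof -
  obtain \<alpha> i where [simp]: "s = (\<alpha>, i)" by (cases s)
  obtain \<beta> j where [simp]: "s' = (\<beta>, j)" by (cases s')
  have ic: "idx p \<alpha> c \<in> multi_idx p \<alpha>" and i: "i \<in> multi_idx p (- \<alpha>)"
    and ic': "idx p \<beta> c' \<in> multi_idx p \<beta>" and j: "j \<in> multi_idx p (- \<beta>)"
    using s s' by (auto simp: bsize_def blocks_def intro: idx_in)
  have "(\<alpha> = \<beta> \<and> (\<forall>n\<in>- \<alpha>. bidx p s r n = bidx p s' c' n) \<and> (\<forall>n\<in>\<alpha>. idx p \<alpha> c n = bidx p s' c' n))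
      \<longleftrightarrow> s = s' \<and> c = c'"
  proof (cases "\<alpha> = \<beta>")
    case True
    have "(\<forall>n\<in>- \<alpha>. bidx p s r n = bidx p s' c' n) \<longleftrightarrow> i = j"
      using multi_idx_eqI[OF i, of j] j True by (auto simp: bidx_def merge_def)
    moreover have "(\<forall>n\<in>\<alpha>. idx p \<alpha> c n = bidx p s' c' n) \<longleftrightarrow> idx p \<alpha> c = idx p \<alpha> c'"
      using multi_idx_eqI[OF ic, of "idx p \<alpha> c'"] ic' True by (auto simp: bidx_def merge_def)
    ultimately show ?thesis
      using True s(3) s'(2) by (auto simp: bsize_def idx_eq_iff)
  qed auto
  moreover have "mat_unit p \<alpha> (bidx p s r) (idx p \<alpha> c) * mat_unit p \<beta> (bidx p s' c') (idx p \<beta> d) =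
    (if \<alpha> = \<beta> \<and> (\<forall>n\<in>- \<alpha>. bidx p s r n = bidx p s' c' n) \<and> (\<forall>n\<in>\<alpha>. idx p \<alpha> c n = bidx p s' c' n)
     then mat_unit p \<beta> (bidx p s r) (idx p \<beta> d) else 0)"
    by (rule mat_unit_mult[OF p bidx_in[OF s(1,2)]]) (rule multi_idx_range[OF ic])
  ultimately show ?thesis by (auto simp: bunit_def)
qed

text \<open>The inverse of \<open>sigma_map\<close>, for families of matrices of the right
  sizes.\<close>

definition of_blocks :: "nat \<Rightarrow> ('n::finite set \<times> ('n \<Rightarrow> nat) \<Rightarrow> complex mat) \<Rightarrow> 'n L2 clinop"
  where "of_blocks p C = (\<Sum>s\<in>blocks p. \<Sum>r<bsize p s. \<Sum>c<bsize p s. C s $$ (r, c) *\<^sub>C bunit p s r c)"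

lemma
  assumes p: "p \<ge> 1" and C: "\<And>s. s \<in> blocks p \<Longrightarrow> C s \<in> carrier_mat (bsize p s) (bsize p s)"
  shows of_blocks_in: "of_blocks p C \<in> mixed_algebra p"
    and bmat_of_blocks: "\<And>s. s \<in> blocks p \<Longrightarrow> bmat p (of_blocks p C :: 'n::finite L2 clinop) s = C s"
proof -
  have *: "of_blocks p C * bunit p s c d = (\<Sum>r<bsize p s. C s $$ (r, c) *\<^sub>C bunit p s r d)"
    if s: "s \<in> blocks p" and c: "c < bsize p s" for s :: "'n set \<times> ('n \<Rightarrow> nat)" and c d
  proof -
    have "of_blocks p C * bunit p s c d = (\<Sum>s'\<in>blocks p. if s' = s then
        (\<Sum>r<bsize p s. C s $$ (r, c) *\<^sub>C bunit p s r d) else 0)"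
      unfolding of_blocks_def sum_distrib_right mult_scaleC_left
    proof (rule sum.cong[OF refl])
      fix s' :: "'n set \<times> ('n \<Rightarrow> nat)" assume s': "s' \<in> blocks p"
      have "(\<Sum>r<bsize p s'. \<Sum>c'<bsize p s'. C s' $$ (r, c') *\<^sub>C (bunit p s' r c' * bunit p s c d)) =
          (\<Sum>r<bsize p s'. \<Sum>c'<bsize p s'. if c' = c then (if s' = s then C s $$ (r, c) *\<^sub>C bunit p s r d else 0) else 0)"
        by (intro sum.cong refl) (use s s' c in \<open>auto simp: bunit_mult[OF p]\<close>)
      thus "(\<Sum>r<bsize p s'. \<Sum>c'<bsize p s'. C s' $$ (r, c') *\<^sub>C (bunit p s' r c' * bunit p s c d)) =
          (if s' = s then (\<Sum>r<bsize p s. C s $$ (r, c) *\<^sub>C bunit p s r d) else 0)"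
        using c by auto
    qed
    thus ?thesis using s by simp
  qed
  show "of_blocks p C \<in> mixed_algebra p"
    by (rule mixed_algebra_charI(1)[OF p C *])
  show "\<And>s. s \<in> blocks p \<Longrightarrow> bmat p (of_blocks p C) s = C s"
    by (rule mixed_algebra_charI(2)[OF p C *])
qed

text \<open>The exponential series is applied to a unit and compared entry by entry with the series
  of the matrices. Convergence of the entries is inherited from the operator: isolating an entry by
  \<open>bselect\<close> bounds it by a constant times the norm of the corresponding term of the
  operator series.\<close>

lemma
  assumes p: "p \<ge> 1" and A: "A \<in> mixed_algebra p"
  shows mixed_algebra_exp: "exp A \<in> mixed_algebra p"
    and det_bmat_exp: "s \<in> blocks p \<Longrightarrow>
      Determinant.det (bmat p (exp A) s) = exp (mat_trace (bmat p (A :: 'n::finite L2 clinop) s))"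
proof -
  \<comment> \<open>These infinite sums acquire their meaning in \<open>sums\<close>, where
    summability is shown.\<close>
  define E where "E s = Matrix.mat (bsize p s) (bsize p s) (\<lambda>(r, c). \<Sum>k. (bmat p A s ^\<^sub>m k) $$ (r, c) / fact k)"
    for s :: "'n set \<times> ('n \<Rightarrow> nat)"
  have E: "E s \<in> carrier_mat (bsize p s) (bsize p s)" for s by (simp add: E_def)
  have exp_term: "(A ^ k /\<^sub>R fact k) * bunit p s c d =
      (\<Sum>r<bsize p s. ((bmat p A s ^\<^sub>m k) $$ (r, c) / fact k) *\<^sub>C bunit p s r d)"
    if s: "s \<in> blocks p" and c: "c < bsize p s" for s k c d
    using mult_bunit[OF p mixed_algebra_pow[OF p A] s c, of k d]
    by (simp add: scaleR_scaleC mult_scaleC_left scaleC_sum_right scaleC_scaleC bmat_pow[OF p A s] divide_inverse mult.commute)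
  have sums: "(\<lambda>k. (bmat p A s ^\<^sub>m k) $$ (r, c) / fact k) sums (E s $$ (r, c))"
    if s: "s \<in> blocks p" and r: "r < bsize p s" and c: "c < bsize p s" for s r c
  proof -
    let ?V = "bunit p s r c" and ?K = "bselect p s r r"
    have V: "norm ?V > 0" using bunit_nonzero[OF p s r c] by simp
    have "norm ((bmat p A s ^\<^sub>m k) $$ (r, c) / fact k) \<le> norm ?K * norm ?V / norm ?V * norm (A ^ k /\<^sub>R fact k)
      * (norm (bunit p s c c) / norm ?V)" for k
    proof -
      have "?K * ((A ^ k /\<^sub>R fact k) * bunit p s c c) = ((bmat p A s ^\<^sub>m k) $$ (r, c) / fact k) *\<^sub>C ?V"
        unfolding exp_term[OF s c] by (rule bselect_sum[OF p r])
      hence "norm ((bmat p A s ^\<^sub>m k) $$ (r, c) / fact k) * norm ?V = norm (?K * ((A ^ k /\<^sub>R fact k) * bunit p s c c))"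
        by (simp add: norm_scaleC)
      also have "\<dots> \<le> norm ?K * (norm (A ^ k /\<^sub>R fact k) * norm (bunit p s c c))"
        by (intro order_trans[OF norm_mult_ineq] mult_left_mono norm_mult_ineq norm_ge_zero)
      finally show ?thesis using V by (simp add: field_simps)
    qed
    moreover have "summable (\<lambda>k. norm ?K * norm ?V / norm ?V * norm (A ^ k /\<^sub>R fact k) * (norm (bunit p s c c) / norm ?V))"
      by (intro summable_mult summable_mult2 summable_norm_exp)
    ultimately have "summable (\<lambda>k. (bmat p A s ^\<^sub>m k) $$ (r, c) / fact k)"
      by (rule summable_comparison_test'[where N = 0, rotated])
    thus ?thesis using r c by (simp add: E_def summable_sums)
  qed
  have *: "exp A * bunit p s c d = (\<Sum>r<bsize p s. E s $$ (r, c) *\<^sub>C bunit p s r d)"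
    if s: "s \<in> blocks p" and c: "c < bsize p s" for s c d
  proof -
    have "(\<lambda>k. (A ^ k /\<^sub>R fact k) * bunit p s c d) sums (exp A * bunit p s c d)"
      by (rule bounded_linear.sums[OF bounded_linear_mult_left exp_converges])
    moreover have "(\<lambda>k. (A ^ k /\<^sub>R fact k) * bunit p s c d) sums (\<Sum>r<bsize p s. E s $$ (r, c) *\<^sub>C bunit p s r d)"
      unfolding exp_term[OF s c]
    proof (rule sums_sum)
      fix r assume "r \<in> {..<bsize p s}"
      hence "(\<lambda>k. (bmat p A s ^\<^sub>m k) $$ (r, c) / fact k) sums (E s $$ (r, c))"
        using sums[OF s _ c] by simp
      moreover have "bounded_linear (\<lambda>z. z *\<^sub>C bunit p s r d)"
        by (rule bounded_linear_intro[where K = "norm (bunit p s r d)"])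
           (simp_all add: scaleC_add_left norm_scaleC scaleR_scaleC scaleC_scaleC scaleR_conv_of_real)
      ultimately show "(\<lambda>k. ((bmat p A s ^\<^sub>m k) $$ (r, c) / fact k) *\<^sub>C bunit p s r d) sums (E s $$ (r, c) *\<^sub>C bunit p s r d)"
        by (rule bounded_linear.sums[rotated])
    qed
    ultimately show ?thesis by (rule sums_unique2)
  qed
  show "exp A \<in> mixed_algebra p"
    by (rule mixed_algebra_charI(1)[OF p E *])
  show "Determinant.det (bmat p (exp A) s) = exp (mat_trace (bmat p A s))" if s: "s \<in> blocks p"
  proof -
    have "bmat p (exp A) s = E s"
      using p E * s by (rule mixed_algebra_charI(2))
    thus ?thesis using det_exp_mat[OF bmat_carrier E sums[OF s]] by simp
  qed
qed

section \<open>Resolvents\<close>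

text \<open>Written as a linear combination so that \<open>bmat_lincomb\<close> produces it.\<close>

definition shifted :: "complex mat \<Rightarrow> complex \<Rightarrow> complex mat"
  where "shifted M z = z \<cdot>\<^sub>m 1\<^sub>m (dim_row M) + (- 1) \<cdot>\<^sub>m M"

lemma shifted_carrier [simp]: "M \<in> carrier_mat n n \<Longrightarrow> shifted M z \<in> carrier_mat n n"
  by (auto simp: shifted_def)

text \<open>The library's \<open>char_matrix\<close> is the negative of this matrix, so the
  determinants vanish together.\<close>

lemma det_shifted:
  assumes M: "M \<in> carrier_mat n n"
  shows "Determinant.det (shifted M z) = 0 \<longleftrightarrow> eigenvalue M z"
proof -
  have "shifted M z = (- 1) \<cdot>\<^sub>m char_matrix M z"
    using M by (intro eq_matI) (auto simp: shifted_def char_matrix_def)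
  thus ?thesis
    using M by (simp add: eigenvalue_det[OF M])
qed

lemma holomorphic_det:
  assumes "\<And>z. F z \<in> carrier_mat n n"
    and "\<And>i j. i < n \<Longrightarrow> j < n \<Longrightarrow> (\<lambda>z. F z $$ (i, j)) holomorphic_on S"
  shows "(\<lambda>z. Determinant.det (F z)) holomorphic_on S"
  unfolding det_def'[OF assms(1)]
proof (intro holomorphic_on_sum holomorphic_on_mult holomorphic_on_const holomorphic_on_prod)
  fix q i assume "q \<in> {q. q permutes {0..<n}}" "i \<in> {0..<n}"
  thus "(\<lambda>z. F z $$ (i, q i)) holomorphic_on S"
    using permutes_in_image[of q "{0..<n}" i] by (intro assms(2)) auto
qed

text \<open>By Cramer's rule an entry is a cofactor divided by the determinant. Both are polynomials
  in the entries, which are affine in \<open>z\<close>, and the determinant vanishes only at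
  eigenvalues.\<close>

lemma holomorphic_minv_shifted:
  assumes M: "M \<in> carrier_mat n n" and S: "\<And>z. z \<in> S \<Longrightarrow> \<not> eigenvalue M z" and rc: "r < n" "c < n"
  shows "(\<lambda>z. minv (shifted M z) $$ (r, c)) holomorphic_on S"
proof -
  have carr: "shifted M z \<in> carrier_mat n n" for z using M by simp
  have entry: "(\<lambda>z. shifted M z $$ (i, j)) holomorphic_on S" if "i < n" "j < n" for i j
  proof -
    have "(\<lambda>z. shifted M z $$ (i, j)) = (\<lambda>z. z * (if i = j then 1 else 0) - M $$ (i, j))"
      using M that by (auto simp: shifted_def fun_eq_iff)
    thus ?thesis by (auto intro!: holomorphic_intros)
  qed
  \<comment> \<open>Row and column are exchanged because the adjugate is the transposed cofactor
    matrix.\<close>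
  have "(\<lambda>z. Determinant.det (mat_delete (shifted M z) c r)) holomorphic_on S"
  proof (rule holomorphic_det)
    show "mat_delete (shifted M z) c r \<in> carrier_mat (n - 1) (n - 1)" for z
      using carr[of z] by auto
    fix i j assume ij: "i < n - 1" "j < n - 1"
    have "(\<lambda>z. mat_delete (shifted M z) c r $$ (i, j)) =
        (\<lambda>z. shifted M z $$ (if i < c then i else Suc i, if j < r then j else Suc j))"
    proof
      fix z
      have "dim_row (shifted M z) = n" "dim_col (shifted M z) = n" using carr[of z] by auto
      thus "mat_delete (shifted M z) c r $$ (i, j) =
          shifted M z $$ (if i < c then i else Suc i, if j < r then j else Suc j)"
        using ij by (simp add: mat_delete_def)
    qed
    thus "(\<lambda>z. mat_delete (shifted M z) c r $$ (i, j)) holomorphic_on S"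
      using ij by (auto intro!: entry)
  qed
  hence "(\<lambda>z. 1 / Determinant.det (shifted M z) * cofactor (shifted M z) c r) holomorphic_on S"
    unfolding cofactor_def
    by (intro holomorphic_intros holomorphic_det[OF carr entry]) (use S det_shifted[OF M] in auto)
  moreover have "minv (shifted M z) $$ (r, c) = 1 / Determinant.det (shifted M z) * cofactor (shifted M z) c r" for z
    using carr[of z] rc by (simp add: minv_def adj_mat_def)
  ultimately show ?thesis by simp
qed

lemma finite_eigenvalues:
  assumes "(M :: complex mat) \<in> carrier_mat n n" shows "finite {z. eigenvalue M z}"
proof -
  have "char_poly M \<noteq> 0" using degree_monic_char_poly[OF assms] by auto
  thus ?thesis unfolding eigenvalue_root_char_poly[OF assms] by (rule poly_roots_finite)
qed

lemma inverse_op_eq: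
  assumes "A * C = 1" "C * A = (1 :: 'a::ring_1)" shows "inverse_op A = C"
  unfolding inverse_op_def
proof (rule the_equality)
  fix D assume D: "A * D = 1 \<and> D * A = 1"
  have "D = D * (A * C)" using assms by simp
  also have "\<dots> = C" using D by (simp flip: mult.assoc)
  finally show "D = C" .
qed (use assms in simp)

text \<open>Both products have identity matrices as blocks, and operators of the algebra are
  determined by their blocks.\<close>

lemma
  assumes p: "p \<ge> 1" and A: "A \<in> mixed_algebra p"
    and det: "\<And>s. s \<in> blocks p \<Longrightarrow> Determinant.det (bmat p (A :: 'n::finite L2 clinop) s) \<noteq> 0"
  shows invertible_op_if_det: "invertible_op A"
    and inverse_op_eq_of_blocks: "inverse_op A = of_blocks p (\<lambda>s. minv (bmat p A s))"
proof -
  let ?C = "of_blocks p (\<lambda>s. minv (bmat p A s)) :: 'n L2 clinop"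
  have carr: "minv (bmat p A s) \<in> carrier_mat (bsize p s) (bsize p s)" if "s \<in> blocks p" for s
    using minv(1)[OF bmat_carrier det[OF that]] .
  note C = of_blocks_in[OF p carr] and bC = bmat_of_blocks[OF p carr]
  have 1: "A * ?C = 1"
    by (rule bmat_inject[OF p mixed_algebra_mult[OF p A C] mixed_algebra_one[OF p]])
       (simp_all add: bmat_mult[OF p A C] bC bmat_one[OF p] minv(2)[OF bmat_carrier det])
  have 2: "?C * A = 1"
    by (rule bmat_inject[OF p mixed_algebra_mult[OF p C A] mixed_algebra_one[OF p]])
       (simp_all add: bmat_mult[OF p C A] bC bmat_one[OF p] minv(3)[OF bmat_carrier det])
  show "invertible_op A" using 1 2 by (auto simp: invertible_op_def)
  show "inverse_op A = ?C" by (rule inverse_op_eq[OF 1 2])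
qed

text \<open>Operators \<open>W\<close> instead of eigenvectors: \<open>K\<close> transports the dimension of the range of a block unit to
  the range of \<open>W\<close>, which lies in the eigenspace.\<close>

lemma eigen_operator:
  assumes p: "p \<ge> 1" and A: "A \<in> mixed_algebra p" and s: "s \<in> blocks p"
    and ev: "eigenvalue (bmat p (A :: 'n::finite L2 clinop) s) z"
  obtains W K where "A * W = z *\<^sub>C W" "K * W = bunit p s 0 0" "W \<noteq> 0"
proof -
  let ?n = "bsize p s" and ?M = "bmat p A s"
  obtain v where v: "v \<in> carrier_vec ?n" "v \<noteq> 0\<^sub>v ?n" "?M *\<^sub>v v = z \<cdot>\<^sub>v v"
    using ev by (auto simp: eigenvalue_def eigenvector_def)
  have n0: "0 < ?n" using p by (simp add: bsize_def)
  obtain r where r: "r < ?n" "v $ r \<noteq> 0"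
  proof -
    have "\<exists>r<?n. v $ r \<noteq> 0"
    proof (rule ccontr)
      assume "\<not> ?thesis"
      hence "v = 0\<^sub>v ?n" using v(1) by (intro eq_vecI) auto
      thus False using v(2) by simp
    qed
    thus ?thesis using that by blast
  qed
  \<comment> \<open>The eigenvector is written down the rows of column 0; on such sums
    \<open>A\<close> acts as \<open>?M\<close> does on vectors.\<close>
  define W where "W = (\<Sum>c<?n. (v $ c) *\<^sub>C bunit p s c 0)"
  have Mv: "(\<Sum>c<?n. ?M $$ (q, c) * v $ c) = z * v $ q" if "q < ?n" for q
  proof -
    have "(?M *\<^sub>v v) $ q = (\<Sum>c<?n. ?M $$ (q, c) * v $ c)"
      using that v(1) by (auto simp: scalar_prod_def atLeast0LessThan intro!: sum.cong)
    thus ?thesis using v that by simp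
  qed
  have "A * W = (\<Sum>c<?n. \<Sum>q<?n. (?M $$ (q, c) * v $ c) *\<^sub>C bunit p s q 0)"
    unfolding W_def sum_distrib_left mult_scaleC_right
    by (rule sum.cong) (simp_all add: mult_bunit[OF p A s] scaleC_sum_right scaleC_scaleC mult.commute)
  also have "\<dots> = (\<Sum>q<?n. (\<Sum>c<?n. ?M $$ (q, c) * v $ c) *\<^sub>C bunit p s q 0)"
    unfolding scaleC_sum_left by (rule sum.swap)
  also have "\<dots> = z *\<^sub>C W"
    unfolding W_def scaleC_sum_right by (rule sum.cong) (simp_all add: Mv scaleC_scaleC)
  finally have 1: "A * W = z *\<^sub>C W" .
  have "bselect p s 0 r * W = (v $ r) *\<^sub>C bunit p s 0 0"
    unfolding W_def by (rule bselect_sum[OF p r(1)])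
  hence 2: "((1 / v $ r) *\<^sub>C bselect p s 0 r) * W = bunit p s 0 0"
    using r(2) by (simp add: mult_scaleC_left scaleC_scaleC)
  have 3: "W \<noteq> 0" using 2 bunit_nonzero[OF p s n0 n0] by auto
  show ?thesis using that[OF 1 2 3] .
qed

lemma linear_clinop_apply: "linear (clinop_apply T)"
  by (rule bounded_linear.linear[OF bounded_linear_clinop_apply])

lemma range_clinop_mult: "range (clinop_apply (S * T)) = clinop_apply S ` range (clinop_apply T)"
  by (auto simp: clinop_apply_mult image_iff)

lemma infinite_dimensional_bunit:
  assumes p: "p \<ge> 1" and s: "s \<in> blocks p" and ne: "fst s \<noteq> UNIV"
  shows "\<not> finite_dimensional (range (clinop_apply (bunit p s 0 0 :: 'n::finite L2 clinop)))"
proof -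
  have "0 < bsize p s" using p by (simp add: bsize_def)
  hence j: "bidx p s 0 \<in> multi_idx p UNIV" by (rule bidx_in[OF s])
  have "bunit p s 0 0 = mat_unit p (fst s) (bidx p s 0) (bidx p s 0)"
    unfolding bunit_def by (rule mat_unit_cong) (simp add: bidx_def merge_def)
  thus ?thesis using infinite_dimensional_mat_unit[OF p j ne] by simp
qed

lemma infinite_dimensional_left_factor:
  assumes "K * W = bunit p s 0 0" "p \<ge> 1" "s \<in> blocks p" "fst s \<noteq> UNIV"
  shows "\<not> finite_dimensional (range (clinop_apply (W :: 'n::finite L2 clinop)))"
proof
  assume "finite_dimensional (range (clinop_apply W))"
  hence "finite_dimensional (range (clinop_apply (K * W)))"
    unfolding range_clinop_mult by (rule finite_dimensional_image[OF _ linear_clinop_apply])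
  thus False using infinite_dimensional_bunit[OF assms(2-4)] assms(1) by simp
qed

section \<open>The spectrum and the essential spectrum\<close>

lemma
  assumes p: "p \<ge> 1" and A: "A \<in> mixed_algebra p"
  shows mixed_algebra_shifted: "z *\<^sub>C 1 - A \<in> mixed_algebra p"
    and bmat_shifted: "s \<in> blocks p \<Longrightarrow> bmat p (z *\<^sub>C 1 - A) s = shifted (bmat p (A :: 'n::finite L2 clinop) s) z"
proof -
  have eq: "z *\<^sub>C 1 - A = z *\<^sub>C 1 + (- 1) *\<^sub>C A"
    using scaleC_diff_left[of 0 1 A] by simp
  show "z *\<^sub>C 1 - A \<in> mixed_algebra p"
    unfolding eq by (rule mixed_algebra_lincomb[OF p mixed_algebra_one[OF p] A])
  show "s \<in> blocks p \<Longrightarrow> bmat p (z *\<^sub>C 1 - A) s = shifted (bmat p A s) z"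
    unfolding eq by (simp add: bmat_lincomb[OF p mixed_algebra_one[OF p] A] bmat_one[OF p] shifted_def)
qed

lemma eigen_operator_shifted:
  assumes "A * W = w *\<^sub>C W" shows "(z *\<^sub>C 1 - A) * W = (z - w) *\<^sub>C (W :: 'n::finite L2 clinop)"
  using assms by (simp add: left_diff_distrib mult_scaleC_left scaleC_diff_left)

text \<open>Nonsingular blocks give an inverse inside the algebra. Conversely, an arbitrary bounded
  left inverse of \<open>z *\<^sub>C 1 - A\<close> would force \<open>W = 0\<close>. Thus
  invertibility among all bounded operators and within the algebra coincide.\<close>

lemma op_spectrum_eq:
  assumes p: "p \<ge> 1" and A: "(A :: 'n::finite L2 clinop) \<in> mixed_algebra p"
  shows "op_spectrum A = {z. \<exists>s\<in>blocks p. eigenvalue (bmat p A s) z}"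
proof (intro equalityI subsetI)
  fix z assume "z \<in> op_spectrum A"
  hence "\<not> invertible_op (z *\<^sub>C 1 - A)" by (simp add: op_spectrum_def)
  then obtain s where s: "s \<in> blocks p" "Determinant.det (bmat p (z *\<^sub>C 1 - A) s) = 0"
    using invertible_op_if_det[OF p mixed_algebra_shifted[OF p A]] by blast
  thus "z \<in> {z. \<exists>s\<in>blocks p. eigenvalue (bmat p A s) z}"
    by (auto simp: bmat_shifted[OF p A] det_shifted[OF bmat_carrier])
next
  fix z assume "z \<in> {z. \<exists>s\<in>blocks p. eigenvalue (bmat p A s) z}"
  then obtain s where s: "s \<in> blocks p" "eigenvalue (bmat p A s) z" by auto
  obtain W K where W: "A * W = z *\<^sub>C W" "K * W = bunit p s 0 0" "W \<noteq> 0"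
    using eigen_operator[OF p A s] .
  have "\<not> invertible_op (z *\<^sub>C 1 - A)"
  proof
    assume "invertible_op (z *\<^sub>C 1 - A)"
    then obtain C where C: "C * (z *\<^sub>C 1 - A) = 1" by (auto simp: invertible_op_def)
    have "W = C * ((z *\<^sub>C 1 - A) * W)" using C by (simp flip: mult.assoc)
    thus False using W(3) eigen_operator_shifted[OF W(1), of z] by simp
  qed
  thus "z \<in> op_spectrum A" by (simp add: op_spectrum_def)
qed

lemma essential_spectrum_contains:
  assumes p: "p \<ge> 1" and A: "(A :: 'n::finite L2 clinop) \<in> mixed_algebra p"
    and s: "s \<in> blocks p" "eigenvalue (bmat p A s) z" and ne: "fst s \<noteq> UNIV"
  shows "z \<in> essential_spectrum A"
proof -
  obtain W K where W: "A * W = z *\<^sub>C W" "K * W = bunit p s 0 0" "W \<noteq> 0"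
    using eigen_operator[OF p A s] .
  have "(z *\<^sub>C 1 - A) * W = 0" using eigen_operator_shifted[OF W(1), of z] by simp
  hence "range (clinop_apply W) \<subseteq> {u. clinop_apply (z *\<^sub>C 1 - A) u = 0}"
    by (auto simp flip: clinop_apply_mult)
  hence "\<not> finite_dimensional {u. clinop_apply (z *\<^sub>C 1 - A) u = 0}"
    using infinite_dimensional_left_factor[OF W(2) p s(1) ne] finite_dimensional_mono by blast
  thus ?thesis by (simp add: essential_spectrum_def fredholm_def)
qed

section \<open>Riesz projections\<close>

lemma finite_dimensional_range_sum:
  assumes "\<And>x. x \<in> I \<Longrightarrow> finite_dimensional (range (clinop_apply (T x)))"
  shows "finite_dimensional (range (clinop_apply (\<Sum>x\<in>I. T x)))"
  using assms
proof (induction I rule: infinite_finite_induct)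
  case (insert x I)
  obtain S1 where S1: "finite S1" "range (clinop_apply (T x)) \<subseteq> span S1"
    using insert.prems[of x] by (auto simp: finite_dimensional_def)
  have "finite_dimensional (range (clinop_apply (\<Sum>x\<in>I. T x)))"
    using insert by auto
  then obtain S2 where S2: "finite S2" "range (clinop_apply (\<Sum>x\<in>I. T x)) \<subseteq> span S2"
    by (auto simp: finite_dimensional_def)
  have "clinop_apply (\<Sum>x\<in>insert x I. T x) u \<in> span (S1 \<union> S2)" for u
  proof -
    have "clinop_apply (T x) u \<in> span (S1 \<union> S2)" "clinop_apply (\<Sum>x\<in>I. T x) u \<in> span (S1 \<union> S2)"
      using S1(2) S2(2) span_mono[of S1 "S1 \<union> S2"] span_mono[of S2 "S1 \<union> S2"] by auto
    thus ?thesis using insert.hyps by (simp add: clinop_apply_add span_add)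
  qed
  thus ?case using S1(1) S2(1) unfolding finite_dimensional_def by (intro exI[of _ "S1 \<union> S2"]) auto
qed (auto simp: finite_dimensional_def intro!: exI[of _ "{}"])

lemma finite_dimensional_range_scaleC:
  assumes "finite_dimensional (range (clinop_apply T))"
  shows "finite_dimensional (range (clinop_apply (c *\<^sub>C T)))"
proof -
  have "range (clinop_apply (c *\<^sub>C T)) = (\<lambda>x. c *\<^sub>C x) ` range (clinop_apply T)"
    by (auto simp: clinop_apply_scaleC image_iff)
  thus ?thesis
    using finite_dimensional_image[OF assms bounded_linear.linear[OF bounded_linear_scaleC]] by simp
qed

lemma bounded_linear_scaleC_left: "bounded_linear (\<lambda>z. z *\<^sub>C (x :: 'a::complex_normed_vector))"
  by (rule bounded_linear_intro[where K = "norm x"])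
     (simp_all add: scaleC_add_left norm_scaleC scaleR_scaleC scaleC_scaleC scaleR_conv_of_real)

text \<open>Cauchy's theorem in the parametrisation of \<open>has_riesz_projection\<close>. The
  larger radius \<open>d\<close> provides an open disc of holomorphy around the circle.\<close>

lemma circle_integral_zero:
  assumes "f holomorphic_on ball w d" "0 < r" "r < d"
  shows "((\<lambda>t. of_real r * cis t / of_real (2 * pi) * f (w + of_real r * cis t)) has_integral 0) {0..2 * pi}"
proof -
  have "(f has_contour_integral 0) (part_circlepath w r 0 (2 * pi))"
  proof (rule Cauchy_theorem_disc_simple[OF assms(1)])
    have "path_image (part_circlepath w r 0 (2 * pi)) \<subseteq> sphere w r"
      using path_image_part_circlepath_subset[of 0 "2 * pi" r w] assms(2) by simp
    thus "path_image (part_circlepath w r 0 (2 * pi)) \<subseteq> ball w d"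
      using assms(3) by force
    have "exp (\<i> * (2 * complex_of_real pi)) = 1" using exp_two_pi_i by (simp add: mult_ac)
    thus "pathfinish (part_circlepath w r 0 (2 * pi)) = pathstart (part_circlepath w r 0 (2 * pi))" by simp
  qed auto
  hence "((\<lambda>t. f (w + of_real r * cis t) * of_real r * \<i> * cis t) has_integral 0) {0..2 * pi}"
    by (subst (asm) has_contour_integral_part_circlepath_iff) auto
  \<comment> \<open>The factor i of dz cancels, and 1/(2 pi) remains as in the projection.\<close>
  from has_integral_mult_right[OF this, of "1 / (\<i> * of_real (2 * pi))"]
  show ?thesis by (simp add: field_simps)
qed

text \<open>On \<open>W\<close> the resolvent at z acts as the number 1/(z - w). On the circle this
  cancels the factor coming from dz, and the integrand is the constant \<open>W\<close> divided by 2
  pi.\<close>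

lemma riesz_projection_eigen_operator:
  assumes Q: "has_riesz_projection A w r Q" and r: "r > 0"
    and spec: "op_spectrum A \<inter> cball w r = {w}" and W: "A * W = w *\<^sub>C W"
  shows "Q * W = (W :: 'n::finite L2 clinop)"
proof -
  have inv: "inverse_op ((w + of_real r * cis t) *\<^sub>C 1 - A) * W = (1 / (of_real r * cis t)) *\<^sub>C W" for t
  proof -
    let ?z = "w + of_real r * cis t"
    let ?D = "?z *\<^sub>C 1 - A"
    have "?z \<in> cball w r" "?z \<noteq> w" using r by (auto simp: dist_norm norm_mult)
    hence "?z \<notin> op_spectrum A" using spec by blast
    hence "invertible_op ?D" by (simp add: op_spectrum_def)
    then obtain C where C: "?D * C = 1" "C * ?D = 1" by (auto simp: invertible_op_def)
    have "W = C * (?D * W)" using C by (simp flip: mult.assoc)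
    also have "\<dots> = (of_real r * cis t) *\<^sub>C (C * W)"
      by (simp add: eigen_operator_shifted[OF W] mult_scaleC_right)
    finally have "(1 / (of_real r * cis t)) *\<^sub>C W = (1 / (of_real r * cis t)) *\<^sub>C (of_real r * cis t) *\<^sub>C (C * W)"
      by simp
    also have "\<dots> = C * W" using r by (simp add: scaleC_scaleC)
    finally show ?thesis by (simp add: inverse_op_eq[OF C])
  qed
  have "((\<lambda>t. ((of_real r * cis t / of_real (2 * pi)) *\<^sub>C inverse_op ((w + of_real r * cis t) *\<^sub>C 1 - A)) * W)
      has_integral Q * W) {0..2 * pi}"
    using has_integral_linear[OF Q[unfolded has_riesz_projection_def] bounded_linear_mult_left[of W]]
    by (simp add: o_def)
  also have "(\<lambda>t. ((of_real r * cis t / of_real (2 * pi)) *\<^sub>C inverse_op ((w + of_real r * cis t) *\<^sub>C 1 - A)) * W) =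
      (\<lambda>t. (1 / of_real (2 * pi)) *\<^sub>C W)"
    using r by (auto simp: mult_scaleC_left inv scaleC_scaleC)
  finally have "((\<lambda>t. (1 / of_real (2 * pi)) *\<^sub>C W) has_integral Q * W) {0..2 * pi}" .
  moreover have "((\<lambda>t. (1 / of_real (2 * pi)) *\<^sub>C W) has_integral W) {0..2 * pi}"
    using has_integral_const_real[of "(1 / of_real (2 * pi)) *\<^sub>C W" 0 "2 * pi"]
    by (simp add: scaleR_scaleC scaleC_scaleC)
  ultimately show ?thesis by (rule has_integral_unique)
qed

lemma ex_finite_rank_riesz_projection:
  assumes p: "p \<ge> 1" and A: "(A :: 'n::finite L2 clinop) \<in> mixed_algebra p"
    and r: "0 < r" "r < d" and spec: "op_spectrum A \<inter> ball w d \<subseteq> {w}"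
    and ne: "\<And>s. s \<in> blocks p \<Longrightarrow> fst s \<noteq> UNIV \<Longrightarrow> \<not> eigenvalue (bmat p A s) w"
  shows "\<exists>Q. has_riesz_projection A w r Q \<and> finite_dimensional (range (clinop_apply Q))"
proof -
  define R where "R s z = minv (shifted (bmat p A s) z)" for s :: "'n set \<times> ('n \<Rightarrow> nat)" and z
  have noev: "\<not> eigenvalue (bmat p A s) z" if "s \<in> blocks p" "z \<in> ball w d" "z \<noteq> w" for s :: "'n set \<times> ('n \<Rightarrow> nat)" and z
    using spec that op_spectrum_eq[OF p A] by auto
  define g where "g s i j t = of_real r * cis t / of_real (2 * pi) * R s (w + of_real r * cis t) $$ (i, j)" for s :: "'n set \<times> ('n \<Rightarrow> nat)" and i j t
  have circle: "w + of_real r * cis t \<in> ball w d - {w}" for t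
    using r by (auto simp: dist_norm norm_mult)
  \<comment> \<open>In the block with full index set \<open>w\<close> may be a pole of the entries,
    so continuity on the circle only gives existence of the integral; in the other blocks the
    entries are holomorphic at \<open>w\<close> too, and the value is 0.\<close>
  have int: "\<exists>q. (g s i j has_integral q) {0..2 * pi} \<and> (fst s \<noteq> UNIV \<longrightarrow> q = 0)"
    if s: "s \<in> blocks p" and ij: "i < bsize p s" "j < bsize p s" for s :: "'n set \<times> ('n \<Rightarrow> nat)" and i j
  proof (cases "fst s = UNIV")
    case True
    have "(\<lambda>z. R s z $$ (i, j)) holomorphic_on ball w d - {w}"
      unfolding R_def by (rule holomorphic_minv_shifted[OF bmat_carrier _ ij]) (use noev[OF s] in auto)
    hence "continuous_on (ball w d - {w}) (\<lambda>z. R s z $$ (i, j))"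
      by (rule holomorphic_on_imp_continuous_on)
    hence "continuous_on {0..2 * pi} (\<lambda>t. R s (w + of_real r * cis t) $$ (i, j))"
      by (rule continuous_on_compose2) (use circle in \<open>auto intro!: continuous_intros\<close>)
    hence "continuous_on {0..2 * pi} (g s i j)"
      unfolding g_def[abs_def] by (intro continuous_intros) auto
    hence "g s i j integrable_on {0..2 * pi}" by (rule integrable_continuous_real)
    thus ?thesis using True by (auto simp: integrable_on_def)
  next
    case False
    have "(\<lambda>z. R s z $$ (i, j)) holomorphic_on ball w d"
      unfolding R_def by (rule holomorphic_minv_shifted[OF bmat_carrier _ ij]) (use noev[OF s] ne[OF s False] in auto)
    from circle_integral_zero[OF this r] show ?thesis by (auto simp: g_def[abs_def])
  qed
  define q where "q s i j = (SOME q. (g s i j has_integral q) {0..2 * pi} \<and> (fst s \<noteq> UNIV \<longrightarrow> q = 0))" for s :: "'n set \<times> ('n \<Rightarrow> nat)" and i j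
  have q: "(g s i j has_integral q s i j) {0..2 * pi}" "fst s \<noteq> UNIV \<Longrightarrow> q s i j = 0"
    if "s \<in> blocks p" "i < bsize p s" "j < bsize p s" for s :: "'n set \<times> ('n \<Rightarrow> nat)" and i j
    using someI_ex[OF int[OF that]] unfolding q_def by auto
  define Q where "Q = (\<Sum>s\<in>blocks p. \<Sum>i<bsize p s. \<Sum>j<bsize p s. q s i j *\<^sub>C bunit p s i j :: 'n L2 clinop)"
  have inv: "(of_real r * cis t / of_real (2 * pi)) *\<^sub>C inverse_op ((w + of_real r * cis t) *\<^sub>C 1 - A) =
      (\<Sum>s\<in>blocks p. \<Sum>i<bsize p s. \<Sum>j<bsize p s. g s i j t *\<^sub>C bunit p s i j)" for t
  proof -
    let ?z = "w + of_real r * cis t"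
    have "Determinant.det (bmat p (?z *\<^sub>C 1 - A) s) \<noteq> 0" if "s \<in> blocks p" for s :: "'n set \<times> ('n \<Rightarrow> nat)"
      using noev[OF that, of ?z] circle[of t] by (simp add: bmat_shifted[OF p A that] det_shifted[OF bmat_carrier])
    hence "inverse_op (?z *\<^sub>C 1 - A) = of_blocks p (\<lambda>s. minv (bmat p (?z *\<^sub>C 1 - A) s))"
      by (rule inverse_op_eq_of_blocks[OF p mixed_algebra_shifted[OF p A]])
    also have "\<dots> = of_blocks p (\<lambda>s. R s ?z)"
      unfolding of_blocks_def R_def by (intro sum.cong refl) (simp add: bmat_shifted[OF p A])
    finally show ?thesis
      by (simp add: of_blocks_def scaleC_sum_right scaleC_scaleC g_def)
  qed
  have "has_riesz_projection A w r Q"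
    unfolding has_riesz_projection_def inv Q_def
  proof (intro has_integral_sum finite_blocks finite_lessThan)
    fix s :: "'n set \<times> ('n \<Rightarrow> nat)" and i j assume "s \<in> blocks p" "i \<in> {..<bsize p s}" "j \<in> {..<bsize p s}"
    hence "(g s i j has_integral q s i j) {0..2 * pi}" by (intro q) auto
    from has_integral_linear[OF this bounded_linear_scaleC_left[of "bunit p s i j"]]
    show "((\<lambda>t. g s i j t *\<^sub>C bunit p s i j) has_integral q s i j *\<^sub>C bunit p s i j) {0..2 * pi}"
      by (simp add: o_def)
  qed
  moreover have "finite_dimensional (range (clinop_apply Q))"
    unfolding Q_def
  proof (intro finite_dimensional_range_sum)
    fix s :: "'n set \<times> ('n \<Rightarrow> nat)" and i j assume s: "s \<in> blocks p" "i \<in> {..<bsize p s}" "j \<in> {..<bsize p s}"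
    show "finite_dimensional (range (clinop_apply (q s i j *\<^sub>C bunit p s i j)))"
    proof (cases "fst s = UNIV")
      case True
      thus ?thesis
        by (intro finite_dimensional_range_scaleC) (simp add: bunit_def finite_dimensional_mat_unit_UNIV)
    next
      case False
      hence "q s i j = 0" using q(2)[of s i j] s by simp
      thus ?thesis by (auto simp: finite_dimensional_def intro!: exI[of _ "{}"])
    qed
  qed
  ultimately show ?thesis by blast
qed

text \<open>The spectrum is finite, so all its points are isolated and the rank of the projection
  alone decides. Exclusion of a point is proved for every admissible radius, membership for
  one.\<close>

lemma discrete_spectrum_eq:
  assumes p: "p \<ge> 1" and A: "(A :: 'n::finite L2 clinop) \<in> mixed_algebra p"
  shows "discrete_spectrum A = op_spectrum A - {z. \<exists>s\<in>blocks p. fst s \<noteq> UNIV \<and> eigenvalue (bmat p A s) z}"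
proof (intro equalityI subsetI)
  fix w assume "w \<in> discrete_spectrum A"
  then obtain r Q where r: "r > 0" and spec: "op_spectrum A \<inter> cball w r = {w}"
    and Q: "has_riesz_projection A w r Q" and fin: "finite_dimensional (range (clinop_apply Q))"
    by (auto simp: discrete_spectrum_def)
  have "\<not> eigenvalue (bmat p A s) w" if s: "s \<in> blocks p" "fst s \<noteq> UNIV" for s
  proof
    assume "eigenvalue (bmat p A s) w"
    then obtain W K where W: "A * W = w *\<^sub>C W" "K * W = bunit p s 0 0" "W \<noteq> 0"
      using eigen_operator[OF p A s(1)] by blast
    have "Q * W = W" by (rule riesz_projection_eigen_operator[OF Q r spec W(1)])
    hence "range (clinop_apply W) \<subseteq> range (clinop_apply Q)"
      by (metis clinop_apply_mult image_subsetI rangeI)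
    thus False
      using infinite_dimensional_left_factor[OF W(2) p s] finite_dimensional_mono[OF fin] by blast
  qed
  thus "w \<in> op_spectrum A - {z. \<exists>s\<in>blocks p. fst s \<noteq> UNIV \<and> eigenvalue (bmat p A s) z}"
    using spec by auto
next
  fix w assume w: "w \<in> op_spectrum A - {z. \<exists>s\<in>blocks p. fst s \<noteq> UNIV \<and> eigenvalue (bmat p A s) z}"
  have "op_spectrum A = (\<Union>s\<in>blocks p. {z. eigenvalue (bmat p A s) z})"
    unfolding op_spectrum_eq[OF p A] by auto
  hence "finite (op_spectrum A)"
    by (simp add: finite_eigenvalues[OF bmat_carrier])
  \<comment> \<open>Half of this distance will be the radius, so that the circle lies inside a disc
    without further spectrum.\<close>
  then obtain d where d: "d > 0" "\<And>x. x \<in> op_spectrum A \<Longrightarrow> x \<noteq> w \<Longrightarrow> d \<le> dist w x"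
    using finite_set_avoid[of "op_spectrum A" w] by blast
  have "op_spectrum A \<inter> ball w d \<subseteq> {w}" using d(2) by force
  moreover have "op_spectrum A \<inter> cball w (d / 2) = {w}"
    using w d by force
  moreover have "\<exists>Q. has_riesz_projection A w (d / 2) Q \<and> finite_dimensional (range (clinop_apply Q))"
    by (rule ex_finite_rank_riesz_projection[OF p A _ _ calculation(1)]) (use d(1) w in auto)
  ultimately show "w \<in> discrete_spectrum A"
    using d(1) unfolding discrete_spectrum_def by (auto intro!: exI[of _ "d / 2"])
qed

section \<open>The number of blocks\<close>

text \<open>Each coordinate either belongs to \<alpha> or carries one of \<open>p\<close> values of
  the block label, which makes \<open>p + 1\<close> possibilities.\<close>

lemma card_blocks:
  "card (blocks p :: ('n::finite set \<times> ('n \<Rightarrow> nat)) set) = (p + 1) ^ CARD('n)"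
proof -
  have "card (blocks p :: ('n set \<times> ('n \<Rightarrow> nat)) set) = (\<Sum>\<alpha>\<in>UNIV. card (multi_idx p (- \<alpha> :: 'n set)))"
    by (simp add: blocks_def)
  also have "\<dots> = (\<Sum>\<alpha>\<in>Pow (UNIV :: 'n set). (\<Prod>n\<in>\<alpha>. 1) * (\<Prod>n\<in>UNIV - \<alpha>. p))"
    by (simp add: card_multi_idx Compl_eq_Diff_UNIV)
  also have "\<dots> = (\<Prod>n\<in>(UNIV :: 'n set). 1 + p)"
    by (rule prod_add[symmetric]) simp
  finally show ?thesis by simp
qed

section \<open>Passage from blocks to the form of the theorem\<close>

lemma ball_blocks:
  "(\<forall>s\<in>blocks p. P (fst s) (snd s)) \<longleftrightarrow> (\<forall>\<alpha>. \<forall>i\<in>multi_idx p (- \<alpha>). P \<alpha> i)"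
  by (auto simp: blocks_def)

lemma bex_blocks:
  "(\<exists>s\<in>blocks p. P (fst s) (snd s)) \<longleftrightarrow> (\<exists>\<alpha>. \<exists>i\<in>multi_idx p (- \<alpha>). P \<alpha> i)"
  by (auto simp: blocks_def Bex_def)

lemma sigma_map_eq: "sigma_map p T = (\<lambda>s\<in>blocks p. bmat p T s)"
  by (simp add: sigma_map_def bmat_def split_def)

lemma tau_eq: "s \<in> blocks p \<Longrightarrow> tau p T s = mat_trace (bmat p T s)"
  by (simp add: tau_def bmat_def split_def)

lemma det_map_eq: "s \<in> blocks p \<Longrightarrow> det_map p T s = Determinant.det (bmat p T s)"
  by (simp add: det_map_def bmat_def split_def)

lemma mat_trace_lincomb:
  assumes "M \<in> carrier_mat n n" "M' \<in> carrier_mat n n"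
  shows "mat_trace (l \<cdot>\<^sub>m M + m \<cdot>\<^sub>m M') = l * mat_trace M + m * mat_trace M'"
  using assms by (simp add: mat_trace_def sum.distrib sum_distrib_left)

lemma invertible_op_iff_det:
  assumes p: "p \<ge> 1" and A: "(A :: 'n::finite L2 clinop) \<in> mixed_algebra p"
  shows "invertible_op A \<longleftrightarrow> (\<forall>s\<in>blocks p. Determinant.det (bmat p A s) \<noteq> 0)"
proof
  assume inv: "invertible_op A"
  \<comment> \<open>Writing \<open>A\<close> as 0 - (- \<open>A\<close>) makes the description of
    the spectrum applicable, at the point 0 and for - \<open>A\<close>.\<close>
  have "invertible_op (0 *\<^sub>C 1 - (- 1) *\<^sub>C A)"
  proof -
    have "0 *\<^sub>C 1 - (- 1) *\<^sub>C A = A"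
      using scaleC_diff_left[of 0 1 A] by simp
    thus ?thesis using inv by simp
  qed
  hence *: "0 \<notin> op_spectrum ((- 1) *\<^sub>C A)" by (simp add: op_spectrum_def)
  show "\<forall>s\<in>blocks p. Determinant.det (bmat p A s) \<noteq> 0"
  proof
    fix s :: "'n set \<times> ('n \<Rightarrow> nat)" assume s: "s \<in> blocks p"
    have "\<not> eigenvalue (bmat p ((- 1) *\<^sub>C A) s) 0"
      using * s op_spectrum_eq[OF p mixed_algebra_scaleC[OF A, of "- 1"]] by auto
    hence "Determinant.det (bmat p (0 *\<^sub>C 1 - (- 1) *\<^sub>C A) s) \<noteq> 0"
      by (simp add: bmat_shifted[OF p mixed_algebra_scaleC[OF A] s] det_shifted[OF bmat_carrier] del: scaleC_zero_left)
    moreover have "0 *\<^sub>C 1 - (- 1) *\<^sub>C A = A"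
      using scaleC_diff_left[of 0 1 A] by simp
    ultimately show "Determinant.det (bmat p A s) \<noteq> 0" by (simp only: not_False_eq_True)
  qed
next
  assume "\<forall>s\<in>blocks p. Determinant.det (bmat p A s) \<noteq> 0"
  thus "invertible_op A" using invertible_op_if_det[OF p A] by blast
qed

text \<open>The blocks of the inverse are the inverse blocks, and \<open>sigma_map\<close> is
  injective on the algebra, so \<open>inv_into\<close> finds this operator and no other.\<close>

lemma inverse_op_eq_inv_sigma_map:
  assumes p: "p \<ge> 1" and A: "(A :: 'n::finite L2 clinop) \<in> mixed_algebra p" and inv: "invertible_op A"
  shows "inverse_op A \<in> mixed_algebra p"
    and "inverse_op A = inv_into (mixed_algebra p) (sigma_map p) (\<lambda>s\<in>blocks p. the (mat_inverse (bmat p A s)))"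
proof -
  have det: "Determinant.det (bmat p A s) \<noteq> 0" if "s \<in> blocks p" for s :: "'n set \<times> ('n \<Rightarrow> nat)"
    using inv that invertible_op_iff_det[OF p A] by blast
  have carr: "minv (bmat p A s) \<in> carrier_mat (bsize p s) (bsize p s)"
    if "s \<in> blocks p" for s :: "'n set \<times> ('n \<Rightarrow> nat)"
    using minv(1)[OF bmat_carrier det[OF that]] .
  have eq: "inverse_op A = of_blocks p (\<lambda>s. minv (bmat p A s))"
    by (rule inverse_op_eq_of_blocks[OF p A det])
  show 1: "inverse_op A \<in> mixed_algebra p"
    unfolding eq by (rule of_blocks_in[OF p carr])
  have "sigma_map p (inverse_op A) = (\<lambda>s\<in>blocks p. the (mat_inverse (bmat p A s)))"
    unfolding sigma_map_eq eq
    by (rule restrict_ext) (simp add: bmat_of_blocks[OF p carr] mat_inverse_eq_minv[OF bmat_carrier det])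
  moreover have "inj_on (sigma_map p) (mixed_algebra p :: 'n L2 clinop set)"
  proof (rule inj_onI)
    fix S T :: "'n L2 clinop" assume ST: "S \<in> mixed_algebra p" "T \<in> mixed_algebra p" "sigma_map p S = sigma_map p T"
    show "S = T"
    proof (rule bmat_inject[OF p ST(1,2)])
      fix s :: "'n set \<times> ('n \<Rightarrow> nat)" assume "s \<in> blocks p"
      thus "bmat p S s = bmat p T s" using fun_cong[OF ST(3), of s] by (simp add: sigma_map_eq)
    qed
  qed
  ultimately show "inverse_op A = inv_into (mixed_algebra p) (sigma_map p) (\<lambda>s\<in>blocks p. the (mat_inverse (bmat p A s)))"
    using inv_into_f_f[OF _ 1] by metis
qed

text \<open>The difference in (ii) accounts for eigenvalues that the full block shares with another
  one: these lie in the essential spectrum, and no Riesz projection at them has finite rank. The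
  full block occurs once, as \<open>multi_idx p (- UNIV)\<close> has a single element.\<close>

theorem corollary1p2:
  fixes p :: nat
    and A B :: "'n::finite L2 clinop"
    and l m :: complex
  assumes p: "p \<ge> 1"
    and A: "A \<in> mixed_algebra p"
    and B: "B \<in> mixed_algebra p"
  shows
    "\<comment> \<open>(i)\<close>
     (invertible_op A \<longleftrightarrow> (\<forall>\<alpha>. \<forall>i\<in>multi_idx p (- \<alpha>). invertible_mat (B_mat p A \<alpha> i)))
     \<and> (invertible_op A \<longrightarrow>
          inverse_op A \<in> mixed_algebra p
          \<and> inverse_op A = inv_into (mixed_algebra p) (sigma_map p)
               (\<lambda>(\<alpha>, i)\<in>blocks p. the (mat_inverse (B_mat p A \<alpha> i))))
     \<comment> \<open>(ii)\<close>
     \<and> op_spectrum A = {z. \<exists>\<alpha>. \<exists>i\<in>multi_idx p (- \<alpha>). eigenvalue (B_mat p A \<alpha> i) z}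
     \<and> discrete_spectrum A =
          {z. \<exists>i\<in>multi_idx p (- UNIV). eigenvalue (B_mat p A UNIV i) z}
          - {z. \<exists>\<alpha>. \<alpha> \<noteq> UNIV \<and> (\<exists>i\<in>multi_idx p (- \<alpha>). eigenvalue (B_mat p A \<alpha> i) z)}
     \<and> {z. \<exists>\<alpha>. \<alpha> \<noteq> UNIV \<and> (\<exists>i\<in>multi_idx p (- \<alpha>). eigenvalue (B_mat p A \<alpha> i) z)}
          \<subseteq> essential_spectrum A
     \<comment> \<open>(iii)\<close>
     \<and> card (blocks p :: ('n set \<times> ('n \<Rightarrow> nat)) set)
          = (\<Sum>n = 0..CARD('n). (CARD('n) choose n) * p ^ (CARD('n) - n))
     \<and> card (blocks p :: ('n set \<times> ('n \<Rightarrow> nat)) set) = (p + 1) ^ CARD('n)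
     \<and> l *\<^sub>C A + m *\<^sub>C B \<in> mixed_algebra p \<and> A * B \<in> mixed_algebra p \<and> exp A \<in> mixed_algebra p
     \<and> (\<forall>s\<in>blocks p. tau p (l *\<^sub>C A + m *\<^sub>C B) s = l * tau p A s + m * tau p B s)
     \<and> tau p (A * B) = tau p (B * A)
     \<and> (\<forall>s\<in>blocks p. det_map p (A * B) s = det_map p A s * det_map p B s)
     \<and> (\<forall>s\<in>blocks p. det_map p (exp A) s = exp (tau p A s))
     \<and> (invertible_op A \<longleftrightarrow> (\<forall>s\<in>blocks p. det_map p A s \<noteq> 0))"
proof -
  have inv_iff: "invertible_op A \<longleftrightarrow> (\<forall>s\<in>blocks p. Determinant.det (bmat p A s) \<noteq> 0)"
    by (rule invertible_op_iff_det[OF p A])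
  have i1: "invertible_op A \<longleftrightarrow> (\<forall>\<alpha>. \<forall>i\<in>multi_idx p (- \<alpha>). invertible_mat (B_mat p A \<alpha> i))"
    unfolding inv_iff invertible_mat_iff_det[OF bmat_carrier, symmetric] unfolding bmat_def by (rule ball_blocks)
  have restr: "(\<lambda>(\<alpha>, i)\<in>blocks p. the (mat_inverse (B_mat p A \<alpha> i))) = (\<lambda>s\<in>blocks p. the (mat_inverse (bmat p A s)))"
    by (simp add: bmat_def split_def)
  have i2: "invertible_op A \<longrightarrow> inverse_op A \<in> mixed_algebra p
      \<and> inverse_op A = inv_into (mixed_algebra p) (sigma_map p)
          (\<lambda>(\<alpha>, i)\<in>blocks p. the (mat_inverse (B_mat p A \<alpha> i)))"
    unfolding restr using inverse_op_eq_inv_sigma_map[OF p A] by blast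
  have ii1: "op_spectrum A = {z. \<exists>\<alpha>. \<exists>i\<in>multi_idx p (- \<alpha>). eigenvalue (B_mat p A \<alpha> i) z}"
    unfolding op_spectrum_eq[OF p A] bmat_def by (rule Collect_cong) (rule bex_blocks)
  have ne: "{z. \<exists>\<alpha>. \<alpha> \<noteq> UNIV \<and> (\<exists>i\<in>multi_idx p (- \<alpha>). eigenvalue (B_mat p A \<alpha> i) z)} =
      {z. \<exists>s\<in>blocks p. fst s \<noteq> UNIV \<and> eigenvalue (bmat p A s) z}"
    by (rule Collect_cong) (auto simp: bmat_def blocks_def)
  have ii2: "discrete_spectrum A =
        {z. \<exists>i\<in>multi_idx p (- UNIV). eigenvalue (B_mat p A UNIV i) z}
        - {z. \<exists>\<alpha>. \<alpha> \<noteq> UNIV \<and> (\<exists>i\<in>multi_idx p (- \<alpha>). eigenvalue (B_mat p A \<alpha> i) z)}"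
  proof -
    have "{z. \<exists>\<alpha>. E \<alpha> z} - {z. \<exists>\<alpha>. \<alpha> \<noteq> UNIV \<and> E \<alpha> z} = {z. E UNIV z} - {z. \<exists>\<alpha>. \<alpha> \<noteq> UNIV \<and> E \<alpha> z}"
      for E :: "'n set \<Rightarrow> complex \<Rightarrow> bool"
    proof -
      have "(\<exists>\<alpha>. E \<alpha> z) \<longleftrightarrow> E UNIV z" if "\<not> (\<exists>\<alpha>. \<alpha> \<noteq> UNIV \<and> E \<alpha> z)" for z
        using that by metis
      thus ?thesis unfolding set_diff_eq mem_Collect_eq by (intro Collect_cong) metis
    qed
    thus ?thesis unfolding discrete_spectrum_eq[OF p A] ne[symmetric] ii1 .
  qed
  have ii3: "{z. \<exists>\<alpha>. \<alpha> \<noteq> UNIV \<and> (\<exists>i\<in>multi_idx p (- \<alpha>). eigenvalue (B_mat p A \<alpha> i) z)} \<subseteq> essential_spectrum A"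
    unfolding ne using essential_spectrum_contains[OF p A] by blast
  have card: "card (blocks p :: ('n set \<times> ('n \<Rightarrow> nat)) set)
      = (\<Sum>n = 0..CARD('n). (CARD('n) choose n) * p ^ (CARD('n) - n))"
    using binomial[of 1 p "CARD('n)"] by (simp add: card_blocks atLeast0AtMost add.commute)
  have tau_lin: "\<forall>s\<in>blocks p. tau p (l *\<^sub>C A + m *\<^sub>C B) s = l * tau p A s + m * tau p B s"
    by (simp add: tau_eq bmat_lincomb[OF p A B] mat_trace_lincomb[OF bmat_carrier bmat_carrier])
  have tau_mult: "tau p (A * B) = tau p (B * A)"
  proof
    fix s :: "'n set \<times> ('n \<Rightarrow> nat)"
    show "tau p (A * B) s = tau p (B * A) s"
    proof (cases "s \<in> blocks p")
      case True
      thus ?thesis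
        by (simp add: tau_eq bmat_mult[OF p A B] bmat_mult[OF p B A] mat_trace_mult_commute[OF bmat_carrier bmat_carrier])
    qed (simp add: tau_def)
  qed
  have det_mult: "\<forall>s\<in>blocks p. det_map p (A * B) s = det_map p A s * det_map p B s"
    by (simp add: det_map_eq bmat_mult[OF p A B] Determinant.det_mult[OF bmat_carrier bmat_carrier])
  have det_exp: "\<forall>s\<in>blocks p. det_map p (exp A) s = exp (tau p A s)"
    by (simp add: det_map_eq tau_eq det_bmat_exp[OF p A])
  have inv_det: "invertible_op A \<longleftrightarrow> (\<forall>s\<in>blocks p. det_map p A s \<noteq> 0)"
    by (simp add: inv_iff det_map_eq)
  show ?thesis
    by (intro conjI i1 i2 ii1 ii2 ii3 card card_blocks mixed_algebra_lincomb[OF p A B] mixed_algebra_mult[OF p A B]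
        mixed_algebra_exp[OF p A] tau_lin tau_mult det_mult det_exp inv_det)
qed

end
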